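(* Let $n\ge1$ and $m=n+3$. Under the direct sum decomposition $$U\mathfrak{p}_{m} = U\mathfrak{f}_{m-2} \oplus U\mathfrak{p}_{m}\, s(\mathfrak{p}_{m-1}),$$ the formal polylogs $l_{a,\kappa}\in (U\mathfrak{p}_{m})^*$ (with $a=(a_1,\dots,a_N)\in\mathbb Z_{\ge1}^N$ and $\kappa:\{1,\dots,N\}\to\{1,\dots,n\}$ non-decreasing) vanish on $U\mathfrak{p}_{m}\, s(\mathfrak{p}_{m-1})$, and for any $u \in U\mathfrak{f}_{m-2}$, $l_{a,\kappa}(u)$ is $(-1)^N$ times the coefficient in $u$ of the monomial $$w_{a,\kappa} = X_{\beta\omega}^{a_N - 1} X_{\kappa(N)\beta}\,X_{\beta\omega}^{a_{N-1} - 1} X_{\kappa(N-1)\beta}\cdots X_{\beta\omega}^{a_1 - 1} X_{\kappa(1)\beta} \in U\mathfrak{f}_{m-2}.$$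
   Context: The ground field is $\mathbb{C}$; $n\ge1$, $m=n+3$, $\mathcal S=\{\alpha,1,\dots,n,\beta,\omega\}$. Lie algebras. $\mathfrak{p}_m$ is the Lie algebra with generators $X_{ab}=X_{ba}$ ($a\ne b$ in $\mathcal S$) and relations $\sum_{b\ne a}X_{ab}=0$ for each $a\in\mathcal S$, and $[X_{ab},X_{cd}]=0$ for $a,b,c,d$ all distinct. It is graded with $\deg X_{ab}=1$; a basis of its degree-one part is $X_{\alpha i},X_{i\beta}$ ($1\le i\le n$), $X_{ij}$ ($1\le i<j\le n$). $\mathfrak{p}_{m-1}$ is defined in the same way with index set $\mathcal S\setminus\{\beta\}=\{\alpha,1,\dots,n,\omega\}$. The map $\pi_\beta:\mathfrak p_m\to\mathfrak p_{m-1}$ sends $X_{\beta v}\mapsto 0$ and the other generators to the generators of the same name. Its kernel $\mathfrak f_{m-2}=\mathfrak f_{n+1}$ is the free Lie algebra on $X_{1\beta},\dots,X_{n\beta},X_{\beta\omega}$, so $U\mathfrak f_{m-2}\subset U\mathfrak p_m$ is the free associative algebra on these generators. $\pi_\beta$ has a Lie algebra section $s:\mathfrak{p}_{m-1}\to\mathfrak{p}_m$ determined by $s(X_{\alpha i})=X_{\alpha i}$ ($1\le i\le n-1$), $s(X_{ij})=X_{ij}$ ($1\le i<j\le n$). $U\mathfrak g$ is the universal enveloping algebra, $(U\mathfrak{p}_m)^*$ is the graded dual, and $\varepsilon\in(U\mathfrak p_m)^*$ is the counit. Polylogarithms. Use coordinates $(x_1,\dots,x_n)$, $z_i=x_ix_{i+1}\cdots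 x_n$, $z_\beta=1$, and $\mathcal D=\{|x_i|<1\ \forall i\}$. For $N\ge 0$, $a=(a_1,\dots,a_N)\in\mathbb Z_{\ge1}^N$ and a non-decreasing $\kappa:\{1,\dots,N\}\to\{1,\dots,n\}$ put $\kappa(N+1):=\beta$, $y_{\kappa,i}=z_{\kappa(i)}/z_{\kappa(i+1)}$ and $$L_{a,\kappa}(x_1,\dots,x_n)=\sum_{0<k_1<\dots<k_N}\frac{y_{\kappa,1}^{k_1}\cdots y_{\kappa,N}^{k_N}}{k_1^{a_1}\cdots k_N^{a_N}},$$ with $L_\emptyset=1$ (and $w_\emptyset=1$) for $N=0$. Formal polylogs. For $\varphi\in(U\mathfrak p_m)^*$ and $X\in\mathfrak p_m$ of degree one let $\varphi_X(u):=\varphi(Xu)$. Let $\iota:(U\mathfrak p_m)^*\to\mathcal O(\mathcal D)[\log x_1,\dots,\log x_n]$ be the (Chen) iterated integral map from the tangential base point at $x=0$ in direction $(1,\dots,1)$, i.e. the unique linear map with $\iota(\varepsilon)=1$, $$d\,\iota(\varphi)=\sum_{i=1}^n\Big(\iota(\varphi_{X_{\alpha i}})\frac{dz_i}{z_i}+\iota(\varphi_{X_{i\beta}})\frac{dz_i}{z_i-1}\Big)+\sum_{i<j}\iota(\varphi_{X_{ij}})\frac{d(z_i-z_j)}{z_i-z_j},$$ and such that for $\varphi$ homogeneous of positive degree the coefficient of $(\log x_1)^0\cdots(\log x_n)^0$ in $\iota(\varphi)$ vanishes at $x=0$. It is known that $\iota$ is injective and that every $L_{a,\kappa}$ is in its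 image. The formal polylog $l_{a,\kappa}\in(U\mathfrak p_m)^*$ is the unique element with $\iota(l_{a,\kappa})=L_{a,\kappa}$ (so $l_\emptyset=\varepsilon$). *)

theory Defs
  imports "HOL-Analysis.Analysis" "HOL-Library.Poly_Mapping"
begin

section \<open>Complex vector spaces, algebras and Lie algebras\<close>

class scaleC =
  fixes scaleC :: "complex \<Rightarrow> 'a \<Rightarrow> 'a"  (infixr \<open>*\<^sub>C\<close> 75)

class complex_vec = scaleC + ab_group_add +
  assumes scaleC_add_right: "c *\<^sub>C (x + y) = c *\<^sub>C x + c *\<^sub>C y"
    and scaleC_add_left: "(c + d) *\<^sub>C x = c *\<^sub>C x + d *\<^sub>C x"
    and scaleC_scaleC: "c *\<^sub>C d *\<^sub>C x = (c * d) *\<^sub>C x"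
    and scaleC_one: "1 *\<^sub>C x = x"

global_interpretation cvec: vector_space "scaleC :: complex \<Rightarrow> 'a \<Rightarrow> 'a::complex_vec"
  by standard (simp_all add: scaleC_add_right scaleC_add_left scaleC_scaleC scaleC_one)

class complex_alg = complex_vec + ring_1 +
  assumes scaleC_mult_left: "(c *\<^sub>C x) * y = c *\<^sub>C (x * y)"
    and scaleC_mult_right: "x * (c *\<^sub>C y) = c *\<^sub>C (x * y)"

class lie_alg = complex_vec +
  fixes lie :: "'a \<Rightarrow> 'a \<Rightarrow> 'a"
  assumes lie_add_left: "lie (x + y) z = lie x z + lie y z"
    and lie_add_right: "lie x (y + z) = lie x y + lie x z"
    and lie_scaleC_left: "lie (c *\<^sub>C x) y = c *\<^sub>C lie x y"
    and lie_scaleC_right: "lie x (c *\<^sub>C y) = c *\<^sub>C lie x y"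
    and lie_self: "lie x x = 0"
    and jacobi: "lie x (lie y z) + lie y (lie z x) + lie z (lie x y) = 0"

definition lie_hom :: "('a::lie_alg \<Rightarrow> 'b::lie_alg) \<Rightarrow> bool" where
  "lie_hom f \<longleftrightarrow> Vector_Spaces.linear scaleC scaleC f \<and> (\<forall>x y. f (lie x y) = lie (f x) (f y))"

definition direct_sum :: "'a::complex_vec set \<Rightarrow> 'a set \<Rightarrow> bool" where
  "direct_sum A B \<longleftrightarrow> cvec.subspace A \<and> cvec.subspace B \<and>
     (\<forall>u. \<exists>a\<in>A. \<exists>b\<in>B. u = a + b) \<and> A \<inter> B = {0}"


section \<open>The Lie algebra with generators \<open>X\<^sub>a\<^sub>b\<close> on a finite index type\<close>

text \<open>
  Lie algebra terms in the generators, modulo the least congruence that contains the axioms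
  of a complex Lie algebra and the defining relations.
\<close>

datatype 's lie_term = LGen 's 's | LZero | LAdd "'s lie_term" "'s lie_term"
  | LScale complex "'s lie_term" | LBr "'s lie_term" "'s lie_term"

text \<open>
  The generators are indexed by all ordered pairs; \<open>X\<^sub>a\<^sub>a\<close>, which is not a generator in the
  mathematical presentation, is removed by the relation \<open>X\<^sub>a\<^sub>a = 0\<close>.
\<close>

inductive lie_eq :: "'s::finite lie_term \<Rightarrow> 's lie_term \<Rightarrow> bool" where
  le_refl: "lie_eq t t"
| le_sym: "lie_eq t u \<Longrightarrow> lie_eq u t"
| le_trans: "lie_eq t u \<Longrightarrow> lie_eq u v \<Longrightarrow> lie_eq t v"
| le_cong_add: "lie_eq t t' \<Longrightarrow> lie_eq u u' \<Longrightarrow> lie_eq (LAdd t u) (LAdd t' u')"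
| le_cong_scale: "lie_eq t t' \<Longrightarrow> lie_eq (LScale c t) (LScale c t')"
| le_cong_br: "lie_eq t t' \<Longrightarrow> lie_eq u u' \<Longrightarrow> lie_eq (LBr t u) (LBr t' u')"
| le_add_assoc: "lie_eq (LAdd (LAdd t u) v) (LAdd t (LAdd u v))"
| le_add_comm: "lie_eq (LAdd t u) (LAdd u t)"
| le_add_zero: "lie_eq (LAdd LZero t) t"
| le_add_inv: "lie_eq (LAdd (LScale (- 1) t) t) LZero"
| le_scale_add: "lie_eq (LScale c (LAdd t u)) (LAdd (LScale c t) (LScale c u))"
| le_add_scale: "lie_eq (LScale (c + d) t) (LAdd (LScale c t) (LScale d t))"
| le_scale_scale: "lie_eq (LScale c (LScale d t)) (LScale (c * d) t)"
| le_scale_one: "lie_eq (LScale 1 t) t"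
| le_br_add_left: "lie_eq (LBr (LAdd t u) v) (LAdd (LBr t v) (LBr u v))"
| le_br_add_right: "lie_eq (LBr t (LAdd u v)) (LAdd (LBr t u) (LBr t v))"
| le_br_scale_left: "lie_eq (LBr (LScale c t) u) (LScale c (LBr t u))"
| le_br_scale_right: "lie_eq (LBr t (LScale c u)) (LScale c (LBr t u))"
| le_br_self: "lie_eq (LBr t t) LZero"
| le_jacobi: "lie_eq (LAdd (LAdd (LBr t (LBr u v)) (LBr u (LBr v t))) (LBr v (LBr t u))) LZero"
| le_gen_diag: "lie_eq (LGen a a) LZero"
| le_gen_sym: "lie_eq (LGen a b) (LGen b a)"
| le_gen_sum: "distinct bs \<Longrightarrow> set bs = UNIV - {a} \<Longrightarrow>
    lie_eq (foldr LAdd (map (LGen a) bs) LZero) LZero"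
| le_gen_comm: "distinct [a, b, c, d] \<Longrightarrow> lie_eq (LBr (LGen a b) (LGen c d)) LZero"

quotient_type 's braid_lie = "'s::finite lie_term" / lie_eq
  by (rule equivpI) (auto simp: reflp_def symp_def transp_def intro: lie_eq.intros)

instantiation braid_lie :: (finite) lie_alg
begin

lift_definition zero_braid_lie :: "'a braid_lie" is LZero .
lift_definition plus_braid_lie :: "'a braid_lie \<Rightarrow> 'a braid_lie \<Rightarrow> 'a braid_lie" is LAdd
  by (rule le_cong_add)
lift_definition scaleC_braid_lie :: "complex \<Rightarrow> 'a braid_lie \<Rightarrow> 'a braid_lie" is LScale
  by (rule le_cong_scale)
lift_definition lie_braid_lie :: "'a braid_lie \<Rightarrow> 'a braid_lie \<Rightarrow> 'a braid_lie" is LBr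
  by (rule le_cong_br)
definition uminus_braid_lie :: "'a braid_lie \<Rightarrow> 'a braid_lie" where
  "uminus_braid_lie x = (- 1) *\<^sub>C x"
definition minus_braid_lie :: "'a braid_lie \<Rightarrow> 'a braid_lie \<Rightarrow> 'a braid_lie" where
  "minus_braid_lie x y = x + - y"

instance
proof
  fix x y z :: "'a braid_lie" and c d :: complex
  show "x + y + z = x + (y + z)" by transfer (rule le_add_assoc)
  show "x + y = y + x" by transfer (rule le_add_comm)
  show "0 + x = x" by transfer (rule le_add_zero)
  show "- x + x = 0" unfolding uminus_braid_lie_def by transfer (rule le_add_inv)
  show "x - y = x + - y" by (rule minus_braid_lie_def)
  show "c *\<^sub>C (x + y) = c *\<^sub>C x + c *\<^sub>C y" by transfer (rule le_scale_add)
  show "(c + d) *\<^sub>C x = c *\<^sub>C x + d *\<^sub>C x" by transfer (rule le_add_scale)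
  show "c *\<^sub>C d *\<^sub>C x = (c * d) *\<^sub>C x" by transfer (rule le_scale_scale)
  show "1 *\<^sub>C x = x" by transfer (rule le_scale_one)
  show "lie (x + y) z = lie x z + lie y z" by transfer (rule le_br_add_left)
  show "lie x (y + z) = lie x y + lie x z" by transfer (rule le_br_add_right)
  show "lie (c *\<^sub>C x) y = c *\<^sub>C lie x y" by transfer (rule le_br_scale_left)
  show "lie x (c *\<^sub>C y) = c *\<^sub>C lie x y" by transfer (rule le_br_scale_right)
  show "lie x x = 0" by transfer (rule le_br_self)
  show "lie x (lie y z) + lie y (lie z x) + lie z (lie x y) = 0" by transfer (rule le_jacobi)
qed

end

lift_definition gX :: "'s::finite \<Rightarrow> 's \<Rightarrow> 's braid_lie" is LGen .


section \<open>The universal enveloping algebra\<close>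

text \<open>
  \<open>U\<gg>\<close> is the unital associative algebra generated by the elements of \<open>\<gg>\<close>, subject to the
  linear relations of \<open>\<gg>\<close> and \<open>[x, y] = x y - y x\<close>. Again it is built from terms, modulo
  the least congruence containing the algebra axioms and these relations.
\<close>

datatype 'g uea_term = UGen 'g | UZero | UOne | UAdd "'g uea_term" "'g uea_term"
  | UScale complex "'g uea_term" | UMul "'g uea_term" "'g uea_term"

inductive uea_eq :: "'g::lie_alg uea_term \<Rightarrow> 'g uea_term \<Rightarrow> bool" where
  ue_refl: "uea_eq t t"
| ue_sym: "uea_eq t u \<Longrightarrow> uea_eq u t"
| ue_trans: "uea_eq t u \<Longrightarrow> uea_eq u v \<Longrightarrow> uea_eq t v"
| ue_cong_add: "uea_eq t t' \<Longrightarrow> uea_eq u u' \<Longrightarrow> uea_eq (UAdd t u) (UAdd t' u')"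
| ue_cong_scale: "uea_eq t t' \<Longrightarrow> uea_eq (UScale c t) (UScale c t')"
| ue_cong_mul: "uea_eq t t' \<Longrightarrow> uea_eq u u' \<Longrightarrow> uea_eq (UMul t u) (UMul t' u')"
| ue_add_assoc: "uea_eq (UAdd (UAdd t u) v) (UAdd t (UAdd u v))"
| ue_add_comm: "uea_eq (UAdd t u) (UAdd u t)"
| ue_add_zero: "uea_eq (UAdd UZero t) t"
| ue_add_inv: "uea_eq (UAdd (UScale (- 1) t) t) UZero"
| ue_scale_add: "uea_eq (UScale c (UAdd t u)) (UAdd (UScale c t) (UScale c u))"
| ue_add_scale: "uea_eq (UScale (c + d) t) (UAdd (UScale c t) (UScale d t))"
| ue_scale_scale: "uea_eq (UScale c (UScale d t)) (UScale (c * d) t)"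
| ue_scale_one: "uea_eq (UScale 1 t) t"
| ue_mul_assoc: "uea_eq (UMul (UMul t u) v) (UMul t (UMul u v))"
| ue_mul_one_left: "uea_eq (UMul UOne t) t"
| ue_mul_one_right: "uea_eq (UMul t UOne) t"
| ue_mul_add_left: "uea_eq (UMul (UAdd t u) v) (UAdd (UMul t v) (UMul u v))"
| ue_mul_add_right: "uea_eq (UMul t (UAdd u v)) (UAdd (UMul t u) (UMul t v))"
| ue_mul_scale_left: "uea_eq (UMul (UScale c t) u) (UScale c (UMul t u))"
| ue_mul_scale_right: "uea_eq (UMul t (UScale c u)) (UScale c (UMul t u))"
| ue_gen_add: "uea_eq (UGen (x + y)) (UAdd (UGen x) (UGen y))"
| ue_gen_scale: "uea_eq (UGen (c *\<^sub>C x)) (UScale c (UGen x))"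
| ue_gen_lie: "uea_eq (UGen (lie x y))
    (UAdd (UMul (UGen x) (UGen y)) (UScale (- 1) (UMul (UGen y) (UGen x))))"

quotient_type (overloaded) 'g uea = "'g::lie_alg uea_term" / uea_eq
  by (rule equivpI) (auto simp: reflp_def symp_def transp_def intro: uea_eq.intros)

primrec counit_term :: "'g uea_term \<Rightarrow> complex" where
  "counit_term (UGen x) = 0"
| "counit_term UZero = 0"
| "counit_term UOne = 1"
| "counit_term (UAdd t u) = counit_term t + counit_term u"
| "counit_term (UScale c t) = c * counit_term t"
| "counit_term (UMul t u) = counit_term t * counit_term u"

lift_definition counit :: "'g::lie_alg uea \<Rightarrow> complex" is counit_term
  subgoal for t u by (induction rule: uea_eq.induct) (simp_all add: algebra_simps)
  done

instantiation uea :: (lie_alg) complex_alg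
begin

lift_definition zero_uea :: "'a uea" is UZero .
lift_definition one_uea :: "'a uea" is UOne .
lift_definition plus_uea :: "'a uea \<Rightarrow> 'a uea \<Rightarrow> 'a uea" is UAdd
  by (rule ue_cong_add)
lift_definition scaleC_uea :: "complex \<Rightarrow> 'a uea \<Rightarrow> 'a uea" is UScale
  by (rule ue_cong_scale)
lift_definition times_uea :: "'a uea \<Rightarrow> 'a uea \<Rightarrow> 'a uea" is UMul
  by (rule ue_cong_mul)
definition uminus_uea :: "'a uea \<Rightarrow> 'a uea" where
  "uminus_uea x = (- 1) *\<^sub>C x"
definition minus_uea :: "'a uea \<Rightarrow> 'a uea \<Rightarrow> 'a uea" where
  "minus_uea x y = x + - y"

instance
proof
  fix x y z :: "'a uea" and c d :: complex
  show "x + y + z = x + (y + z)" by transfer (rule ue_add_assoc)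
  show "x + y = y + x" by transfer (rule ue_add_comm)
  show "0 + x = x" by transfer (rule ue_add_zero)
  show "- x + x = 0" unfolding uminus_uea_def by transfer (rule ue_add_inv)
  show "x - y = x + - y" by (rule minus_uea_def)
  show "c *\<^sub>C (x + y) = c *\<^sub>C x + c *\<^sub>C y" by transfer (rule ue_scale_add)
  show "(c + d) *\<^sub>C x = c *\<^sub>C x + d *\<^sub>C x" by transfer (rule ue_add_scale)
  show "c *\<^sub>C d *\<^sub>C x = (c * d) *\<^sub>C x" by transfer (rule ue_scale_scale)
  show "1 *\<^sub>C x = x" by transfer (rule ue_scale_one)
  show "x * y * z = x * (y * z)" by transfer (rule ue_mul_assoc)
  show "1 * x = x" by transfer (rule ue_mul_one_left)
  show "x * 1 = x" by transfer (rule ue_mul_one_right)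
  show "(x + y) * z = x * z + y * z" by transfer (rule ue_mul_add_left)
  show "x * (y + z) = x * y + x * z" by transfer (rule ue_mul_add_right)
  show "(c *\<^sub>C x) * y = c *\<^sub>C (x * y)" by transfer (rule ue_mul_scale_left)
  show "x * (c *\<^sub>C y) = c *\<^sub>C (x * y)" by transfer (rule ue_mul_scale_right)
  have "counit (0 :: 'a uea) = 0" by transfer simp
  moreover have "counit (1 :: 'a uea) = 1" by transfer simp
  ultimately show "(0 :: 'a uea) \<noteq> 1" by force
qed

end

lift_definition uemb :: "'g::lie_alg \<Rightarrow> 'g uea" is UGen .

text \<open>The image of \<open>U\<hh>\<close> in \<open>U\<gg>\<close>, for a Lie subalgebra \<open>\<hh>\<close> of \<open>\<gg>\<close>, with which \<open>U\<hh>\<close> is identified.\<close>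

definition uea_sub :: "'g::lie_alg set \<Rightarrow> 'g uea set" where
  "uea_sub H = cvec.span {prod_list (map uemb xs) | xs. set xs \<subseteq> H}"

definition uea_left_ideal :: "'g::lie_alg set \<Rightarrow> 'g uea set" where
  "uea_left_ideal H = cvec.span {u * uemb h | u h. h \<in> H}"


section \<open>The grading and the graded dual\<close>

definition uea_deg :: "nat \<Rightarrow> 's::finite braid_lie uea set" where
  "uea_deg d = cvec.span {prod_list (map (\<lambda>(a, b). uemb (gX a b)) ps) | ps. length ps = d}"

definition graded_dual :: "('s::finite braid_lie uea \<Rightarrow> complex) set" where
  "graded_dual = {\<phi>. Vector_Spaces.linear scaleC (*) \<phi> \<and> (\<exists>D. \<forall>d>D. \<forall>u\<in>uea_deg d. \<phi> u = 0)}"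

definition homogeneous :: "nat \<Rightarrow> ('s::finite braid_lie uea \<Rightarrow> complex) \<Rightarrow> bool" where
  "homogeneous d \<phi> \<longleftrightarrow> \<phi> \<in> graded_dual \<and> (\<forall>e. e \<noteq> d \<longrightarrow> (\<forall>u\<in>uea_deg e. \<phi> u = 0))"

definition precomp :: "('s::finite braid_lie uea \<Rightarrow> complex) \<Rightarrow> 's braid_lie \<Rightarrow>
    ('s braid_lie uea \<Rightarrow> complex)" where
  "precomp \<phi> X = (\<lambda>u. \<phi> (uemb X * u))"


section \<open>Index sets\<close>

text \<open>
  The set \<open>{1, \<dots>, n}\<close> is modelled by a finite linearly ordered type \<open>'n\<close>; its largest
  element \<open>Max UNIV\<close> stands for \<open>n\<close>. The type \<open>'n base\<close> is \<open>{\<alpha>, 1, \<dots>, n, \<omega>}\<close> and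
  \<open>'n idx\<close> is \<open>{\<alpha>, 1, \<dots>, n, \<beta>, \<omega>}\<close>.
\<close>

datatype 'n base = Alpha | Pt 'n | Omega
datatype 'n idx = Beta | Nb "'n base"

instance base :: (finite) finite
proof
  have "(UNIV :: 'a base set) = {Alpha, Omega} \<union> range Pt"
    by (auto intro: base.exhaust)
  then show "finite (UNIV :: 'a base set)" by (metis finite.emptyI finite.insertI finite_Un finite_imageI finite)
qed

instance idx :: (finite) finite
proof
  have "(UNIV :: 'a idx set) = {Beta} \<union> range Nb"
    by (auto intro: idx.exhaust)
  then show "finite (UNIV :: 'a idx set)" by (metis finite.emptyI finite.insertI finite_Un finite_imageI finite)
qed

abbreviation i_alpha :: "'n idx" (\<open>\<alpha>\<close>) where "\<alpha> \<equiv> Nb Alpha"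
abbreviation i_beta :: "'n idx" (\<open>\<beta>\<close>) where "\<beta> \<equiv> Beta"
abbreviation i_omega :: "'n idx" (\<open>\<omega>\<close>) where "\<omega> \<equiv> Nb Omega"
abbreviation i_pt :: "'n \<Rightarrow> 'n idx" where "i_pt i \<equiv> Nb (Pt i)"

definition is_pi_beta :: "('n::finite idx braid_lie \<Rightarrow> 'n base braid_lie) \<Rightarrow> bool" where
  "is_pi_beta p \<longleftrightarrow> lie_hom p \<and> (\<forall>v. p (gX \<beta> v) = 0) \<and>
     (\<forall>a b. p (gX (Nb a) (Nb b)) = gX a b)"

definition is_section :: "('n::{finite,linorder} idx braid_lie \<Rightarrow> 'n base braid_lie) \<Rightarrow>
    ('n base braid_lie \<Rightarrow> 'n idx braid_lie) \<Rightarrow> bool" where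
  "is_section p s \<longleftrightarrow> lie_hom s \<and> (\<forall>y. p (s y) = y) \<and>
     (\<forall>i < Max UNIV. s (gX Alpha (Pt i)) = gX \<alpha> (i_pt i)) \<and>
     (\<forall>i j. i < j \<longrightarrow> s (gX (Pt i) (Pt j)) = gX (i_pt i) (i_pt j))"

text \<open>
  Free associative algebra on \<open>X\<^sub>1\<^sub>\<beta>, \<dots>, X\<^sub>n\<^sub>\<beta>, X\<^sub>\<beta>\<^sub>\<omega>\<close>: finitely supported
  functions on words, together with their evaluation in the enveloping algebra.
\<close>

datatype 'n letter = XB 'n | XBO

primrec letter_val :: "'n::finite letter \<Rightarrow> 'n idx braid_lie" where
  "letter_val (XB i) = gX (i_pt i) \<beta>"
| "letter_val XBO = gX \<beta> \<omega>"

definition word_eval :: "('n::finite letter list \<Rightarrow>\<^sub>0 complex) \<Rightarrow> 'n idx braid_lie uea" where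
  "word_eval P = (\<Sum>w\<in>Poly_Mapping.keys P.
     Poly_Mapping.lookup P w *\<^sub>C prod_list (map (uemb \<circ> letter_val) w))"

text \<open>Meaningful on the range of \<^const>\<open>word_eval\<close>, provided that this map is injective.\<close>

definition word_coeff :: "'n::finite letter list \<Rightarrow> 'n idx braid_lie uea \<Rightarrow> complex" where
  "word_coeff w u = Poly_Mapping.lookup (inv word_eval u) w"

definition polylog_word :: "nat \<Rightarrow> (nat \<Rightarrow> nat) \<Rightarrow> (nat \<Rightarrow> 'n) \<Rightarrow> 'n letter list" where
  "polylog_word N a \<kappa> =
     concat (map (\<lambda>i. replicate (a i - 1) XBO @ [XB (\<kappa> i)]) (rev [1..<Suc N]))"


section \<open>Holomorphic functions on the polydisc with logarithms\<close>

definition polydisc :: "(complex ^ 'n::finite) set" where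
  "polydisc = {x. \<forall>i. norm (x $ i) < 1}"

text \<open>Functions on the polydisc are represented by their extension by zero.\<close>

definition holo_polydisc :: "(complex ^ 'n::finite \<Rightarrow> complex) set" where
  "holo_polydisc = {f. (\<forall>x\<in>polydisc. \<exists>f'. (f has_derivative f') (at x) \<and> (\<forall>c v. f' (c *s v) = c * f' v))
     \<and> (\<forall>x. x \<notin> polydisc \<longrightarrow> f x = 0)}"

text \<open>
  \<open>\<O>(\<D>)[log x\<^sub>1, \<dots>, log x\<^sub>n]\<close> as a polynomial ring in the symbols \<open>log x\<^sub>i\<close>:
  \<open>F e\<close> is the coefficient of the monomial with exponents \<open>e\<close>.
\<close>

type_synonym 'n logpoly = "('n \<Rightarrow> nat) \<Rightarrow> complex ^ 'n \<Rightarrow> complex"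

definition holo_log :: "'n::finite logpoly set" where
  "holo_log = {F. (\<forall>e. F e \<in> holo_polydisc) \<and> finite {e. F e \<noteq> (\<lambda>_. 0)}}"

definition logpoly_const :: "(complex ^ 'n::finite \<Rightarrow> complex) \<Rightarrow> 'n logpoly" where
  "logpoly_const f = (\<lambda>e x. if e = (\<lambda>_. 0) \<and> x \<in> polydisc then f x else 0)"

definition partial_deriv :: "'n::finite \<Rightarrow> (complex ^ 'n \<Rightarrow> complex) \<Rightarrow> complex ^ 'n \<Rightarrow> complex" where
  "partial_deriv k f x = deriv (\<lambda>t. f (\<chi> j. if j = k then t else x $ j)) (x $ k)"

text \<open>
  The \<open>dx\<^sub>k\<close>-component of \<open>dF\<close>, with \<open>d(log x\<^sub>k) = dx\<^sub>k / x\<^sub>k\<close>, where no \<open>x\<^sub>k\<close> vanishes.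
\<close>

definition logpoly_deriv :: "'n::finite \<Rightarrow> 'n logpoly \<Rightarrow> 'n logpoly" where
  "logpoly_deriv k F = (\<lambda>e x. partial_deriv k (F e) x
     + of_nat (Suc (e k)) * F (e(k := Suc (e k))) x / (x $ k))"

text \<open>The \<open>dx\<^sub>k\<close>-component of \<open>dg / g\<close>.\<close>

definition dlog :: "(complex ^ 'n::finite \<Rightarrow> complex) \<Rightarrow> 'n \<Rightarrow> complex ^ 'n \<Rightarrow> complex" where
  "dlog g k x = partial_deriv k g x / g x"

definition zc :: "'n \<Rightarrow> complex ^ 'n::{finite,linorder} \<Rightarrow> complex" where
  "zc i x = (\<Prod>j\<in>{i..}. x $ j)"

text \<open>
  The differential equation is required where all \<open>x\<^sub>k\<close> are nonzero. There the denominators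
  \<open>z\<^sub>i\<close>, \<open>z\<^sub>i - 1\<close>, \<open>z\<^sub>i - z\<^sub>j\<close> do not vanish, and this set is dense in the polydisc.
\<close>

definition is_iterated_integral ::
    "(('n::{finite,linorder} idx braid_lie uea \<Rightarrow> complex) \<Rightarrow> 'n logpoly) \<Rightarrow> bool" where
  "is_iterated_integral \<iota> \<longleftrightarrow>
     (\<forall>\<phi>\<in>graded_dual. \<iota> \<phi> \<in> holo_log) \<and>
     (\<forall>\<phi>\<in>graded_dual. \<forall>\<psi>\<in>graded_dual. \<iota> (\<lambda>u. \<phi> u + \<psi> u) = (\<lambda>e x. \<iota> \<phi> e x + \<iota> \<psi> e x)) \<and>
     (\<forall>c. \<forall>\<phi>\<in>graded_dual. \<iota> (\<lambda>u. c * \<phi> u) = (\<lambda>e x. c * \<iota> \<phi> e x)) \<and>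
     \<iota> counit = logpoly_const (\<lambda>_. 1) \<and>
     (\<forall>\<phi>\<in>graded_dual. \<forall>k e. \<forall>x\<in>polydisc. (\<forall>i. x $ i \<noteq> 0) \<longrightarrow>
        logpoly_deriv k (\<iota> \<phi>) e x =
          (\<Sum>i\<in>UNIV. \<iota> (precomp \<phi> (gX \<alpha> (i_pt i))) e x * dlog (zc i) k x
                    + \<iota> (precomp \<phi> (gX (i_pt i) \<beta>)) e x * dlog (\<lambda>y. zc i y - 1) k x)
          + (\<Sum>(i, j)\<in>{(i, j). i < j}.
               \<iota> (precomp \<phi> (gX (i_pt i) (i_pt j))) e x * dlog (\<lambda>y. zc i y - zc j y) k x)) \<and>
     (\<forall>d>0. \<forall>\<phi>. homogeneous d \<phi> \<longrightarrow> \<iota> \<phi> (\<lambda>_. 0) 0 = 0)"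


section \<open>Polylogarithms and formal polylogarithms\<close>

text \<open>
  \<open>z\<^sub>\<kappa>\<^sub>(\<^sub>i\<^sub>) / z\<^sub>\<kappa>\<^sub>(\<^sub>i\<^sub>+\<^sub>1\<^sub>)\<close> with \<open>\<kappa>(N+1) = \<beta>\<close> and \<open>z\<^sub>\<beta> = 1\<close>. Since \<open>\<kappa>\<close> is non-decreasing, the
  quotient is the monomial \<open>\<Prod> x\<^sub>j\<close> over \<open>\<kappa> i \<le> j < \<kappa> (i + 1)\<close>, which is defined
  also where some \<open>x\<^sub>j\<close> vanishes.
\<close>

definition y_mon :: "nat \<Rightarrow> (nat \<Rightarrow> 'n) \<Rightarrow> nat \<Rightarrow> complex ^ 'n::{finite,linorder} \<Rightarrow> complex" where
  "y_mon N \<kappa> i x = (\<Prod>j\<in>{j. \<kappa> i \<le> j \<and> (i < N \<longrightarrow> j < \<kappa> (Suc i))}. x $ j)"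

definition polylog :: "nat \<Rightarrow> (nat \<Rightarrow> nat) \<Rightarrow> (nat \<Rightarrow> 'n) \<Rightarrow> complex ^ 'n::{finite,linorder} \<Rightarrow> complex" where
  "polylog N a \<kappa> x =
     (\<Sum>\<^sub>\<infinity>k\<in>{k \<in> {1..N} \<rightarrow>\<^sub>E {1..}. strict_mono_on {1..N} k}.
        \<Prod>i\<in>{1..N}. y_mon N \<kappa> i x ^ k i / of_nat (k i) ^ a i)"

definition formal_polylog ::
    "(('n::{finite,linorder} idx braid_lie uea \<Rightarrow> complex) \<Rightarrow> 'n logpoly) \<Rightarrow>
     nat \<Rightarrow> (nat \<Rightarrow> nat) \<Rightarrow> (nat \<Rightarrow> 'n) \<Rightarrow> 'n idx braid_lie uea \<Rightarrow> complex" where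
  "formal_polylog \<iota> N a \<kappa> =
     (THE l. l \<in> graded_dual \<and> \<iota> l = logpoly_const (polylog N a \<kappa>))"

end

theory Submission
  imports Defs "HOL-Complex_Analysis.Complex_Analysis"
begin

text \<open>
  Let \<open>A\<close> be the free associative algebra on the letters \<open>X\<^sub>i\<^sub>\<beta>\<close>, \<open>X\<^sub>\<beta>\<^sub>\<omega>\<close>. The algebra \<open>U\<pp>\<^sub>m\<close> acts on \<open>A\<close>:
  letters act by left multiplication, \<open>s(\<pp>\<^sub>m\<^sub>-\<^sub>1)\<close> by derivations. Applying this action to \<open>1 \<in> A\<close> gives
  a left inverse of \<open>A \<rightarrow> U\<pp>\<^sub>m\<close> that vanishes on \<open>U\<pp>\<^sub>m s(\<pp>\<^sub>m\<^sub>-\<^sub>1)\<close>; this yields the decomposition and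
  freeness without the Poincare-Birkhoff-Witt theorem, and its coordinates are functionals
  \<open>\<lambda>\<^sub>w\<close> of the graded dual, one for each word \<open>w\<close>.

  The coordinate \<open>x\<^sub>n\<close> parametrises the fibre of \<open>\<pi>\<^sub>\<beta>\<close>: in the direction \<open>x\<^sub>n\<close> the differential equation of
  \<open>\<iota>(\<lambda>\<^sub>w)\<close> only removes the first letter of \<open>w\<close>, and the polylogarithms satisfy the same equation.
  Both sides agree for \<open>x\<^sub>n = 0\<close>, because there the equations in the other directions involve only
  left multiplication by \<open>s(\<pp>\<^sub>m\<^sub>-\<^sub>1)\<close>, which lowers the degree of a functional and preserves its vanishing on
  \<open>U\<pp>\<^sub>m s(\<pp>\<^sub>m\<^sub>-\<^sub>1)\<close>.

  Injectivity of \<open>\<iota>\<close> is seen on a generic line in the coordinates \<open>z\<^sub>i\<close>: there the forms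
  acquire distinct simple poles, and hyperlogarithms with distinct poles are linearly independent
  over the polynomials.
\<close>

section \<open>Complex algebras and their universal properties\<close>

text \<open>The module is the one induced from the trivial module of s(p_{m-1}). In it, X (P.1) =
  [X, P].1 + P X.1, so X_ab with a, b \<noteq> \<beta> acts as the derivation [X_ab, -] plus right
  multiplication by the letters that express X_ab - s(X_ab). These operators are written down and
  checked against the relations of p_m; the delicate relation is the one for disjoint pairs, where
  derivation and multiplication terms have to compensate each other. The equation in the direction
  x_n is simple because X_\<beta>\<omega> = \<Sum> X_\<alpha>i + \<Sum> X_ij (i < j): along a fibre
  all forms dlog z_i and dlog (z_i - z_j) become dx_n / x_n, and their coefficients add up to this
  one letter. The comparison takes place at x_n = 0, where the equation for \<iota> is not imposed.
  Multiplied by x_k it has coefficients that are regular on the polydisc, and so it extends by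
  continuity; this requires continuity of the partial derivatives. Independence of hyperlogarithms
  rests on the fact that the derivative of a rational function has no simple pole.\<close>

instantiation list :: (type) monoid_add
begin
definition zero_list :: "'a list" where "zero_list = []"
definition plus_list :: "'a list \<Rightarrow> 'a list \<Rightarrow> 'a list" where "plus_list = (@)"
instance by standard (simp_all add: zero_list_def plus_list_def)
end

instantiation complex :: complex_alg
begin
definition scaleC_complex :: "complex \<Rightarrow> complex \<Rightarrow> complex" where "scaleC_complex = (*)"
instance by standard (simp_all add: scaleC_complex_def algebra_simps)
end

instantiation poly_mapping :: (type, complex_vec) complex_vec
begin

lift_definition scaleC_poly_mapping :: "complex \<Rightarrow> ('a \<Rightarrow>\<^sub>0 'b) \<Rightarrow> 'a \<Rightarrow>\<^sub>0 'b" is "\<lambda>c f k. c *\<^sub>C f k"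
proof -
  fix c :: complex and f :: "'a \<Rightarrow> 'b"
  assume "finite {k. f k \<noteq> 0}"
  then show "finite {k. c *\<^sub>C f k \<noteq> 0}"
    by (rule rev_finite_subset) auto
qed

instance
  by standard
    (transfer, simp add: scaleC_add_right scaleC_add_left scaleC_scaleC fun_eq_iff)+

end

lemma lookup_scaleC: "Poly_Mapping.lookup (c *\<^sub>C P) k = c *\<^sub>C Poly_Mapping.lookup P k"
  by transfer simp

lemma scaleC_single: "c *\<^sub>C Poly_Mapping.single k a = Poly_Mapping.single k (c *\<^sub>C a)"
  by (rule poly_mapping_eqI) (simp add: lookup_scaleC lookup_single when_def)

lemma poly_mapping_induct [case_names zero add single]:
  fixes P :: "('a \<Rightarrow>\<^sub>0 'b::monoid_add) \<Rightarrow> bool"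
  assumes "P 0" and "\<And>f g. P f \<Longrightarrow> P g \<Longrightarrow> P (f + g)" and "\<And>k c. P (Poly_Mapping.single k c)"
  shows "P f"
proof (induction f rule: Poly_Mapping.update_induct)
  case const
  show ?case by (rule assms(1))
next
  case (update f k b)
  have "Poly_Mapping.update k b f = Poly_Mapping.single k b + f"
    using update(1)
    by (intro poly_mapping_eqI)
      (auto simp: lookup_update lookup_add lookup_single in_keys_iff when_def)
  then show ?case using update assms by metis
qed

text \<open>Lists form an additive monoid under concatenation, so the convolution product turns
  finitely supported functions on words into the free associative algebra.\<close>

instance poly_mapping :: (monoid_add, complex_alg) complex_alg
proof
  fix c :: complex and P Q :: "'a \<Rightarrow>\<^sub>0 'b"
  show "(c *\<^sub>C P) * Q = c *\<^sub>C (P * Q)"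
  proof (induction P rule: poly_mapping_induct)
    case (single k a)
    show ?case
      by (induction Q rule: poly_mapping_induct)
        (simp_all add: scaleC_single mult_single scaleC_mult_left distrib_left scaleC_add_right)
  qed (simp_all add: scaleC_add_right distrib_right)
  show "P * (c *\<^sub>C Q) = c *\<^sub>C (P * Q)"
  proof (induction P rule: poly_mapping_induct)
    case (single k a)
    show ?case
      by (induction Q rule: poly_mapping_induct)
        (simp_all add: scaleC_single mult_single scaleC_mult_right distrib_left scaleC_add_right)
  qed (simp_all add: distrib_right scaleC_add_right)
qed

section \<open>Complex linear maps and linear extension from a basis\<close>

abbreviation clinear :: "('a::complex_vec \<Rightarrow> 'b::complex_vec) \<Rightarrow> bool" where
  "clinear \<equiv> Vector_Spaces.linear scaleC scaleC"

lemma clinearI: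
  assumes "\<And>x y. f (x + y) = f x + f y" and "\<And>c x. f (c *\<^sub>C x) = c *\<^sub>C f x"
  shows "clinear f"
  using assms by unfold_locales simp_all

lemma clinear_add: "clinear f \<Longrightarrow> f (x + y) = f x + f y"
  by (simp add: Vector_Spaces.linear_iff)

lemma clinear_scaleC: "clinear f \<Longrightarrow> f (c *\<^sub>C x) = c *\<^sub>C f x"
  by (simp add: Vector_Spaces.linear_iff)

lemma clinear_0: "clinear f \<Longrightarrow> f 0 = 0"
  by (metis add_cancel_right_left clinear_add)

lemma scaleC_minus_one: "(- 1) *\<^sub>C x = - (x::'a::complex_vec)"
  using cvec.scale_minus_left[of 1 x] scaleC_one by simp

lemma clinear_minus: "clinear f \<Longrightarrow> f (- x) = - f x"
  using clinear_scaleC[of f "- 1" x] by (simp add: scaleC_minus_one)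

lemma clinear_diff: "clinear f \<Longrightarrow> f (x - y) = f x - f y"
  using clinear_add[of f x "- y"] by (simp add: clinear_minus)

lemma clinear_sum: "clinear f \<Longrightarrow> f (sum g A) = (\<Sum>x\<in>A. f (g x))"
  by (induction A rule: infinite_finite_induct) (auto simp: clinear_add clinear_0)

lemma clinear_compose: "clinear f \<Longrightarrow> clinear g \<Longrightarrow> clinear (\<lambda>x. f (g x))"
  by (rule clinearI) (simp_all add: clinear_add clinear_scaleC)

lemma clinear_subspace_vimage:
  "clinear f \<Longrightarrow> cvec.subspace M \<Longrightarrow> cvec.subspace {x. f x \<in> M}"
  by (simp add: cvec.subspace_def clinear_add clinear_scaleC clinear_0)

lemma clinear_eq_on_span:
  assumes "clinear f" "clinear g" "\<And>x. x \<in> B \<Longrightarrow> f x = g x" "x \<in> cvec.span B"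
  shows "f x = g x"
  using assms(4)
  by (induction rule: cvec.span_induct_alt)
    (simp_all add: assms clinear_add[OF assms(1)] clinear_add[OF assms(2)] clinear_0[OF assms(1)]
      clinear_0[OF assms(2)] clinear_scaleC[OF assms(1)] clinear_scaleC[OF assms(2)])

lemma clinear_mult_left: "clinear (\<lambda>x. a * (x::'a::complex_alg))"
  by (rule clinearI) (simp_all add: distrib_left scaleC_mult_right)

lemma clinear_mult_right: "clinear (\<lambda>x. (x::'a::complex_alg) * a)"
  by (rule clinearI) (simp_all add: distrib_right scaleC_mult_left)

lemma clinear_functional: "Vector_Spaces.linear scaleC (*) \<phi> \<longleftrightarrow> clinear \<phi>"
  by (simp add: scaleC_complex_def)

lemma clinear_lookup: "clinear (\<lambda>P :: 'a \<Rightarrow>\<^sub>0 complex. Poly_Mapping.lookup P k)"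
  by (rule clinearI) (simp_all add: lookup_add lookup_scaleC)

definition lin_ext :: "('w \<Rightarrow> 'v::complex_vec) \<Rightarrow> ('w \<Rightarrow>\<^sub>0 complex) \<Rightarrow> 'v" where
  "lin_ext f P = (\<Sum>w\<in>Poly_Mapping.keys P. Poly_Mapping.lookup P w *\<^sub>C f w)"

lemma lin_ext_superset:
  assumes "finite K" "Poly_Mapping.keys P \<subseteq> K"
  shows "lin_ext f P = (\<Sum>w\<in>K. Poly_Mapping.lookup P w *\<^sub>C f w)"
  unfolding lin_ext_def
  by (rule sum.mono_neutral_left) (use assms in \<open>auto simp: in_keys_iff\<close>)

lemma clinear_lin_ext: "clinear (lin_ext f)"
proof (rule clinearI)
  fix P Q :: "'a \<Rightarrow>\<^sub>0 complex" and c
  let ?K = "Poly_Mapping.keys P \<union> Poly_Mapping.keys Q"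
  have "Poly_Mapping.keys (P + Q) \<subseteq> ?K" by (rule Poly_Mapping.keys_add)
  then show "lin_ext f (P + Q) = lin_ext f P + lin_ext f Q"
    by (simp add: lin_ext_superset[where K = ?K] lookup_add scaleC_add_left sum.distrib)
  have "Poly_Mapping.keys (c *\<^sub>C P) \<subseteq> Poly_Mapping.keys P"
    by (auto simp: in_keys_iff lookup_scaleC scaleC_complex_def)
  then show "lin_ext f (c *\<^sub>C P) = c *\<^sub>C lin_ext f P"
    by (simp add: lin_ext_superset[where K = "Poly_Mapping.keys P"] lookup_scaleC
        cvec.scale_sum_right scaleC_complex_def scaleC_scaleC)
qed

lemma lin_ext_single: "lin_ext f (Poly_Mapping.single w c) = c *\<^sub>C f w"
  by (simp add: lin_ext_superset[where K = "{w}"])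

lemma single_eq_scaleC: "Poly_Mapping.single w c = c *\<^sub>C Poly_Mapping.single w (1::complex)"
  by (simp add: scaleC_single scaleC_complex_def)

lemma clinear_poly_mapping_eqI:
  assumes "clinear f" "clinear g" "\<And>w. f (Poly_Mapping.single w 1) = g (Poly_Mapping.single w (1::complex))"
  shows "f = g"
proof
  fix P show "f P = g P"
  proof (induction P rule: poly_mapping_induct)
    case (single w c)
    then show ?case
      by (subst (1 2) single_eq_scaleC) (simp only: clinear_scaleC[OF assms(1)] clinear_scaleC[OF assms(2)] assms(3))
  qed (use assms in \<open>simp_all add: clinear_add[OF assms(1)] clinear_add[OF assms(2)] clinear_0[OF assms(1)] clinear_0[OF assms(2)]\<close>)
qed

section \<open>Universal properties of the enveloping algebra and of the Lie algebra\<close>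

definition comm :: "'a::ring \<Rightarrow> 'a \<Rightarrow> 'a" where
  "comm x y = x * y - y * x"

lemma clinear_comm: "clinear (comm (a :: 'a::complex_alg))"
  by (rule clinearI) (simp_all add: comm_def algebra_simps scaleC_mult_left scaleC_mult_right)

definition alg_hom :: "('a::complex_alg \<Rightarrow> 'b::complex_alg) \<Rightarrow> bool" where
  "alg_hom f \<longleftrightarrow> clinear f \<and> f 1 = 1 \<and> (\<forall>x y. f (x * y) = f x * f y)"

lemma uea_induct [case_names gen add scale mult one]:
  assumes "\<And>x. P (uemb x)" and "\<And>u v. P u \<Longrightarrow> P v \<Longrightarrow> P (u + v)" and "\<And>c u. P u \<Longrightarrow> P (c *\<^sub>C u)"
    and "\<And>u v. P u \<Longrightarrow> P v \<Longrightarrow> P (u * v)" and "P 1"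
  shows "P u"
proof (induction u rule: uea.abs_induct)
  case (1 t)
  have 0: "P 0" using assms(3)[OF assms(5), of 0] by (simp add: cvec.scale_zero_left)
  show ?case
  proof (induction t)
    case (UGen x) then show ?case using assms(1)[of x] by (simp add: uemb_def)
  next
    case UZero then show ?case using 0 by (simp add: zero_uea_def)
  next
    case UOne then show ?case using assms(5) by (simp add: one_uea_def)
  next
    case (UAdd t u) then show ?case using assms(2)[OF UAdd] by (simp add: plus_uea.abs_eq)
  next
    case (UScale c t) then show ?case using assms(3)[OF UScale] by (simp add: scaleC_uea.abs_eq)
  next
    case (UMul t u) then show ?case using assms(4)[OF UMul] by (simp add: times_uea.abs_eq)
  qed
qed

lemma clinear_uemb: "clinear uemb"
  by (rule clinearI; transfer) (rule ue_gen_add ue_gen_scale)+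

lemma uemb_lie: "uemb (lie x y) = comm (uemb x) (uemb y)"
proof -
  have "uemb (lie x y) = uemb x * uemb y + (- 1) *\<^sub>C (uemb y * uemb x)"
    by transfer (rule ue_gen_lie)
  then show ?thesis by (simp add: scaleC_minus_one comm_def)
qed

text \<open>Terms are evaluated by recursion; every clause of the congruence turns into an identity
  of the target algebra, so the evaluation descends to the quotient.\<close>

lemma uea_universal:
  fixes f :: "'g::lie_alg \<Rightarrow> 'e::complex_alg"
  assumes "clinear f" and "\<And>x y. f (lie x y) = comm (f x) (f y)"
  obtains \<Phi> where "alg_hom \<Phi>" and "\<And>x. \<Phi> (uemb x) = f x"
proof -
  define ev :: "'g uea_term \<Rightarrow> 'e" where
    "ev = rec_uea_term f 0 1 (\<lambda>_ _. (+)) (\<lambda>c _ x. c *\<^sub>C x) (\<lambda>_ _. (*))"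
  have ev [simp]: "ev (UGen x) = f x" "ev UZero = 0" "ev UOne = 1" "ev (UAdd t u) = ev t + ev u"
    "ev (UScale c t) = c *\<^sub>C ev t" "ev (UMul t u) = ev t * ev u" for x t u c
    by (simp_all add: ev_def)
  have resp: "ev t = ev u" if "uea_eq t u" for t u
    using that
    by induction (simp_all add: algebra_simps scaleC_minus_one scaleC_add_right scaleC_add_left
        scaleC_scaleC scaleC_one scaleC_mult_left scaleC_mult_right assms(2) comm_def
        clinear_add[OF assms(1)] clinear_scaleC[OF assms(1)])
  define \<Phi> where "\<Phi> u = ev (rep_uea u)" for u
  have abs: "\<Phi> (abs_uea t) = ev t" for t
    unfolding \<Phi>_def by (rule resp) (rule Quotient3_rep_abs[OF Quotient3_uea ue_refl])
  have cl: "clinear \<Phi>"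
  proof (rule clinearI)
    fix u v c
    show "\<Phi> (u + v) = \<Phi> u + \<Phi> v"
      by (induction u; induction v) (simp add: plus_uea.abs_eq abs)
    show "\<Phi> (c *\<^sub>C u) = c *\<^sub>C \<Phi> u"
      by (induction u) (simp add: scaleC_uea.abs_eq abs)
  qed
  have mu: "\<Phi> (u * v) = \<Phi> u * \<Phi> v" for u v
    by (induction u; induction v) (simp add: times_uea.abs_eq abs)
  have "alg_hom \<Phi>"
    unfolding alg_hom_def using cl mu by (simp add: one_uea_def abs)
  moreover have "\<Phi> (uemb x) = f x" for x by (simp add: uemb_def abs)
  ultimately show ?thesis by (rule that)
qed

lemma braid_lie_induct [case_names gen add scale lie]:
  fixes x :: "'s::finite braid_lie"
  assumes "\<And>a b. P (gX a b)" and "\<And>u v. P u \<Longrightarrow> P v \<Longrightarrow> P (u + v)" and "\<And>c u. P u \<Longrightarrow> P (c *\<^sub>C u)"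
    and "\<And>u v. P u \<Longrightarrow> P v \<Longrightarrow> P (lie u v)"
  shows "P x"
proof (induction x rule: braid_lie.abs_induct)
  case (1 t)
  have 0: "P 0" using assms(3)[OF assms(1), of 0] by (simp add: cvec.scale_zero_left)
  show ?case
  proof (induction t)
    case (LGen a b) then show ?case using assms(1)[of a b] by (simp add: gX_def)
  next
    case LZero then show ?case using 0 by (simp add: zero_braid_lie_def)
  next
    case (LAdd t u) then show ?case using assms(2)[OF LAdd] by (simp add: plus_braid_lie.abs_eq)
  next
    case (LScale c t) then show ?case using assms(3)[OF LScale] by (simp add: scaleC_braid_lie.abs_eq)
  next
    case (LBr t u) then show ?case using assms(4)[OF LBr] by (simp add: lie_braid_lie.abs_eq)
  qed
qed

lemma gX_diag: "gX a a = 0" by transfer (rule le_gen_diag)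
lemma gX_sym: "gX a b = gX b a" by transfer (rule le_gen_sym)
lemma gX_comm: "distinct [a, b, c, d] \<Longrightarrow> lie (gX a b) (gX c d) = 0"
  by transfer (rule le_gen_comm)

lemma sum_gX: "(\<Sum>b\<in>UNIV. gX (a::'s::finite) b) = 0"
proof -
  have *: "abs_braid_lie (foldr LAdd (map (LGen a) bs) LZero) = (\<Sum>b\<leftarrow>bs. gX a b)" for bs
  proof (induction bs)
    case Nil
    show ?case by (simp add: zero_braid_lie_def)
  next
    case (Cons b bs)
    then show ?case by (simp flip: plus_braid_lie.abs_eq add: gX_def)
  qed
  obtain bs where bs: "distinct bs" "set bs = UNIV - {a}"
    using finite_distinct_list[of "UNIV - {a}"] by auto
  have "(\<Sum>b\<in>UNIV - {a}. gX a b) = 0"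
    using le_gen_sum[OF bs] bs sum.distinct_set_conv_list[OF bs(1), of "gX a"]
    by (simp flip: * braid_lie.abs_eq_iff add: zero_braid_lie_def)
  then show ?thesis by (simp add: sum.remove[of UNIV a] gX_diag)
qed

text \<open>The target is an associative algebra with its commutator, which is the form needed to
  compose with \<open>uea_universal\<close> and obtain a representation of the enveloping algebra
  from operators for the generators alone.\<close>

lemma braid_lie_universal:
  fixes g :: "'s::finite \<Rightarrow> 's \<Rightarrow> 'e::complex_alg"
  assumes diag: "\<And>a. g a a = 0" and sym: "\<And>a b. g a b = g b a" and sum: "\<And>a. (\<Sum>b\<in>UNIV. g a b) = 0"
    and commute: "\<And>a b c d. distinct [a, b, c, d] \<Longrightarrow> comm (g a b) (g c d) = 0"
  obtains f where "clinear f" and "\<And>x y. f (lie x y) = comm (f x) (f y)" and "\<And>a b. f (gX a b) = g a b"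
proof -
  define ev :: "'s lie_term \<Rightarrow> 'e" where
    "ev = rec_lie_term g 0 (\<lambda>_ _. (+)) (\<lambda>c _ x. c *\<^sub>C x) (\<lambda>_ _. comm)"
  have ev [simp]: "ev (LGen a b) = g a b" "ev LZero = 0" "ev (LAdd t u) = ev t + ev u"
    "ev (LScale c t) = c *\<^sub>C ev t" "ev (LBr t u) = comm (ev t) (ev u)" for a b t u c
    by (simp_all add: ev_def)
  have fold: "ev (foldr LAdd (map (LGen a) bs) LZero) = (\<Sum>b\<leftarrow>bs. g a b)" for a bs
    by (induction bs) simp_all
  have resp: "ev t = ev u" if "lie_eq t u" for t u
    using that
  proof induction
    case (le_gen_sum bs a)
    have "(\<Sum>b\<in>UNIV - {a}. g a b) = 0"
      using sum[of a] by (simp add: sum.remove[of UNIV a] diag)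
    then show ?case
      using le_gen_sum sum.distinct_set_conv_list[of bs "g a"] by (simp add: fold)
  next
    case (le_gen_sym a b)
    then show ?case using sym by simp
  next
    case (le_gen_comm a b c d)
    then show ?case using commute by simp
  qed (simp_all add: algebra_simps scaleC_minus_one scaleC_add_right scaleC_add_left
      scaleC_scaleC scaleC_one scaleC_mult_left scaleC_mult_right comm_def diag
      cvec.scale_right_diff_distrib)
  define f where "f u = ev (rep_braid_lie u)" for u
  have abs: "f (abs_braid_lie t) = ev t" for t
    unfolding f_def by (rule resp) (rule Quotient3_rep_abs[OF Quotient3_braid_lie le_refl])
  have "clinear f"
  proof (rule clinearI)
    fix u v c
    show "f (u + v) = f u + f v"
      by (induction u; induction v) (simp add: plus_braid_lie.abs_eq abs)
    show "f (c *\<^sub>C u) = c *\<^sub>C f u"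
      by (induction u) (simp add: scaleC_braid_lie.abs_eq abs)
  qed
  moreover have "f (lie u v) = comm (f u) (f v)" for u v
    by (induction u; induction v) (simp add: lie_braid_lie.abs_eq abs)
  moreover have "f (gX a b) = g a b" for a b by (simp add: gX_def abs)
  ultimately show ?thesis by (rule that)
qed

text \<open>The Lie elements that preserve \<open>M\<close> under left multiplication are closed
  under brackets, because a bracket acts as a commutator; hence all of them do, and then so do their
  products. Applying these to 1 exhausts the algebra.\<close>

lemma uea_left_induct:
  fixes M :: "'s::finite braid_lie uea set"
  assumes M: "cvec.subspace M" and one: "1 \<in> M" and gen: "\<And>a b u. u \<in> M \<Longrightarrow> uemb (gX a b) * u \<in> M"
  shows "M = UNIV"
proof -
  have "uemb x * u \<in> M" if "u \<in> M" for x u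
    using that
  proof (induction x arbitrary: u rule: braid_lie_induct)
    case (lie x y)
    then show ?case
      by (auto simp: uemb_lie comm_def left_diff_distrib mult.assoc intro!: cvec.subspace_diff[OF M])
  qed (auto simp: gen clinear_add[OF clinear_uemb] clinear_scaleC[OF clinear_uemb] distrib_right
      scaleC_mult_left intro!: cvec.subspace_add[OF M] cvec.subspace_scale[OF M])
  then have "v * u \<in> M" if "u \<in> M" for u v
    using that
    by (induction v arbitrary: u rule: uea_induct)
      (auto simp: distrib_right scaleC_mult_left mult.assoc intro!: cvec.subspace_add[OF M] cvec.subspace_scale[OF M])
  then have "v * 1 \<in> M" for v using one by blast
  then show ?thesis by auto
qed

section \<open>A module of the enveloping algebra on the free associative algebra\<close>

text \<open>The universal properties take values in a type of class \<open>complex_alg\<close>; the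
  endomorphism algebra in which the action lives is therefore made into such a type, with
  composition as product.\<close>

typedef (overloaded) 'v lin_endo = "{f :: 'v::complex_alg \<Rightarrow> 'v. clinear f}"
  morphisms app_endo Endo
proof
  show "id \<in> {f :: 'v \<Rightarrow> 'v. clinear f}" by (simp add: clinearI)
qed

setup_lifting type_definition_lin_endo

instantiation lin_endo :: (complex_alg) complex_alg
begin

lift_definition zero_lin_endo :: "'a lin_endo" is "\<lambda>_. 0" by (rule clinearI) auto
lift_definition one_lin_endo :: "'a lin_endo" is "\<lambda>x. x" by (rule clinearI) auto
lift_definition plus_lin_endo :: "'a lin_endo \<Rightarrow> 'a lin_endo \<Rightarrow> 'a lin_endo" is "\<lambda>f g x. f x + g x"
  by (rule clinearI) (simp_all add: clinear_add clinear_scaleC scaleC_add_right)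
lift_definition minus_lin_endo :: "'a lin_endo \<Rightarrow> 'a lin_endo \<Rightarrow> 'a lin_endo" is "\<lambda>f g x. f x - g x"
  by (rule clinearI) (simp_all add: clinear_add clinear_scaleC cvec.scale_right_diff_distrib)
lift_definition uminus_lin_endo :: "'a lin_endo \<Rightarrow> 'a lin_endo" is "\<lambda>f x. - f x"
  by (rule clinearI) (simp_all add: clinear_add clinear_scaleC)
lift_definition scaleC_lin_endo :: "complex \<Rightarrow> 'a lin_endo \<Rightarrow> 'a lin_endo" is "\<lambda>c f x. c *\<^sub>C f x"
  by (rule clinearI) (simp_all add: clinear_add clinear_scaleC scaleC_add_right scaleC_scaleC mult.commute)
lift_definition times_lin_endo :: "'a lin_endo \<Rightarrow> 'a lin_endo \<Rightarrow> 'a lin_endo" is "\<lambda>f g x. f (g x)"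
  by (rule clinear_compose)

instance
proof
  show "(0 :: 'a lin_endo) \<noteq> 1"
    by transfer (metis zero_neq_one)
qed (transfer, simp add: scaleC_add_right scaleC_add_left scaleC_scaleC clinear_add clinear_scaleC add.assoc add.commute fun_eq_iff)+

end

lift_definition lmul :: "'a::complex_alg \<Rightarrow> 'a lin_endo" is "\<lambda>a x. a * x" by (rule clinear_mult_left)
lift_definition rmul :: "'a::complex_alg \<Rightarrow> 'a lin_endo" is "\<lambda>a x. x * a" by (rule clinear_mult_right)

section \<open>Derivations of the free associative algebra\<close>

type_synonym 'n free_alg = "'n letter list \<Rightarrow>\<^sub>0 complex"

definition word :: "'n letter list \<Rightarrow> 'n free_alg" where "word w = Poly_Mapping.single w 1"

lemma word_Nil: "word [] = 1"
  by (simp add: word_def flip: zero_list_def)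

lemma word_append: "word (v @ w) = word v * word w"
  by (simp add: word_def mult_single plus_list_def)

lemma word_Cons: "word (l # w) = word [l] * word w"
  by (simp flip: word_append)

lemma lookup_word: "Poly_Mapping.lookup (word v) w = (if v = w then 1 else 0)"
  by (simp add: word_def lookup_single when_def)

primrec der_word :: "('n letter \<Rightarrow> 'n free_alg) \<Rightarrow> 'n letter list \<Rightarrow> 'n free_alg" where
  "der_word \<delta> [] = 0"
| "der_word \<delta> (l # w) = \<delta> l * word w + word [l] * der_word \<delta> w"

definition der :: "('n letter \<Rightarrow> 'n free_alg) \<Rightarrow> 'n free_alg \<Rightarrow> 'n free_alg" where
  "der \<delta> = lin_ext (der_word \<delta>)"

lemma clinear_der: "clinear (der \<delta>)"
  unfolding der_def by (rule clinear_lin_ext)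

lemma der_word_eq: "der \<delta> (word w) = der_word \<delta> w"
  by (simp add: der_def word_def lin_ext_single)

lemma der_letter: "der \<delta> (word [l]) = \<delta> l"
  by (simp add: der_word_eq word_Nil)

lemma der_one: "der \<delta> 1 = 0"
  by (simp add: der_word_eq flip: word_Nil)

lemma der_mult: "der \<delta> (P * Q) = der \<delta> P * Q + P * der \<delta> Q"
proof -
  note lin = clinearI clinear_add[OF clinear_der] clinear_scaleC[OF clinear_der]
  have w: "der \<delta> (word v * word w) = der \<delta> (word v) * word w + word v * der \<delta> (word w)" for v w
  proof (induction v)
    case Nil
    then show ?case by (simp add: word_Nil der_one)
  next
    case (Cons l v)
    have "der \<delta> (word (l # v) * word w) = \<delta> l * word (v @ w) + word [l] * der \<delta> (word (v @ w))"
      by (simp add: der_word_eq flip: word_append)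
    also have "\<dots> = der \<delta> (word (l # v)) * word w + word (l # v) * der \<delta> (word w)"
      unfolding word_append Cons word_Cons[of l v]
      by (simp add: der_word_eq[of _ "l # v", unfolded word_Cons[of l v]] distrib_left distrib_right mult.assoc der_word_eq)
    finally show ?case .
  qed
  have "(\<lambda>Q. der \<delta> (word v * Q)) = (\<lambda>Q. der \<delta> (word v) * Q + word v * der \<delta> Q)" for v
    by (rule clinear_poly_mapping_eqI)
      (simp_all add: w distrib_left scaleC_mult_right scaleC_add_right lin flip: word_def)
  then have "(\<lambda>P. der \<delta> (P * Q)) = (\<lambda>P. der \<delta> P * Q + P * der \<delta> Q)" for Q
    by (intro clinear_poly_mapping_eqI)
      (simp_all add: fun_eq_iff distrib_right scaleC_mult_left scaleC_add_right lin flip: word_def)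
  then show ?thesis by (simp add: fun_eq_iff)
qed

lemma der_comm: "der \<delta> (comm P Q) = comm (der \<delta> P) Q + comm P (der \<delta> Q)"
  by (simp add: comm_def clinear_diff[OF clinear_der] der_mult)

text \<open>The commutator of two derivations is again a derivation, hence determined by its values
  on letters.\<close>

lemma der_commute:
  assumes "\<And>l. der \<delta> (\<delta>' l) = der \<delta>' (\<delta> l)"
  shows "der \<delta> (der \<delta>' P) = der \<delta>' (der \<delta> P)"
proof -
  have "(\<lambda>P. der \<delta> (der \<delta>' P)) = (\<lambda>P. der \<delta>' (der \<delta> P))"
  proof (rule clinear_poly_mapping_eqI; (simp flip: word_def)?)
    show "der \<delta> (der \<delta>' (word w)) = der \<delta>' (der \<delta> (word w))" for w
    proof (induction w)
      case Nil
      then show ?case by (simp add: word_Nil der_one clinear_0[OF clinear_der])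
    next
      case (Cons l w)
      then show ?case
        by (simp add: word_Cons[of l w] der_mult der_letter clinear_add[OF clinear_der] assms)
    qed
  qed (rule clinear_compose[OF clinear_der clinear_der])+
  then show ?thesis by (simp add: fun_eq_iff)
qed

section \<open>The derivations induced by generators without index \<beta>\<close>

lemma UNIV_base: "(UNIV :: 'n base set) = insert Alpha (insert Omega (range Pt))"
  by (auto intro: base.exhaust)

lemma UNIV_idx: "(UNIV :: 'n idx set) = insert Beta (range Nb)"
  by (auto intro: idx.exhaust)

lemma sum_base: "(\<Sum>v\<in>UNIV. f v) = f Alpha + f Omega + (\<Sum>i\<in>UNIV. f (Pt i))"
  for f :: "'n::finite base \<Rightarrow> 'a::comm_monoid_add"
proof -
  have "inj (Pt :: 'n \<Rightarrow> 'n base)" by (rule injI) simp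
  then have "(\<Sum>v\<in>range Pt. f v) = (\<Sum>i\<in>UNIV. f (Pt i))"
    by (simp add: sum.reindex)
  then show ?thesis
    unfolding UNIV_base by (subst sum.insert; (subst sum.insert)?) (auto simp: add.assoc)
qed

lemma sum_idx: "(\<Sum>v\<in>UNIV. f v) = f Beta + (\<Sum>v\<in>UNIV. f (Nb v))"
  for f :: "'n::finite idx \<Rightarrow> 'a::comm_monoid_add"
proof -
  have "inj (Nb :: 'n base \<Rightarrow> 'n idx)" by (rule injI) simp
  then have "(\<Sum>v\<in>range Nb. f v) = (\<Sum>i\<in>UNIV. f (Nb i))"
    by (simp add: sum.reindex)
  then show ?thesis
    unfolding UNIV_idx by (subst sum.insert) auto
qed

text \<open>The value at \<open>Alpha\<close> is forced by the relation \<Sum> X_v\<beta> = 0, which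
  eliminates X_\<alpha>\<beta> in favour of the free generators.\<close>

primrec ltr :: "'n::finite base \<Rightarrow> 'n free_alg" where
  "ltr Alpha = - ((\<Sum>i\<in>UNIV. word [XB i]) + word [XBO])"
| "ltr (Pt i) = word [XB i]"
| "ltr Omega = word [XBO]"

lemma sum_ltr: "(\<Sum>v\<in>UNIV. ltr v) = 0"
  by (simp add: sum_base)

text \<open>
  The bracket of \<open>X\<^sub>a\<^sub>b\<close> (\<open>a, b \<noteq> \<beta>\<close>) with \<open>X\<^sub>v\<^sub>\<beta>\<close> in \<open>\<pp>\<^sub>m\<close>, with \<open>ltr v\<close> in the role of \<open>X\<^sub>v\<^sub>\<beta>\<close>.
\<close>

definition brk :: "'n::finite base \<Rightarrow> 'n base \<Rightarrow> 'n base \<Rightarrow> 'n free_alg" where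
  "brk a b v = (if v = a then comm (ltr a) (ltr b) else if v = b then comm (ltr b) (ltr a) else 0)"

lemma brk_diag: "brk a a v = 0"
  by (simp add: brk_def comm_def)

lemma brk_sym: "brk a b v = brk b a v"
  by (simp add: brk_def)

lemma sum_brk: "(\<Sum>v\<in>UNIV. brk a b v) = 0"
proof (cases "a = b")
  case False
  then have "(\<Sum>v\<in>UNIV. brk a b v) = (\<Sum>v\<in>{a, b}. brk a b v)"
    by (intro sum.mono_neutral_right) (auto simp: brk_def)
  then show ?thesis using False by (simp add: brk_def comm_def)
qed (simp add: brk_diag)

text \<open>In p_m the X_ab with b \<noteq> \<beta> add up to -X_a\<beta>, so the corresponding
  derivations have to add up to the inner derivation by \<open>- ltr a\<close>. This is the check on
  letters; \<open>sum_dr\<close> extends it to all words.\<close>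

lemma sum_brk_right: "(\<Sum>b\<in>UNIV. brk a b v) = - comm (ltr a) (ltr v)"
proof (cases "v = a")
  case True
  then have "(\<Sum>b\<in>UNIV. brk a b v) = comm (ltr a) (\<Sum>b\<in>UNIV. ltr b)"
    unfolding clinear_sum[OF clinear_comm] by (simp add: brk_def)
  then show ?thesis using True by (simp add: sum_ltr comm_def)
next
  case False
  then have "(\<Sum>b\<in>UNIV. brk a b v) = (\<Sum>b\<in>{v}. brk a b v)"
    by (intro sum.mono_neutral_right) (auto simp: brk_def)
  then show ?thesis using False by (simp add: brk_def comm_def)
qed

primrec base_of :: "'n letter \<Rightarrow> 'n base" where
  "base_of (XB i) = Pt i"
| "base_of XBO = Omega"

lemma ltr_base_of: "ltr (base_of l) = word [l]"
  by (cases l) simp_all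

definition dr :: "'n::finite base \<Rightarrow> 'n base \<Rightarrow> 'n free_alg \<Rightarrow> 'n free_alg" where
  "dr a b = der (\<lambda>l. brk a b (base_of l))"

lemmas clinear_dr = clinear_der[of "\<lambda>l. brk a b (base_of l)" for a b, folded dr_def]

lemma dr_sym: "dr a b = dr b a"
  unfolding dr_def by (subst brk_sym) simp

lemma der_zero: "der (\<lambda>_. 0) P = 0"
proof -
  have "der_word (\<lambda>_. 0) w = 0" for w :: "'a letter list" by (induction w) simp_all
  then show ?thesis by (simp add: der_def lin_ext_def)
qed

lemma dr_diag: "dr a a P = 0"
  by (simp add: dr_def brk_diag der_zero)

text \<open>The derivation is prescribed on letters only; at \<open>Alpha\<close> the formula
  follows because the brackets with all \<open>ltr v\<close> sum to zero, as the
  \<open>ltr v\<close> themselves do.\<close>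

lemma dr_ltr: "dr a b (ltr v) = brk a b v"
proof (cases v)
  case Alpha
  have "dr a b (ltr Alpha) = - ((\<Sum>i\<in>UNIV. brk a b (Pt i)) + brk a b Omega)"
    by (simp add: dr_def clinear_minus[OF clinear_der] clinear_diff[OF clinear_der]
        clinear_sum[OF clinear_der] der_letter)
  moreover have "brk a b Alpha = - ((\<Sum>i\<in>UNIV. brk a b (Pt i)) + brk a b Omega)"
    using sum_brk[of a b] unfolding eq_neg_iff_add_eq_0
    by (simp only: sum_base add.assoc add.commute add.left_commute)
  ultimately show ?thesis using Alpha by simp
qed (simp_all add: dr_def der_letter)

lemma sum_dr: "(\<Sum>b\<in>UNIV. dr a b P) = - comm (ltr a) P"
proof -
  have "(\<lambda>P. \<Sum>b\<in>UNIV. dr a b P) = (\<lambda>P. - comm (ltr a) P)"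
  proof (rule clinear_poly_mapping_eqI; (simp flip: word_def)?)
    show "clinear (\<lambda>P. \<Sum>b\<in>UNIV. dr a b P)"
      by (rule clinearI) (simp_all add: clinear_add[OF clinear_dr] clinear_scaleC[OF clinear_dr]
          sum.distrib cvec.scale_sum_right)
    show "clinear (\<lambda>P. - comm (ltr a) P)"
      by (rule clinearI) (simp_all add: clinear_add[OF clinear_comm] clinear_scaleC[OF clinear_comm])
    show "(\<Sum>b\<in>UNIV. dr a b (word w)) = - comm (ltr a) (word w)" for w
    proof (induction w)
      case Nil
      then show ?case by (simp add: word_Nil der_one dr_def comm_def)
    next
      case (Cons l w)
      have "(\<Sum>b\<in>UNIV. dr a b (word (l # w)))
          = (\<Sum>b\<in>UNIV. brk a b (base_of l)) * word w + word [l] * (\<Sum>b\<in>UNIV. dr a b (word w))"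
        by (simp add: dr_def word_Cons[of l w] der_mult der_letter sum.distrib sum_distrib_left sum_distrib_right)
      then show ?case
        by (simp add: Cons sum_brk_right ltr_base_of word_Cons[of l w] comm_def algebra_simps)
    qed
  qed
  then show ?thesis by (simp add: fun_eq_iff)
qed

lemma dr_mult: "dr a b (P * Q) = dr a b P * Q + P * dr a b Q"
  unfolding dr_def by (rule der_mult)

text \<open>On a letter both composites vanish: the inner derivation gives 0 or a bracket of
  \<open>ltr c\<close> and \<open>ltr d\<close>, and both are killed by the other
  derivation.\<close>

lemma dr_commute:
  assumes "distinct [a, b, c, d]"
  shows "dr a b (dr c d P) = dr c d (dr a b P)"
proof -
  have "dr a b (brk c d v) = 0" if "distinct [a, b, c, d]" for a b c d v :: "'a base"
  proof -
    have "dr a b (ltr c) = 0" "dr a b (ltr d) = 0"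
      using that by (auto simp: dr_ltr brk_def)
    moreover have "dr a b (comm x y) = comm (dr a b x) y + comm x (dr a b y)" for x y
      unfolding dr_def by (rule der_comm)
    ultimately show ?thesis
      by (simp add: brk_def comm_def[of 0] comm_def[of _ 0] clinear_0[OF clinear_dr])
  qed
  then have "dr a b (brk c d v) = 0" "dr c d (brk a b v) = 0" for v
    using assms by auto
  then show ?thesis
    unfolding dr_def by (intro der_commute) simp
qed

text \<open>
  \<open>X\<^sub>a\<^sub>b\<close> for \<open>a, b \<noteq> \<beta>\<close> is congruent to \<open>y_part a b\<close> modulo \<open>s(\<pp>\<^sub>m\<^sub>-\<^sub>1)\<close>; here \<open>s(X\<^sub>\<alpha>\<^sub>n) = X\<^sub>\<alpha>\<^sub>n - X\<^sub>\<beta>\<^sub>\<omega>\<close>.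
\<close>

definition y_om :: "'n::{finite,linorder} base \<Rightarrow> 'n free_alg" where
  "y_om a = - ltr a - (if a = Alpha \<or> a = Pt (Max UNIV) then ltr Omega else 0)"

definition y_part :: "'n::{finite,linorder} base \<Rightarrow> 'n base \<Rightarrow> 'n free_alg" where
  "y_part a b = (if a = b then 0 else if a = Omega then y_om b else if b = Omega then y_om a
     else if {a, b} = {Alpha, Pt (Max UNIV)} then ltr Omega else 0)"

lemma y_part_omega: "a \<noteq> Omega \<Longrightarrow> y_part Omega a = y_om a"
  by (simp add: y_part_def)

lemma y_part_inner:
  "a \<noteq> Omega \<Longrightarrow> b \<noteq> Omega \<Longrightarrow> y_part a b = (if {a, b} = {Alpha, Pt (Max UNIV)} then ltr Omega else 0)"
  by (auto simp: y_part_def doubleton_eq_iff)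

lemma y_part_sym: "y_part a b = y_part b a"
  by (simp add: y_part_def insert_commute)

text \<open>The X_ab with b \<noteq> \<beta> add up to -X_a\<beta>, while their images in p_{m-1}
  add up to 0; the differences X_ab - s(X_ab) must account for this.\<close>

lemma sum_y_part: "(\<Sum>b\<in>UNIV. y_part a b) = - ltr a" for a :: "'n::{finite,linorder} base"
proof (cases a)
  case Alpha
  have "(\<Sum>i\<in>UNIV. y_part Alpha (Pt i)) = (\<Sum>i\<in>{Max UNIV :: 'n}. y_part Alpha (Pt i))"
    by (rule sum.mono_neutral_right) (auto simp: y_part_def doubleton_eq_iff)
  then show ?thesis using Alpha by (simp add: sum_base y_part_def y_om_def del: ltr.simps)
next
  case (Pt j)
  have "(\<Sum>i\<in>UNIV. y_part (Pt j) (Pt i)) = 0"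
    by (rule sum.neutral) (auto simp: y_part_def doubleton_eq_iff)
  then show ?thesis using Pt by (auto simp: sum_base y_part_def y_om_def doubleton_eq_iff simp del: ltr.simps)
next
  case Omega
  have "(\<Sum>i\<in>UNIV. y_part Omega (Pt i :: 'n base)) = - (\<Sum>i\<in>UNIV. ltr (Pt i)) - (\<Sum>i\<in>UNIV. if i = (Max UNIV :: 'n) then ltr Omega else 0)"
  proof -
    have "(\<Sum>i\<in>UNIV. y_part Omega (Pt i :: 'n base)) = (\<Sum>i\<in>UNIV. - ltr (Pt i) - (if i = (Max UNIV :: 'n) then ltr Omega else 0))"
      by (rule sum.cong) (simp_all add: y_part_def y_om_def)
    then show ?thesis by (simp only: sum_subtractf sum_negf)
  qed
  moreover have "(\<Sum>i\<in>UNIV. ltr (Pt i :: 'n base)) = - ltr Alpha - ltr Omega"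
    by simp
  ultimately show ?thesis using Omega by (simp add: sum_base y_part_def y_om_def del: ltr.simps)
qed

text \<open>The obstruction to a representation: for operators of the form derivation plus right
  multiplication, the commutator is the commutator of the derivations plus right multiplication by
  this element. The arguments of \<open>comm\<close> are reversed because right multiplications
  compose in reverse order.\<close>

definition cocycle :: "'n::{finite,linorder} base \<Rightarrow> 'n base \<Rightarrow> 'n base \<Rightarrow> 'n base \<Rightarrow> 'n free_alg" where
  "cocycle a b c d = dr a b (y_part c d) - dr c d (y_part a b) + comm (y_part c d) (y_part a b)"

lemma dr_ltr_eq_0: "v \<noteq> a \<Longrightarrow> v \<noteq> b \<Longrightarrow> dr a b (ltr v) = 0"
  by (simp add: dr_ltr brk_def)

text \<open>\<open>y_part c d\<close> is a combination of \<open>ltr c\<close>, \<open>ltr d\<close>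
  and \<open>ltr Omega\<close>, and \<open>dr a b\<close> kills \<open>ltr v\<close> for every v
  other than a and b.\<close>

lemma dr_y_part:
  assumes "distinct [a, b, c, d]" "a \<noteq> Omega" "b \<noteq> Omega" "(c = Omega \<or> d = Omega) \<longrightarrow> y_part a b = 0"
  shows "dr a b (y_part c d) = 0"
proof -
  have om: "dr a b (ltr Omega) = 0" by (rule dr_ltr_eq_0) (use assms in auto)
  have "dr a b (y_om e) = 0" if "e \<noteq> a" "e \<noteq> b" for e
    using that om unfolding y_om_def
    by (simp add: clinear_diff[OF clinear_dr] clinear_minus[OF clinear_dr] dr_ltr_eq_0 clinear_0[OF clinear_dr] del: ltr.simps)
  then have "dr a b (y_om c) = 0" "dr a b (y_om d) = 0" using assms(1) by auto
  then show ?thesis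
    using assms(1) om y_part_omega[of c] y_part_omega[of d] y_part_sym[of c Omega] y_part_inner[of c d]
    by (cases "c = Omega"; cases "d = Omega") (simp_all add: clinear_0[OF clinear_dr] del: ltr.simps)
qed

lemma cocycle_swap: "cocycle a b c d = - cocycle c d a b"
  by (simp add: cocycle_def comm_def)

lemma cocycle_sym: "cocycle a b c d = cocycle b a c d" "cocycle a b c d = cocycle a b d c"
  by (simp_all add: cocycle_def y_part_sym[of a b] dr_sym[of a b] y_part_sym[of c d] dr_sym[of c d])

text \<open>For {c, d} = {\<alpha>, n} the terms do not vanish separately: the bracket
  \<open>dr Omega e (ltr Omega)\<close> cancels against the commutator of \<open>ltr Omega\<close>
  and \<open>- ltr e\<close>. Here the summand X_\<beta>\<omega> in X_\<alpha>n - s(X_\<alpha>n) is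
  decisive.\<close>

lemma cocycle_omega:
  assumes "distinct [Omega, e, c, d]"
  shows "cocycle Omega e c d = 0"
proof (cases "{c, d} = {Alpha, Pt (Max UNIV)}")
  case True
  then have e: "e \<noteq> Alpha" "e \<noteq> Pt (Max UNIV)" using assms by (auto simp: doubleton_eq_iff)
  have ne: "e \<noteq> Omega" "c \<noteq> Omega" "d \<noteq> Omega" using assms by auto
  have y: "y_part c d = ltr Omega" "y_part Omega e = - ltr e"
    using True e y_part_inner[OF ne(2,3)] y_part_omega[OF ne(1)] by (simp_all add: y_om_def del: ltr.simps)
  have "dr c d (ltr e) = 0" by (rule dr_ltr_eq_0) (use assms in auto)
  then show ?thesis
    unfolding cocycle_def y
    by (simp add: dr_ltr brk_def clinear_minus[OF clinear_dr] comm_def del: ltr.simps)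
next
  case False
  then have y: "y_part c d = 0" using assms y_part_inner[of c d] by auto
  have "dr c d (y_part Omega e) = 0" by (rule dr_y_part) (use assms y in auto)
  then show ?thesis unfolding cocycle_def y by (simp add: comm_def clinear_0[OF clinear_dr])
qed

lemma y_part_cocycle:
  assumes "distinct [a, b, c, d]"
  shows "cocycle a b c d = 0"
proof -
  consider "a = Omega" | "b = Omega" | "c = Omega" | "d = Omega" | "a \<noteq> Omega" "b \<noteq> Omega" "c \<noteq> Omega" "d \<noteq> Omega" by blast
  then show ?thesis
  proof cases
    case 1
    then show ?thesis using assms cocycle_omega by metis
  next
    case 2
    have "distinct [b, a, c, d]" using assms by auto
    then show ?thesis using 2 cocycle_omega cocycle_sym by metis
  next
    case 3
    have "distinct [c, d, a, b]" using assms by auto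
    then show ?thesis using 3 cocycle_omega cocycle_swap by (metis neg_equal_0_iff_equal)
  next
    case 4
    have "distinct [d, c, a, b]" using assms by auto
    then show ?thesis using 4 cocycle_omega cocycle_swap cocycle_sym by (metis neg_equal_0_iff_equal)
  next
    case 5
    have "dr a b (y_part c d) = 0" by (rule dr_y_part) (use assms 5 in auto)
    moreover have "dr c d (y_part a b) = 0" by (rule dr_y_part) (use assms 5 in auto)
    moreover have "comm (y_part c d) (y_part a b) = 0"
      using 5 y_part_inner[of a b] y_part_inner[of c d] by (simp add: comm_def del: ltr.simps)
    ultimately show ?thesis by (simp add: cocycle_def)
  qed
qed

section \<open>The action of the enveloping algebra on the free algebra\<close>

lift_definition dr_endo :: "'n::finite base \<Rightarrow> 'n base \<Rightarrow> 'n free_alg lin_endo" is dr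
  by (rule clinear_dr)

text \<open>The last clause moves X_ab past P and then replaces X_ab, now acting on the generator of
  the induced module, by its part outside s(p_{m-1}); hence the multiplication from the
  right.\<close>

fun fiber_gen :: "'n::{finite,linorder} idx \<Rightarrow> 'n idx \<Rightarrow> 'n free_alg lin_endo" where
  "fiber_gen Beta Beta = 0"
| "fiber_gen Beta (Nb v) = lmul (ltr v)"
| "fiber_gen (Nb v) Beta = lmul (ltr v)"
| "fiber_gen (Nb a) (Nb b) = dr_endo a b + rmul (y_part a b)"

lemma app_sum: "app_endo (sum f A) x = (\<Sum>a\<in>A. app_endo (f a) x)"
  by (induction A rule: infinite_finite_induct) (simp_all add: zero_lin_endo.rep_eq plus_lin_endo.rep_eq)

lemmas app_simps = zero_lin_endo.rep_eq one_lin_endo.rep_eq plus_lin_endo.rep_eq minus_lin_endo.rep_eq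
  times_lin_endo.rep_eq lmul.rep_eq rmul.rep_eq dr_endo.rep_eq app_sum scaleC_lin_endo.rep_eq

lemma lin_endo_eqI: "(\<And>x. app_endo f x = app_endo g x) \<Longrightarrow> f = g"
  by (metis app_endo_inject ext)

lemma fiber_gen_commute:
  assumes "distinct [a, b, c, d]"
  shows "comm (fiber_gen a b) (fiber_gen c d) = 0"
proof -
  have 1: "comm (dr_endo a b + rmul (y_part a b)) (lmul (ltr c)) = 0" if "distinct [a, b, c]" for a b c :: "'a base"
  proof (rule lin_endo_eqI)
    fix P
    have "dr a b (ltr c) = 0" using that by (auto simp: dr_ltr brk_def)
    then show "app_endo (comm (dr_endo a b + rmul (y_part a b)) (lmul (ltr c))) P = app_endo 0 P"
      by (simp add: comm_def app_simps dr_mult algebra_simps)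
  qed
  have 2: "comm (lmul (ltr c)) (dr_endo a b + rmul (y_part a b)) = 0" if "distinct [a, b, c]" for a b c :: "'a base"
    using 1[OF that] unfolding comm_def by simp
  have 3: "comm (dr_endo a b + rmul (y_part a b)) (dr_endo c d + rmul (y_part c d)) = 0"
    if "distinct [a, b, c, d]" for a b c d :: "'a base"
  proof (rule lin_endo_eqI)
    fix P
    have "app_endo (comm (dr_endo a b + rmul (y_part a b)) (dr_endo c d + rmul (y_part c d))) P
      = (dr a b (dr c d P) - dr c d (dr a b P))
        + P * cocycle a b c d"
      by (simp add: comm_def cocycle_def app_simps dr_mult clinear_add[OF clinear_dr] algebra_simps)
    then show "app_endo (comm (dr_endo a b + rmul (y_part a b)) (dr_endo c d + rmul (y_part c d))) P = app_endo 0 P"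
      using dr_commute[OF that, of P] y_part_cocycle[OF that] by (simp add: app_simps)
  qed
  show ?thesis
    using assms 1 2 3 by (cases a; cases b; cases c; cases d) auto
qed

lemma fiber_gen_sym: "fiber_gen a b = fiber_gen b a"
  by (cases a; cases b) (simp_all add: y_part_sym dr_endo_def dr_sym)

lemma fiber_gen_diag: "fiber_gen a a = 0"
proof (cases a)
  case (Nb v)
  then show ?thesis
    by (intro lin_endo_eqI) (simp add: app_simps dr_diag y_part_def)
qed simp

lemma sum_fiber_gen: "(\<Sum>b\<in>UNIV. fiber_gen a b) = 0"
proof (rule lin_endo_eqI)
  fix P
  show "app_endo (\<Sum>b\<in>UNIV. fiber_gen a b) P = app_endo 0 P"
  proof (cases a)
    case Beta
    then show ?thesis by (simp add: sum_idx app_simps sum_ltr flip: sum_distrib_right)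
  next
    case (Nb v)
    then show ?thesis
      by (simp add: sum_idx app_simps sum.distrib sum_dr sum_y_part comm_def flip: sum_distrib_left)
  qed
qed

lemma fiber_proj_exists:
  "\<exists>ev :: 'n::{finite,linorder} idx braid_lie uea \<Rightarrow> 'n free_alg. clinear ev \<and> ev 1 = 1 \<and>
     (\<forall>v u. ev (uemb (gX (Nb v) \<beta>) * u) = ltr v * ev u) \<and>
     (\<forall>a b u. ev (uemb (gX (Nb a) (Nb b)) * u) = dr a b (ev u) + ev u * y_part a b)"
proof -
  obtain f :: "'n idx braid_lie \<Rightarrow> 'n free_alg lin_endo" where
    f: "clinear f" "\<And>x y. f (lie x y) = comm (f x) (f y)" "\<And>a b. f (gX a b) = fiber_gen a b"
    using braid_lie_universal[of fiber_gen] fiber_gen_diag fiber_gen_sym sum_fiber_gen fiber_gen_commute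
    by blast
  obtain \<Phi> where \<Phi>: "alg_hom \<Phi>" "\<And>x. \<Phi> (uemb x) = f x"
    using uea_universal[of f, OF f(1,2)] by blast
  have "clinear (\<lambda>u. app_endo (\<Phi> u) 1)"
    using \<Phi>(1) unfolding alg_hom_def
    by (intro clinearI) (simp_all add: clinear_add clinear_scaleC app_simps)
  with \<Phi> show ?thesis
    by (intro exI[of _ "\<lambda>u. app_endo (\<Phi> u) 1"]) (simp add: alg_hom_def f(3) app_simps)
qed

definition fiber_proj :: "'n::{finite,linorder} idx braid_lie uea \<Rightarrow> 'n free_alg" where
  "fiber_proj = (SOME ev. clinear ev \<and> ev 1 = 1 \<and>
     (\<forall>v u. ev (uemb (gX (Nb v) \<beta>) * u) = ltr v * ev u) \<and>
     (\<forall>a b u. ev (uemb (gX (Nb a) (Nb b)) * u) = dr a b (ev u) + ev u * y_part a b))"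

lemma clinear_fiber_proj: "clinear fiber_proj"
  and fiber_proj_one: "fiber_proj 1 = 1"
  and fiber_proj_letter: "fiber_proj (uemb (gX (Nb v) \<beta>) * u) = ltr v * fiber_proj u"
  and fiber_proj_base: "fiber_proj (uemb (gX (Nb a) (Nb b)) * u) = dr a b (fiber_proj u) + fiber_proj u * y_part a b"
  using someI_ex[OF fiber_proj_exists, folded fiber_proj_def] by blast+

section \<open>The splitting of the enveloping algebra\<close>

lemma clinear_lie: "clinear (lie (x :: 'a::lie_alg))"
  by (rule clinearI) (simp_all add: lie_add_right lie_scaleC_right)

lemma clinear_lie_left: "clinear (\<lambda>x. lie (x :: 'a::lie_alg) y)"
  by (rule clinearI) (simp_all add: lie_add_left lie_scaleC_left)

lemma lie_antisym: "lie (x :: 'a::lie_alg) y = - lie y x"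
proof -
  have "lie (x + y) (x + y) = lie x y + lie y x"
    unfolding lie_add_left lie_add_right by (simp add: lie_self)
  then show ?thesis by (simp add: lie_self eq_neg_iff_add_eq_0)
qed

lemma comm_mult: "comm a (b * c) = comm a b * c + b * comm a c" for a :: "'a::ring"
  by (simp add: comm_def algebra_simps)

lemma alg_hom_comm: "alg_hom f \<Longrightarrow> f (comm x y) = comm (f x) (f y)"
  by (simp add: alg_hom_def comm_def clinear_diff)

section \<open>Evaluation of words and commutators with the letters\<close>

lemma word_eval_word: "word_eval (word w) = prod_list (map (uemb \<circ> letter_val) w)"
  by (simp add: word_eval_def word_def scaleC_one)

lemma clinear_word_eval: "clinear word_eval"
  using clinear_lin_ext[of "\<lambda>w. prod_list (map (uemb \<circ> letter_val) w)"]
  by (simp add: word_eval_def[abs_def] lin_ext_def[abs_def])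

lemma word_eval_one: "word_eval 1 = 1"
  using word_eval_word[of "[]"] by (simp add: word_Nil)

lemma clinear_eq_on_words:
  assumes "clinear f" "clinear g" "\<And>w. f (word w) = g (word w)"
  shows "f P = g P"
  using clinear_poly_mapping_eqI[of f g] assms by (simp add: word_def)

lemma word_eval_mult: "word_eval (P * Q) = word_eval P * word_eval Q"
proof -
  have w: "word_eval (word v * word w) = word_eval (word v) * word_eval (word w)" for v w :: "'a letter list"
    by (simp add: word_eval_word flip: word_append)
  have "word_eval (word v * Q) = word_eval (word v) * word_eval Q" for v
    by (rule clinear_eq_on_words[OF clinear_compose[OF clinear_word_eval clinear_mult_left]
          clinear_compose[OF clinear_mult_left clinear_word_eval] w])
  then show ?thesis
    by (rule clinear_eq_on_words[OF clinear_compose[OF clinear_word_eval clinear_mult_right]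
          clinear_compose[OF clinear_mult_right clinear_word_eval]])
qed

lemma alg_hom_word_eval: "alg_hom word_eval"
  using clinear_word_eval by (simp add: alg_hom_def word_eval_mult word_eval_one)

lemma letter_val_eq: "letter_val l = gX (Nb (base_of l)) \<beta>"
  by (cases l) (simp_all add: gX_sym[of Beta])

lemma fiber_proj_word_eval: "fiber_proj (word_eval P) = P"
proof (rule clinear_eq_on_words[OF clinear_compose[OF clinear_fiber_proj clinear_word_eval], of "\<lambda>P. P"])
  show "fiber_proj (word_eval (word w)) = word w" for w :: "'a letter list"
  proof (induction w)
    case Nil
    then show ?case by (simp add: word_eval_one fiber_proj_one word_Nil)
  next
    case (Cons l w)
    then show ?case
      using word_eval_word[of "[l]"]
      by (simp add: word_eval_mult letter_val_eq fiber_proj_letter ltr_base_of word_Cons[of l w])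
  qed
qed (simp add: clinearI)

lemma word_eval_ltr: "word_eval (ltr v) = uemb (gX (Nb v) \<beta>)"
proof (cases v)
  case Alpha
  have "(\<Sum>b\<in>UNIV. gX \<beta> (b :: 'a idx)) = 0" by (rule sum_gX)
  then have "gX \<beta> \<alpha> = - ((\<Sum>i\<in>UNIV. gX (i_pt (i :: 'a)) \<beta>) + gX \<beta> \<omega>)"
    unfolding eq_neg_iff_add_eq_0
    by (simp add: sum_idx sum_base gX_diag gX_sym[of \<beta> "i_pt _"] ac_simps)
  then have "uemb (gX \<alpha> \<beta> :: 'a idx braid_lie) = - ((\<Sum>i\<in>UNIV. uemb (gX (i_pt (i :: 'a)) \<beta>)) + uemb (gX \<beta> \<omega>))"
    by (simp add: gX_sym[of \<alpha> \<beta>] clinear_minus[OF clinear_uemb] clinear_diff[OF clinear_uemb] clinear_add[OF clinear_uemb] clinear_sum[OF clinear_uemb])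
  then show ?thesis using Alpha
    by (simp add: clinear_minus[OF clinear_word_eval] clinear_add[OF clinear_word_eval] clinear_diff[OF clinear_word_eval]
        clinear_sum[OF clinear_word_eval] word_eval_word)
qed (simp_all add: word_eval_word gX_sym[of \<beta>])

text \<open>Bracketing X_c\<beta> with the relation \<Sum> X_db = 0 leaves only b = \<beta> and b =
  c, since the other pairs are disjoint or degenerate.\<close>

lemma lie_gX_adjacent:
  assumes "c \<noteq> d"
  shows "lie (gX (Nb c) (Nb d)) (gX (Nb c) \<beta>) = lie (gX (Nb c) \<beta>) (gX (Nb d) (\<beta> :: 'n::finite idx))"
proof -
  have "0 = lie (gX (Nb c) \<beta>) (\<Sum>b\<in>UNIV. gX (Nb d) b)"
    by (simp add: sum_gX clinear_0[OF clinear_lie])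
  also have "\<dots> = (\<Sum>b\<in>UNIV. lie (gX (Nb c) \<beta>) (gX (Nb d) b))"
    by (simp add: clinear_sum[OF clinear_lie])
  also have "\<dots> = (\<Sum>b\<in>{\<beta>, Nb c}. lie (gX (Nb c) \<beta>) (gX (Nb d) b))"
  proof (rule sum.mono_neutral_right)
    show "\<forall>b\<in>UNIV - {\<beta>, Nb c}. lie (gX (Nb c) \<beta>) (gX (Nb d) b) = 0"
    proof
      fix b assume "b \<in> UNIV - {\<beta>, Nb c}"
      then show "lie (gX (Nb c) \<beta>) (gX (Nb d) b) = 0"
        using assms by (cases "b = Nb d") (auto simp: gX_diag clinear_0[OF clinear_lie] intro!: gX_comm)
    qed
  qed auto
  finally have "lie (gX (Nb c) \<beta>) (gX (Nb d) \<beta>) + lie (gX (Nb c) \<beta>) (gX (Nb c) (Nb d)) = 0"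
    by (simp add: gX_sym[of "Nb d" "Nb c"])
  then show ?thesis
    unfolding lie_antisym[of "gX (Nb c) (Nb d)"] by (metis eq_neg_iff_add_eq_0)
qed

lemma comm_gX_letter: "comm (uemb (gX (Nb c) (Nb d))) (uemb (gX (Nb v) \<beta>)) = word_eval (brk c d v)"
proof (cases "c = d")
  case True
  then show ?thesis
    by (simp add: gX_diag clinear_0[OF clinear_uemb] brk_diag clinear_0[OF clinear_word_eval] comm_def)
next
  case False
  have eq: "comm (uemb (gX (Nb c) (Nb d))) (uemb (gX (Nb c) \<beta>)) = word_eval (comm (ltr c) (ltr d))"
    if "c \<noteq> d" for c d :: "'a base"
    by (simp add: alg_hom_comm[OF alg_hom_word_eval] word_eval_ltr lie_gX_adjacent[OF that] flip: uemb_lie)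
  show ?thesis
    unfolding brk_def
    using False eq[of c d] eq[of d c]
    by (auto simp: gX_sym[of "Nb d" "Nb c"] gX_comm clinear_0[OF clinear_uemb] clinear_0[OF clinear_word_eval] simp flip: uemb_lie)
qed

lemma comm_gX_word_eval: "comm (uemb (gX (Nb c) (Nb d))) (word_eval P) = word_eval (dr c d P)"
proof (rule clinear_eq_on_words[OF clinear_compose[OF clinear_comm clinear_word_eval]
      clinear_compose[OF clinear_word_eval clinear_dr]])
  show "comm (uemb (gX (Nb c) (Nb d))) (word_eval (word w)) = word_eval (dr c d (word w))" for w
  proof (induction w)
    case Nil
    then show ?case
      by (simp add: word_eval_one dr_def word_Nil der_one clinear_0[OF clinear_word_eval] comm_def)
  next
    case (Cons l w)
    have "comm (uemb (gX (Nb c) (Nb d))) (word_eval (word [l])) = word_eval (dr c d (word [l]))"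
      using comm_gX_letter[of c d "base_of l"]
      by (simp add: word_eval_ltr dr_ltr flip: ltr_base_of)
    then show ?case
      using Cons by (simp add: word_Cons[of l w] word_eval_mult comm_mult dr_mult clinear_add[OF clinear_word_eval])
  qed
qed

lemma subspace_range_word_eval: "cvec.subspace (range word_eval)"
proof (rule cvec.subspaceI)
  show "0 \<in> range word_eval" using clinear_0[OF clinear_word_eval] by (metis rangeI)
qed (auto simp flip: clinear_add[OF clinear_word_eval] clinear_scaleC[OF clinear_word_eval])

text \<open>Commutators with X_v\<beta> stay in the subalgebra because X_v\<beta> lies in it;
  commutators with the other generators act through \<open>dr\<close>. This replaces the knowledge
  that the kernel of the projection is generated by the letters.\<close>

lemma comm_range_word_eval: "comm (uemb x) (word_eval P) \<in> range word_eval"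
proof (induction x arbitrary: P rule: braid_lie_induct)
  case (gen a b)
  show ?case
  proof (cases "a = \<beta> \<or> b = \<beta>")
    case True
    then have "uemb (gX a b) \<in> range word_eval"
      by (cases a; cases b) (auto simp: gX_diag clinear_0[OF clinear_uemb] gX_sym[of \<beta>] cvec.subspace_0[OF subspace_range_word_eval] simp flip: word_eval_ltr)
    then show ?thesis by (auto simp flip: alg_hom_comm[OF alg_hom_word_eval])
  next
    case False
    then show ?thesis by (cases a; cases b) (auto simp: comm_gX_word_eval)
  qed
next
  case (add u v)
  have "comm (uemb (u + v)) (word_eval P) = comm (uemb u) (word_eval P) + comm (uemb v) (word_eval P)"
    by (simp add: clinear_add[OF clinear_uemb] comm_def algebra_simps)
  then show ?case by (metis add cvec.subspace_add[OF subspace_range_word_eval])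
next
  case (scale c u)
  have "comm (uemb (c *\<^sub>C u)) (word_eval P) = c *\<^sub>C comm (uemb u) (word_eval P)"
    by (simp add: clinear_scaleC[OF clinear_uemb] comm_def algebra_simps scaleC_mult_left scaleC_mult_right)
  then show ?case by (metis scale cvec.subspace_scale[OF subspace_range_word_eval])
next
  case (lie u v)
  have "comm (uemb (lie u v)) (word_eval P)
      = comm (uemb u) (comm (uemb v) (word_eval P)) - comm (uemb v) (comm (uemb u) (word_eval P))"
    by (simp add: uemb_lie comm_def algebra_simps)
  moreover have "comm (uemb u) (comm (uemb v) (word_eval P)) \<in> range word_eval"
    "comm (uemb v) (comm (uemb u) (word_eval P)) \<in> range word_eval"
    using lie.IH by (metis rangeE)+
  ultimately show ?case using cvec.subspace_diff[OF subspace_range_word_eval] by simp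
qed

lemma uea_left_ideal_mult: "u \<in> uea_left_ideal H \<Longrightarrow> v * u \<in> uea_left_ideal H"
  unfolding uea_left_ideal_def
proof (induction rule: cvec.span_induct_alt)
  case (step c x y)
  then obtain u h where "x = u * uemb h" "h \<in> H" by blast
  then have "v * x = (v * u) * uemb h" by (simp add: mult.assoc)
  then have "v * x \<in> cvec.span {u * uemb h |u h. h \<in> H}"
    using \<open>h \<in> H\<close> by (intro cvec.span_base) blast
  with step show ?case
    unfolding distrib_left scaleC_mult_right by (intro cvec.span_add cvec.span_scale)
qed (simp add: cvec.span_zero)

text \<open>Each generator changes \<open>fiber_proj\<close> by a linear operator, so the kernel is
  a left ideal.\<close>

lemma fiber_proj_left_ideal: "fiber_proj u = 0 \<Longrightarrow> fiber_proj (v * u) = 0"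
proof -
  assume u: "fiber_proj u = 0"
  have "{v. fiber_proj (v * u) = 0} = UNIV"
  proof (rule uea_left_induct)
    have "clinear (\<lambda>v. fiber_proj (v * u))"
      by (rule clinear_compose[OF clinear_fiber_proj clinear_mult_right])
    from clinear_subspace_vimage[OF this cvec.subspace_single_0]
    show "cvec.subspace {v. fiber_proj (v * u) = 0}" by simp
  next
    fix a b v assume "v \<in> {v. fiber_proj (v * u) = 0}"
    then show "uemb (gX a b) * v \<in> {v. fiber_proj (v * u) = 0}"
      by (cases a; cases b)
        (simp_all add: mult.assoc fiber_proj_letter fiber_proj_base clinear_0[OF clinear_dr]
          gX_diag clinear_0[OF clinear_uemb] clinear_0[OF clinear_fiber_proj] gX_sym[of \<beta> "Nb _"])
  qed (simp add: u)
  then show ?thesis by blast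
qed

section \<open>The section s and the direct sum decomposition\<close>

context
  fixes p :: "'n::{finite,linorder} idx braid_lie \<Rightarrow> 'n base braid_lie"
    and s :: "'n base braid_lie \<Rightarrow> 'n idx braid_lie"
  assumes p: "is_pi_beta p" and s: "is_section p s"
begin

lemma clinear_p: "clinear p" and p_lie: "p (lie x y) = lie (p x) (p y)"
  and p_beta: "p (gX \<beta> v) = 0" and p_gX: "p (gX (Nb a) (Nb b)) = gX a b"
  using p by (auto simp: is_pi_beta_def lie_hom_def)

lemma clinear_s: "clinear s" and s_lie: "s (lie h k) = lie (s h) (s k)" and p_s: "p (s h) = h"
  and s_alpha: "i < Max UNIV \<Longrightarrow> s (gX Alpha (Pt i)) = gX \<alpha> (i_pt i)"
  and s_pt: "i < j \<Longrightarrow> s (gX (Pt i) (Pt j)) = gX (i_pt i) (i_pt j)"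
  using s by (auto simp: is_section_def lie_hom_def)

definition offset :: "'n base \<Rightarrow> 'n base \<Rightarrow> 'n idx braid_lie" where
  "offset a b = gX (Nb a) (Nb b) - s (gX a b)"

lemma offset_sym: "offset a b = offset b a"
  unfolding offset_def by (simp add: gX_sym[of "Nb a"] gX_sym[of a])

lemma offset_diag: "offset a a = 0"
  unfolding offset_def by (simp add: gX_diag clinear_0[OF clinear_s])

lemma sum_offset: "(\<Sum>b\<in>UNIV. offset a b) = - gX (Nb a) \<beta>"
  using sum_gX[of "Nb a"] unfolding offset_def
  by (simp add: sum_subtractf clinear_sum[OF clinear_s, symmetric] sum_gX clinear_0[OF clinear_s] sum_idx eq_neg_iff_add_eq_0 add.commute)

lemma offset_alpha: "i \<noteq> Max UNIV \<Longrightarrow> offset Alpha (Pt i) = 0"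
  unfolding offset_def by (subst s_alpha) (simp_all add: order.not_eq_order_implies_strict)

lemma offset_pt: "offset (Pt i) (Pt j) = 0"
  using s_pt[of i j] s_pt[of j i] gX_sym[of "Pt i"] gX_sym[of "i_pt i"]
  by (cases i j rule: linorder_cases) (auto simp: offset_diag offset_def)

text \<open>Only some values of s are prescribed; they make the offsets between points, and those of
  \<alpha> with i < n, vanish. The remaining ones solve the linear system given by the row sums
  \<open>sum_offset\<close>, so s is determined on all generators.\<close>

lemma offset_eq: "uemb (offset a b) = word_eval (y_part a b)"
proof -
  let ?n = "Max UNIV :: 'n"
  note ev = word_eval_ltr clinear_minus[OF clinear_word_eval] clinear_diff[OF clinear_word_eval]
    clinear_0[OF clinear_word_eval] clinear_0[OF clinear_uemb] clinear_minus[OF clinear_uemb] clinear_diff[OF clinear_uemb]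
  have low: "offset (Pt i) Omega = - gX (i_pt i) \<beta>" if "i \<noteq> ?n" for i
    using sum_offset[of "Pt i"] offset_alpha[OF that] offset_sym[of Alpha "Pt i"]
    by (simp add: sum_base offset_pt)
  have n: "offset Alpha (Pt ?n) + offset (Pt ?n) Omega = - gX (i_pt ?n) \<beta>"
    using sum_offset[of "Pt ?n"] offset_sym[of Alpha "Pt ?n"]
    by (simp add: sum_base offset_pt)
  have "(\<Sum>i\<in>UNIV. offset Alpha (Pt i)) = offset Alpha (Pt ?n)"
    using sum.mono_neutral_right[of UNIV "{?n}" "\<lambda>i. offset Alpha (Pt i)"] by (auto simp: offset_alpha)
  then have al: "offset Alpha Omega + offset Alpha (Pt ?n) = - gX \<alpha> \<beta>"
    using sum_offset[of Alpha] by (simp add: sum_base offset_diag)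
  have "(\<Sum>i\<in>UNIV. offset Omega (Pt i)) = offset (Pt ?n) Omega - (\<Sum>i\<in>UNIV - {?n}. gX (i_pt i) \<beta>)"
    by (subst sum.remove[of UNIV ?n]) (auto simp: offset_sym[of Omega] low sum_negf[symmetric] intro!: sum.cong)
  then have om: "offset Alpha Omega + offset (Pt ?n) Omega - (\<Sum>i\<in>UNIV - {?n}. gX (i_pt i) \<beta>) = - gX \<omega> \<beta>"
    using sum_offset[of Omega]
    by (simp only: sum_base offset_diag offset_sym[of Omega Alpha] add_0_right add_diff_eq)
  have be: "gX \<alpha> \<beta> + gX \<omega> \<beta> + gX (i_pt ?n) \<beta> + (\<Sum>i\<in>UNIV - {?n}. gX (i_pt i) \<beta>) = 0"
    using sum_gX[of "\<beta> :: 'n idx"] sum.remove[of UNIV ?n "\<lambda>i. gX (i_pt i) \<beta>"]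
    by (simp add: sum_idx sum_base gX_diag gX_sym[of \<beta>] add.assoc)
  \<comment> \<open>The row sums at n and \<alpha> minus the one at \<omega> leave twice the
    unknown; the relation at \<beta> simplifies the other side.\<close>
  have "offset Alpha (Pt ?n) + offset Alpha (Pt ?n) = gX \<omega> \<beta> + gX \<omega> \<beta>"
  proof -
    have "offset Alpha (Pt ?n) + offset Alpha (Pt ?n) =
       (offset Alpha (Pt ?n) + offset (Pt ?n) Omega) + (offset Alpha Omega + offset Alpha (Pt ?n))
       - (offset Alpha Omega + offset (Pt ?n) Omega - (\<Sum>i\<in>UNIV - {?n}. gX (i_pt i) \<beta>))
       - (\<Sum>i\<in>UNIV - {?n}. gX (i_pt i) \<beta>)"
      by (simp add: algebra_simps)
    also have "\<dots> = gX \<omega> \<beta> + gX \<omega> \<beta> - (gX \<alpha> \<beta> + gX \<omega> \<beta> + gX (i_pt ?n) \<beta> + (\<Sum>i\<in>UNIV - {?n}. gX (i_pt i) \<beta>))"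
      unfolding n al om by (simp add: algebra_simps)
    finally show ?thesis unfolding be by simp
  qed
  then have "2 *\<^sub>C offset Alpha (Pt ?n) = 2 *\<^sub>C gX \<omega> \<beta>"
    using scaleC_add_left[of 1 1] scaleC_one by (metis one_add_one)
  then have n1: "offset Alpha (Pt ?n) = gX \<omega> \<beta>"
    by (simp add: cvec.scale_left_imp_eq)
  have n2: "offset (Pt ?n) Omega = - gX (i_pt ?n) \<beta> - gX \<omega> \<beta>"
    using n n1 by (simp add: eq_diff_eq add.commute)
  have n3: "offset Alpha Omega = - gX \<alpha> \<beta> - gX \<omega> \<beta>"
    using al n1 by (simp add: eq_diff_eq)
  have om_case: "uemb (offset v Omega) = word_eval (y_om v)" if "v \<noteq> Omega" for v
    using that by (cases v) (auto simp: y_om_def low n2 n3 ev simp del: ltr.simps)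
  have pt_case: "uemb (offset Alpha (Pt i)) = word_eval (y_part Alpha (Pt i))" for i
    by (cases "i = ?n") (simp_all add: n1 offset_alpha y_part_def doubleton_eq_iff ev del: ltr.simps)
  have pts: "y_part (Pt i) (Pt j) = 0" for i j
    by (auto simp: y_part_def doubleton_eq_iff)
  show ?thesis
    using om_case[of a] om_case[of b] pt_case
    by (cases a; cases b)
      (auto simp: offset_diag offset_pt pts ev offset_sym[of Omega] offset_sym[of "Pt _" Alpha] y_part_sym[of "Pt _" Alpha]
        simp del: ltr.simps, auto simp: y_part_def clinear_0[OF clinear_word_eval])
qed

text \<open>On generators the two copies of \<open>y_part\<close> cancel; brackets are handled
  because the kernel of \<open>fiber_proj\<close> is a left ideal.\<close>

lemma fiber_proj_s: "fiber_proj (uemb (s h)) = 0"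
proof (induction h rule: braid_lie_induct)
  case (gen a b)
  have "s (gX a b) = gX (Nb a) (Nb b) - offset a b" by (simp add: offset_def)
  moreover have "fiber_proj (uemb (gX (Nb a) (Nb b))) = y_part a b"
    using fiber_proj_base[of a b 1] by (simp add: fiber_proj_one dr_def der_one)
  ultimately show ?case
    by (simp add: clinear_diff[OF clinear_uemb] clinear_diff[OF clinear_fiber_proj] offset_eq fiber_proj_word_eval)
next
  case (lie u v)
  then show ?case
    by (simp add: s_lie uemb_lie comm_def clinear_diff[OF clinear_fiber_proj] fiber_proj_left_ideal)
qed (simp_all add: clinear_add[OF clinear_s] clinear_add[OF clinear_uemb] clinear_add[OF clinear_fiber_proj]
    clinear_scaleC[OF clinear_s] clinear_scaleC[OF clinear_uemb] clinear_scaleC[OF clinear_fiber_proj])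

lemma fiber_proj_Us: "u \<in> uea_left_ideal (range s) \<Longrightarrow> fiber_proj u = 0"
  unfolding uea_left_ideal_def
  by (rule clinear_eq_on_span[where g = "\<lambda>_. 0"])
    (auto simp: fiber_proj_s fiber_proj_left_ideal intro: clinear_fiber_proj clinearI)

text \<open>Every x differs from some s h by an element of the kernel whose image is a combination
  of words; this property passes to brackets. If x is in the kernel itself, applying
  \<open>p\<close> shows h = 0.\<close>

lemma uemb_kernel: 
  assumes "p x = 0"
  shows "uemb x \<in> range word_eval"
proof -
  note R = subspace_range_word_eval
  have "\<exists>h. uemb (x - s h) \<in> range word_eval \<and> p (x - s h) = 0" for x
  proof (induction x rule: braid_lie_induct)
    case (gen a b)
    show ?case
    proof (cases "a = \<beta> \<or> b = \<beta>")
      case True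
      then have "uemb (gX a b) \<in> range word_eval \<and> p (gX a b) = 0"
        by (cases a; cases b) (auto simp: gX_diag clinear_0[OF clinear_uemb] clinear_0[OF clinear_p] p_beta
            gX_sym[of _ \<beta>] cvec.subspace_0[OF R] intro: word_eval_ltr[unfolded gX_sym[of _ \<beta>], symmetric])
      then show ?thesis by (intro exI[of _ 0]) (simp add: clinear_0[OF clinear_s])
    next
      case False
      then obtain v w where "a = Nb v" "b = Nb w" by (cases a; cases b) auto
      then show ?thesis
        using offset_eq[of v w]
        by (intro exI[of _ "gX v w"]) (auto simp: offset_def clinear_diff[OF clinear_p] p_s p_gX)
    qed
  next
    case (add u v)
    then obtain h k where hk: "uemb (u - s h) \<in> range word_eval" "p (u - s h) = 0"
      "uemb (v - s k) \<in> range word_eval" "p (v - s k) = 0" by blast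
    have "u + v - s (h + k) = (u - s h) + (v - s k)" by (simp add: clinear_add[OF clinear_s])
    then show ?case using hk cvec.subspace_add[OF R hk(1,3)]
      by (intro exI[of _ "h + k"]) (simp only: clinear_add[OF clinear_uemb] clinear_add[OF clinear_p] add_0_right simp_thms)
  next
    case (scale c u)
    then obtain h where hk: "uemb (u - s h) \<in> range word_eval" "p (u - s h) = 0" by blast
    have "c *\<^sub>C u - s (c *\<^sub>C h) = c *\<^sub>C (u - s h)"
      by (simp add: clinear_scaleC[OF clinear_s] cvec.scale_right_diff_distrib)
    then show ?case using hk cvec.subspace_scale[OF R hk(1)]
      by (intro exI[of _ "c *\<^sub>C h"]) (simp only: clinear_scaleC[OF clinear_uemb] clinear_scaleC[OF clinear_p] cvec.scale_zero_right simp_thms)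
  next
    case (lie u v)
    then obtain h k where hk: "uemb (u - s h) \<in> range word_eval" "p (u - s h) = 0"
      "uemb (v - s k) \<in> range word_eval" "p (v - s k) = 0" by blast
    \<comment> \<open>Each bracket on the right contains a difference whose image is a combination
      of words, and such combinations are stable under commutators.\<close>
    have "lie u v - s (lie h k) = lie u (v - s k) - lie (s k) (u - s h)"
      using lie_antisym[of "s k" "u - s h"]
      by (simp add: s_lie clinear_diff[OF clinear_lie] clinear_diff[OF clinear_lie_left])
    moreover have "uemb (lie u (v - s k)) \<in> range word_eval" "uemb (lie (s k) (u - s h)) \<in> range word_eval"
      using hk(1,3) comm_range_word_eval unfolding uemb_lie by auto
    ultimately show ?case
      using hk cvec.subspace_diff[OF R]
      by (intro exI[of _ "lie h k"])
        (simp add: clinear_diff[OF clinear_uemb] clinear_diff[OF clinear_p] p_lie clinear_0[OF clinear_lie])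
  qed
  then obtain h where h: "uemb (x - s h) \<in> range word_eval" "p (x - s h) = 0" by blast
  then have "h = 0" using assms by (simp add: clinear_diff[OF clinear_p] p_s)
  then show ?thesis using h by (simp add: clinear_0[OF clinear_s])
qed

lemma Uf_eq: "uea_sub {x. p x = 0} = range word_eval"
proof
  have "prod_list (map uemb xs) \<in> range word_eval" if "set xs \<subseteq> {x. p x = 0}" for xs
    using that
  proof (induction xs)
    case Nil
    have "1 \<in> range word_eval" by (metis word_eval_one rangeI)
    then show ?case by simp
  next
    case (Cons x xs)
    then obtain P Q where "prod_list (map uemb xs) = word_eval P" "uemb x = word_eval Q"
      using uemb_kernel[of x] by auto
    then show ?case by (simp flip: word_eval_mult)
  qed
  then show "uea_sub {x. p x = 0} \<subseteq> range word_eval"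
    unfolding uea_sub_def by (intro cvec.span_minimal[OF _ subspace_range_word_eval]) auto
next
  have "prod_list (map (uemb \<circ> letter_val) w) \<in> uea_sub {x. p x = 0}" for w :: "'n letter list"
    unfolding uea_sub_def
    by (rule cvec.span_base) (auto simp: letter_val_eq gX_sym[of _ \<beta>] p_beta intro!: exI[of _ "map letter_val w"])
  then show "range word_eval \<subseteq> uea_sub {x. p x = 0}"
    unfolding word_eval_def
    by (auto simp: uea_sub_def intro!: cvec.span_sum cvec.span_scale)
qed

lemma uea_decomp: "u - word_eval (fiber_proj u) \<in> uea_left_ideal (range s)"
proof -
  note R = subspace_range_word_eval
  let ?Us = "uea_left_ideal (range s)"
  have S: "cvec.subspace ?Us" by (simp add: uea_left_ideal_def)
  let ?M = "{r + t | r t. r \<in> range word_eval \<and> t \<in> ?Us}"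
  have M: "cvec.subspace ?M" by (rule cvec.subspace_sums[OF R S])
  have "?M = UNIV"
  proof (rule uea_left_induct[OF M])
    have "1 = word_eval 1" by (simp add: word_eval_one)
    then show "1 \<in> ?M" using cvec.subspace_0[OF S] by force
  next
    fix a b u assume "u \<in> ?M"
    then obtain P t where u: "u = word_eval P + t" "t \<in> ?Us" by blast
    have "uemb (gX a b) * word_eval P \<in> ?M"
    proof (cases "a = \<beta> \<or> b = \<beta>")
      case True
      then have "p (gX a b) = 0" using p_beta gX_sym by metis
      from uemb_kernel[OF this] obtain Q where "uemb (gX a b) = word_eval Q" by blast
      then have "uemb (gX a b) * word_eval P = word_eval (Q * P) + 0" by (simp add: word_eval_mult)
      then show ?thesis using cvec.subspace_0[OF S] by blast
    next
      case False
      then obtain v w where vw: "a = Nb v" "b = Nb w" by (cases a; cases b) auto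
      let ?h = "s (gX v w)"
      obtain Q where Q: "comm (uemb ?h) (word_eval P) = word_eval Q" using comm_range_word_eval by blast
      have "uemb (gX a b) = word_eval (y_part v w) + uemb ?h"
        using offset_eq[of v w] by (simp add: vw offset_def clinear_diff[OF clinear_uemb] diff_eq_eq)
      \<comment> \<open>With X_ab = y + s(h), the factor s(h) is moved to the right of P; the
        commutator that arises is again a combination of words.\<close>
      then have "uemb (gX a b) * word_eval P = word_eval (y_part v w * P + Q) + word_eval P * uemb ?h"
        using Q by (simp add: word_eval_mult clinear_add[OF clinear_word_eval] comm_def algebra_simps)
      moreover have "word_eval P * uemb ?h \<in> ?Us"
        unfolding uea_left_ideal_def by (rule cvec.span_base) blast
      ultimately show ?thesis by blast
    qed
    moreover have "uemb (gX a b) * t \<in> ?M"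
    proof -
      have "uemb (gX a b) * t = 0 + uemb (gX a b) * t" by simp
      then show ?thesis using uea_left_ideal_mult[OF u(2)] cvec.subspace_0[OF R] by blast
    qed
    ultimately show "uemb (gX a b) * u \<in> ?M"
      using cvec.subspace_add[OF M] by (simp add: u distrib_left)
  qed
  then obtain P t where u: "u = word_eval P + t" "t \<in> ?Us" by blast
  then have "fiber_proj u = P"
    by (simp add: clinear_add[OF clinear_fiber_proj] fiber_proj_word_eval fiber_proj_Us)
  then show ?thesis using u by simp
qed

lemma uea_direct_sum: "direct_sum (uea_sub {x. p x = 0}) (uea_left_ideal (range s))"
  unfolding direct_sum_def
proof (intro conjI allI)
  show S: "cvec.subspace (uea_left_ideal (range s))" by (simp add: uea_left_ideal_def)
  show R: "cvec.subspace (uea_sub {x. p x = 0})" by (simp add: uea_sub_def)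
  show "\<exists>a\<in>uea_sub {x. p x = 0}. \<exists>b\<in>uea_left_ideal (range s). u = a + b" for u
    using uea_decomp[of u]
    by (intro bexI[of _ "word_eval (fiber_proj u)"] bexI[of _ "u - word_eval (fiber_proj u)"]) (auto simp: Uf_eq)
  have "u = 0" if "u = word_eval P" "u \<in> uea_left_ideal (range s)" for u P
    using fiber_proj_Us[OF that(2)] that(1) by (simp add: fiber_proj_word_eval clinear_0[OF clinear_word_eval])
  then show "uea_sub {x. p x = 0} \<inter> uea_left_ideal (range s) = {0}"
    using cvec.subspace_0[OF S] cvec.subspace_0[OF R] by (auto simp: Uf_eq)
qed

end

section \<open>Coordinate functionals of words and their degree\<close>

lemma inj_word_eval: "inj (word_eval :: ('n::{finite,linorder} letter list \<Rightarrow>\<^sub>0 complex) \<Rightarrow> _)"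
  by (metis fiber_proj_word_eval injI)

lemma word_coeff_eq: "u \<in> range word_eval \<Longrightarrow> word_coeff w u = Poly_Mapping.lookup (fiber_proj u) w"
  by (auto simp: word_coeff_def fiber_proj_word_eval inv_f_f[OF inj_word_eval])

definition word_fun :: "'n::{finite,linorder} letter list \<Rightarrow> 'n idx braid_lie uea \<Rightarrow> complex" where
  "word_fun w u = Poly_Mapping.lookup (fiber_proj u) w"

lemma clinear_word_fun: "clinear (word_fun w)"
  unfolding word_fun_def by (rule clinear_compose[OF clinear_lookup clinear_fiber_proj])

abbreviation gens :: "('s::finite \<times> 's) list \<Rightarrow> 's braid_lie uea" where
  "gens ps \<equiv> prod_list (map (\<lambda>(a, b). uemb (gX a b)) ps)"

lemma span_gens: "cvec.span (range (gens :: ('s::finite \<times> 's) list \<Rightarrow> _)) = UNIV"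
proof (rule uea_left_induct)
  show "1 \<in> cvec.span (range (gens :: ('s \<times> 's) list \<Rightarrow> _))"
    by (rule cvec.span_base) (auto intro: range_eqI[of _ _ "[]"])
next
  fix a b :: 's and u assume "u \<in> cvec.span (range (gens :: ('s \<times> 's) list \<Rightarrow> _))"
  then show "uemb (gX a b) * u \<in> cvec.span (range gens)"
  proof (induction rule: cvec.span_induct_alt)
    case (step c x y)
    then obtain ps where "x = gens ps" by blast
    then have "uemb (gX a b) * x = gens ((a, b) # ps)" by simp
    then have "uemb (gX a b) * x \<in> cvec.span (range gens)" by (metis cvec.span_base rangeI)
    with step show ?case
      unfolding distrib_left scaleC_mult_right by (intro cvec.span_add cvec.span_scale)
  qed (simp add: cvec.span_zero)
qed simp

lemma clinear_eq_on_gens: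
  assumes "clinear f" "clinear g" "\<And>ps. f (gens ps) = g (gens ps)"
  shows "f u = g u"
  using clinear_eq_on_span[OF assms(1,2), of "range gens" u] assms(3) by (auto simp: span_gens)

definition hom_part :: "nat \<Rightarrow> 'n free_alg set" where
  "hom_part d = {P. \<forall>w. length w \<noteq> d \<longrightarrow> Poly_Mapping.lookup P w = 0}"

lemma subspace_hom_part: "cvec.subspace (hom_part d)"
  by (rule cvec.subspaceI) (auto simp: hom_part_def lookup_add lookup_scaleC)

lemma word_hom_part: "length w = d \<Longrightarrow> word w \<in> hom_part d"
  by (auto simp: hom_part_def lookup_word)

lemma hom_part_span: "P \<in> hom_part d \<Longrightarrow> P \<in> cvec.span {word w | w. length w = d}"
proof -
  assume P: "P \<in> hom_part d"
  have "lin_ext word P = P"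
    by (rule clinear_eq_on_words[OF clinear_lin_ext, of "\<lambda>P. P"])
      (auto simp: clinearI word_def lin_ext_single scaleC_one)
  then have "P = (\<Sum>w\<in>Poly_Mapping.keys P. Poly_Mapping.lookup P w *\<^sub>C word w)"
    by (simp add: lin_ext_def)
  also have "\<dots> \<in> cvec.span {word w | w. length w = d}"
    using P by (intro cvec.span_sum cvec.span_scale cvec.span_base) (auto simp: hom_part_def in_keys_iff)
  finally show ?thesis .
qed

lemma hom_part_mult:
  assumes P: "P \<in> hom_part d" and Q: "Q \<in> hom_part e" and n: "n = d + e"
  shows "P * Q \<in> hom_part n"
proof -
  note S = subspace_hom_part
  have 1: "word v * R \<in> hom_part n" if "R \<in> cvec.span {word w | w. length w = e}" "length v = d" for v R
    using that(1)
  proof (induction rule: cvec.span_induct_alt)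
    case (step c x y)
    have "word v * x \<in> hom_part n"
      using step(1) that(2) n by (auto simp flip: word_append intro!: word_hom_part)
    then show ?case using step
      unfolding distrib_left scaleC_mult_right by (intro cvec.subspace_add[OF S] cvec.subspace_scale[OF S])
  qed (simp add: cvec.subspace_0[OF S])
  show ?thesis
    using hom_part_span[OF P]
  proof (induction rule: cvec.span_induct_alt)
    case (step c x y)
    have "x * Q \<in> hom_part n" using step(1) 1[OF hom_part_span[OF Q]] by auto
    then show ?case using step
      unfolding distrib_right scaleC_mult_left by (intro cvec.subspace_add[OF S] cvec.subspace_scale[OF S])
  qed (simp add: cvec.subspace_0[OF S])
qed

lemma hom_part_comm: "P \<in> hom_part d \<Longrightarrow> Q \<in> hom_part e \<Longrightarrow> comm P Q \<in> hom_part (d + e)"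
  unfolding comm_def
  by (intro cvec.subspace_diff[OF subspace_hom_part] hom_part_mult[of P d Q e] hom_part_mult[of Q e P d]) auto

lemma ltr_hom_part: "ltr v \<in> hom_part 1"
  by (cases v) (auto intro!: word_hom_part cvec.subspace_neg[OF subspace_hom_part] cvec.subspace_diff[OF subspace_hom_part] cvec.subspace_add[OF subspace_hom_part]
      cvec.subspace_sum[OF subspace_hom_part])

lemma y_part_hom_part:
  fixes a b :: "'a::{finite,linorder} base"
  shows "y_part a b \<in> hom_part 1"
proof -
  note S = subspace_hom_part
  have "(if v = Alpha \<or> v = Pt (Max UNIV) then ltr Omega else 0) \<in> hom_part 1" for v :: "'a base"
    using ltr_hom_part cvec.subspace_0[OF S] by (cases "v = Alpha \<or> v = Pt (Max UNIV)") (simp_all del: ltr.simps)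
  then have "y_om v \<in> hom_part 1" for v :: "'a base"
    unfolding y_om_def by (intro cvec.subspace_diff[OF S] cvec.subspace_neg[OF S] ltr_hom_part)
  then show ?thesis
    unfolding y_part_def by (simp add: ltr_hom_part cvec.subspace_0[OF subspace_hom_part] del: ltr.simps One_nat_def)
qed

lemma brk_hom_part: "brk a b v \<in> hom_part 2"
  using hom_part_comm[OF ltr_hom_part ltr_hom_part]
  by (auto simp: brk_def cvec.subspace_0[OF subspace_hom_part] numeral_2_eq_2 simp del: ltr.simps)

lemma dr_hom_part:
  assumes "P \<in> hom_part d"
  shows "dr a b P \<in> hom_part (Suc d)"
proof -
  note S = subspace_hom_part
  have w: "dr a b (word w) \<in> hom_part (Suc (length w))" for w
  proof (induction w)
    case Nil
    then show ?case by (simp add: dr_def word_Nil der_one cvec.subspace_0[OF S])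
  next
    case (Cons l w)
    have "dr a b (word (l # w)) = brk a b (base_of l) * word w + word [l] * dr a b (word w)"
      by (simp add: word_Cons[of l w] dr_mult) (simp add: dr_def der_letter)
    moreover have "brk a b (base_of l) * word w \<in> hom_part (Suc (length (l # w)))"
      by (rule hom_part_mult[OF brk_hom_part word_hom_part]) auto
    moreover have "word [l] * dr a b (word w) \<in> hom_part (Suc (length (l # w)))"
      by (rule hom_part_mult[OF word_hom_part Cons]) auto
    ultimately show ?case by (simp add: cvec.subspace_add[OF S])
  qed
  show ?thesis
    using hom_part_span[OF assms]
  proof (induction rule: cvec.span_induct_alt)
    case (step c x y)
    then have "dr a b x \<in> hom_part (Suc d)" using w by auto
    then show ?case using step
      unfolding clinear_add[OF clinear_dr] clinear_scaleC[OF clinear_dr]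
      by (intro cvec.subspace_add[OF S] cvec.subspace_scale[OF S])
  qed (simp add: clinear_0[OF clinear_dr] cvec.subspace_0[OF S])
qed

text \<open>Every generator acts with degree one: letters and \<open>y_part\<close> have length one,
  and derivations replace a letter by a bracket of length two. This puts the coordinate functionals
  into the graded dual.\<close>

lemma fiber_proj_gens: "fiber_proj (gens ps) \<in> hom_part (length ps)"
proof (induction ps)
  case Nil
  then show ?case by (simp add: fiber_proj_one word_hom_part flip: word_Nil)
next
  case (Cons p ps)
  obtain a b where p: "p = (a, b)" by fastforce
  have l: "ltr v * fiber_proj (gens ps) \<in> hom_part (Suc (length ps))" for v
    by (rule hom_part_mult[OF ltr_hom_part Cons]) simp
  have r: "fiber_proj (gens ps) * y_part v w \<in> hom_part (Suc (length ps))" for v w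
    by (rule hom_part_mult[OF Cons y_part_hom_part]) simp
  show ?case
    using l r dr_hom_part[OF Cons]
    by (cases a; cases b)
      (auto simp: p fiber_proj_letter fiber_proj_base gX_sym[of \<beta> "Nb _"] gX_diag clinear_0[OF clinear_uemb]
        clinear_0[OF clinear_fiber_proj] cvec.subspace_0[OF subspace_hom_part]
        intro!: cvec.subspace_add[OF subspace_hom_part])
qed

lemma uea_deg_eq: "uea_deg d = cvec.span {gens ps | ps. length ps = d}"
  by (simp add: uea_deg_def)

lemma homogeneous_word_fun: "homogeneous (length w) (word_fun w)"
proof -
  have z: "word_fun w u = 0" if "u \<in> uea_deg d" "d \<noteq> length w" for d u
  proof (rule clinear_eq_on_span[OF clinear_word_fun, of "\<lambda>_. 0"])
    show "u \<in> cvec.span {gens ps | ps. length ps = d}" using that(1) by (simp add: uea_deg_eq)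
    show "word_fun w x = 0" if x: "x \<in> {gens ps | ps. length ps = d}" for x
    proof -
      obtain ps where "x = gens ps" "length ps = d" using x by blast
      then show ?thesis using fiber_proj_gens[of ps] \<open>d \<noteq> length w\<close> by (simp add: word_fun_def hom_part_def)
    qed
  qed (simp add: clinearI)
  then show ?thesis
    unfolding homogeneous_def graded_dual_def clinear_functional
    using clinear_word_fun by auto
qed

lemma clinear_counit: "clinear counit"
proof (rule clinearI)
  fix u v :: "'a uea" and c
  show "counit (u + v) = counit u + counit v" by transfer simp
  show "counit (c *\<^sub>C u) = c *\<^sub>C counit u" unfolding scaleC_complex_def by transfer simp
qed

lemma counit_mult: "counit (u * v) = counit u * counit v"
  by transfer simp

lemma counit_uemb: "counit (uemb x) = 0"
  by transfer simp

lemma counit_one: "counit 1 = 1"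
  by transfer simp

lemma counit_gens: "counit (gens ps) = (if ps = [] then 1 else 0)"
  by (cases ps) (auto simp: counit_one counit_mult counit_uemb)

lemma word_fun_Nil: "word_fun [] = counit"
proof
  fix u :: "'a idx braid_lie uea"
  show "word_fun [] u = counit u"
  proof (rule clinear_eq_on_gens[OF clinear_word_fun clinear_counit])
    show "word_fun [] (gens ps) = counit (gens ps)" for ps :: "('a idx \<times> 'a idx) list"
      using fiber_proj_gens[of ps]
      by (cases ps)
        (auto simp: counit_mult counit_uemb word_fun_def hom_part_def counit_one fiber_proj_one lookup_word simp flip: word_Nil)
  qed
qed

lemma lookup_letter_mult:
  "Poly_Mapping.lookup (word [l] * P) (l' # w) = (if l = l' then Poly_Mapping.lookup P w else 0)"
proof (rule clinear_eq_on_words[OF clinear_compose[OF clinear_lookup clinear_mult_left]])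
  show "clinear (\<lambda>P. if l = l' then Poly_Mapping.lookup P w else 0)"
    by (cases "l = l'") (simp_all add: clinearI lookup_add lookup_scaleC)
qed (simp add: lookup_word flip: word_append)

lemma precomp_word_fun:
  "precomp (word_fun (l # w)) (letter_val l') = (if l = l' then word_fun w else (\<lambda>_. 0))"
  by (auto simp: precomp_def word_fun_def letter_val_eq fiber_proj_letter ltr_base_of lookup_letter_mult fun_eq_iff)

section \<open>Linear independence of hyperlogarithms\<close>

lemma lead_coeff_pderiv': "lead_coeff (pderiv p) = of_nat (degree p) * lead_coeff (p :: complex poly)"
  by (cases "degree p") (auto simp: degree_pderiv coeff_pderiv coeff_eq_0)

text \<open>Comparing leading coefficients in f h' = f' h forces a nonzero solution h to have the
  degree of f. Subtracting from g the multiple of f with the same leading coefficient lowers the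
  degree, so nothing remains.\<close>

lemma wronskian_eq_0:
  fixes f g :: "complex poly"
  assumes "f \<noteq> 0" and "f * pderiv g = pderiv f * g"
  obtains c where "g = smult c f"
proof -
  have deg: "degree h = degree f" if "h \<noteq> 0" "f * pderiv h = pderiv f * h" for h :: "complex poly"
  proof -
    have "lead_coeff (f * pderiv h) = lead_coeff (pderiv f * h)" using that(2) by simp
    then show ?thesis
      using assms(1) that(1) by (simp only: lead_coeff_mult lead_coeff_pderiv') simp
  qed
  define c where "c = lead_coeff g / lead_coeff f"
  define h where "h = g - smult c f"
  have h: "f * pderiv h = pderiv f * h"
    using assms(2) by (simp add: h_def pderiv_diff pderiv_smult algebra_simps)
  have "h = 0"
  proof (rule ccontr)
    assume "h \<noteq> 0"
    moreover from this have "g \<noteq> 0" by (auto simp: h_def c_def)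
    ultimately have eq: "degree h = degree f" "degree g = degree f" using deg h assms(2) by blast+
    then have "coeff h (degree f) = 0" using assms(1) by (simp add: h_def c_def)
    with eq \<open>h \<noteq> 0\<close> show False by (metis leading_coeff_0_iff)
  qed
  then show ?thesis using that[of c] by (simp add: h_def)
qed

text \<open>The factor t - a on the left keeps the exponent at p, which avoids p - 1 and makes the
  formula valid at p = 0.\<close>

lemma linear_mult_pderiv:
  fixes a :: complex
  shows "[:- a, 1:] * pderiv ([:- a, 1:] ^ p * f) = [:- a, 1:] ^ p * (of_nat p * f + [:- a, 1:] * pderiv f)"
proof (cases p)
  case (Suc k)
  define x where "x = [:- a, 1:]"
  have "pderiv x = 1" by (simp add: x_def pderiv_pCons one_pCons)
  then have "x * pderiv (x ^ Suc k * f) = x ^ Suc k * (of_nat (Suc k) * f + x * pderiv f)"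
    unfolding pderiv_mult pderiv_power_Suc by (simp add: algebra_simps of_nat_poly smult_add_left)
  then show ?thesis by (simp only: Suc x_def)
qed simp

text \<open>The equation is \<open>(g / f)' = R / ((t - a) Q)\<close> without denominators.\<close>

lemma no_simple_pole_of_derivative:
  fixes f g Q R :: "complex poly"
  assumes eq: "[:- a, 1:] * Q * (f * pderiv g - pderiv f * g) = f * f * R"
    and f: "f \<noteq> 0" and Q: "poly Q a \<noteq> 0" and R: "poly R a \<noteq> 0"
  shows False
proof -
  let ?x = "[:- a, 1:]"
  have "R \<noteq> 0" using R by auto
  then have "g \<noteq> 0" using eq f by auto
  obtain f1 where f1: "f = ?x ^ order a f * f1" "poly f1 a \<noteq> 0"
    using order_decomp[OF f, of a] by (metis poly_eq_0_iff_dvd)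
  obtain g1 where g1: "g = ?x ^ order a g * g1" "poly g1 a \<noteq> 0"
    using order_decomp[OF \<open>g \<noteq> 0\<close>, of a] by (metis poly_eq_0_iff_dvd)
  define p where "p = order a f"
  define r where "r = order a g"
  define V where "V = f1 * (of_nat r * g1 + ?x * pderiv g1) - (of_nat p * f1 + ?x * pderiv f1) * g1"
  note f1 = f1[folded p_def] and g1 = g1[folded r_def]
  have "?x * (f * pderiv g - pderiv f * g) = f * (?x * pderiv g) - (?x * pderiv f) * g"
    by (simp only: algebra_simps)
  also have "\<dots> = (?x ^ p * f1) * (?x ^ r * (of_nat r * g1 + ?x * pderiv g1)) - ?x ^ p * (of_nat p * f1 + ?x * pderiv f1) * (?x ^ r * g1)"
    by (simp only: f1(1) g1(1) linear_mult_pderiv)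
  also have "\<dots> = ?x ^ (p + r) * V"
    unfolding V_def power_add by (simp only: algebra_simps)
  finally have *: "?x ^ (p + r) * (Q * V) = ?x ^ (p + p) * (f1 * f1 * R)"
    using eq by (simp only: f1(1) power_add) (metis (no_types, lifting) f1(1) mult.assoc mult.left_commute)
  \<comment> \<open>The orders of both sides at a are compared. For r = p this value is 0 while the
    right side does not vanish at a; for r > p the left side has too many zeros; for r < p the right
    side has more zeros, although V(a) \<noteq> 0.\<close>
  have V: "poly V a = (of_nat r - of_nat p) * (poly f1 a * poly g1 a)"
    by (simp add: V_def algebra_simps)
  consider "r = p" | "r > p" | "r < p" by linarith
  then show False
  proof cases
    case 1
    then have "Q * V = f1 * f1 * R" using * by simp
    then have "poly (Q * V) a = poly (f1 * f1 * R) a" by simp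
    then show False using V 1 f1 R by simp
  next
    case 2
    then obtain k where k: "r = p + Suc k" using less_iff_Suc_add by auto
    have "?x ^ (p + p) * (?x ^ Suc k * (Q * V)) = ?x ^ (p + p) * (f1 * f1 * R)"
      using * unfolding k by (simp only: power_add mult.assoc)
    then have "?x ^ Suc k * (Q * V) = f1 * f1 * R" by simp
    then have "poly (?x ^ Suc k * (Q * V)) a = poly (f1 * f1 * R) a" by simp
    then show False using f1 R by simp
  next
    case 3
    then obtain k where k: "p = r + Suc k" using less_iff_Suc_add by auto
    have "?x ^ (p + r) * (Q * V) = ?x ^ (p + r) * (?x ^ Suc k * (f1 * f1 * R))"
      using * k by (metis (no_types, lifting) add.assoc mult.assoc power_add)
    then have "Q * V = ?x ^ Suc k * (f1 * f1 * R)" by simp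
    then have "poly (Q * V) a = poly (?x ^ Suc k * (f1 * f1 * R)) a" by simp
    then have "poly V a = 0" using Q by simp
    moreover have "(of_nat r :: complex) \<noteq> of_nat p" using 3 by simp
    ultimately show False using V f1(2) g1(2) by simp
  qed
qed

section \<open>Relations between hyperlogarithms with polynomial coefficients\<close>

definition words_upto :: "complex set \<Rightarrow> nat \<Rightarrow> complex list set" where
  "words_upto S D = {w. set w \<subseteq> S \<and> length w \<le> D}"

lemma finite_words_upto: "finite S \<Longrightarrow> finite (words_upto S D)"
  unfolding words_upto_def by (rule finite_lists_length_le)

lemma words_upto_Suc: "words_upto S (Suc D) = insert [] ((\<lambda>(a, w). a # w) ` (S \<times> words_upto S D))"
proof -
  have "w \<in> words_upto S (Suc D) \<longleftrightarrow> w \<in> insert [] ((\<lambda>(a, w). a # w) ` (S \<times> words_upto S D))" for w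
    by (cases w) (auto simp: words_upto_def)
  then show ?thesis by blast
qed

lemma sum_words_upto_Suc:
  assumes "finite S"
  shows "(\<Sum>w\<in>words_upto S (Suc D). g w) = g [] + (\<Sum>a\<in>S. \<Sum>w\<in>words_upto S D. (g (a # w) :: 'a::comm_monoid_add))"
proof -
  have "inj_on (\<lambda>x. fst x # snd x) (S \<times> words_upto S D)" by (auto simp: inj_on_def)
  then show ?thesis
    unfolding words_upto_Suc
    by (subst sum.insert)
      (auto simp: assms finite_words_upto sum.reindex sum.cartesian_product case_prod_beta)
qed

text \<open>Only the differential recursion is fixed; the constants of integration of the
  \<open>I w\<close> are arbitrary.\<close>

locale hyperlogs =
  fixes S :: "complex set" and U :: "complex set" and I :: "complex list \<Rightarrow> complex \<Rightarrow> complex"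
  assumes finite_S: "finite S" and open_U: "open U" and U_nonempty: "U \<noteq> {}" and disjoint: "S \<inter> U = {}"
    and I_Nil: "t \<in> U \<Longrightarrow> I [] t = 1"
    and I_Cons: "a \<in> S \<Longrightarrow> set w \<subseteq> S \<Longrightarrow> t \<in> U \<Longrightarrow> (I (a # w) has_field_derivative I w t / (t - a)) (at t)"
begin

text \<open>\<open>Q\<close> is the common denominator of the forms dt / (t - a), and
  \<open>q a\<close> is the quotient Q / (t - a).\<close>

definition Q :: "complex poly" where "Q = (\<Prod>b\<in>S. [:- b, 1:])"
definition q :: "complex \<Rightarrow> complex poly" where "q a = (\<Prod>b\<in>S - {a}. [:- b, 1:])"

lemma Q_eq: "a \<in> S \<Longrightarrow> Q = [:- a, 1:] * q a"
  unfolding Q_def q_def by (rule prod.remove[OF finite_S])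

lemma poly_q: "poly (q a) a \<noteq> 0"
  using finite_S by (auto simp: q_def poly_prod)

lemma poly_q_other: "a \<in> S \<Longrightarrow> b \<noteq> a \<Longrightarrow> poly (q b) a = 0"
  using finite_S by (auto simp: q_def poly_prod intro!: prod_zero)

text \<open>The coefficients are polynomials, since differentiation and elimination of a coefficient
  lead out of the constants.\<close>

definition relation :: "nat \<Rightarrow> (complex list \<Rightarrow> complex poly) \<Rightarrow> bool" where
  "relation D P \<longleftrightarrow> (\<forall>w. w \<notin> words_upto S D \<longrightarrow> P w = 0) \<and>
     (\<forall>t\<in>U. (\<Sum>w\<in>words_upto S D. poly (P w) t * I w t) = 0)"

text \<open>The coefficients of Q times the derivative of \<Sum> P_w I_w; the sum over a collects
  what the derivatives of the I_{a # w} contribute to I_w.\<close>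

definition D_op :: "(complex list \<Rightarrow> complex poly) \<Rightarrow> complex list \<Rightarrow> complex poly" where
  "D_op P w = Q * pderiv (P w) + (\<Sum>a\<in>S. q a * P (a # w))"

lemma relation_D_op:
  assumes "relation D P"
  shows "relation D (D_op P)"
  unfolding relation_def
proof (intro conjI allI impI ballI)
  fix w assume "w \<notin> words_upto S D"
  moreover from this have "a # w \<notin> words_upto S D" for a by (auto simp: words_upto_def)
  ultimately have "P w = 0" "P (a # w) = 0" for a
    using assms unfolding relation_def by blast+
  then show "D_op P w = 0" by (simp add: D_op_def)
next
  fix t assume t: "t \<in> U"
  let ?W = "words_upto S D"
  define dI where "dI w = (case w of [] \<Rightarrow> 0 | a # v \<Rightarrow> I v t / (t - a))" for w
  have dI: "(I w has_field_derivative dI w) (at t)" if "w \<in> ?W" for w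
  proof (cases w)
    case Nil
    have "(I [] has_field_derivative 0) (at t)"
      by (rule has_field_derivative_transform_within_open[of "\<lambda>_. 1", OF _ open_U t]) (auto simp: I_Nil)
    then show ?thesis by (simp add: Nil dI_def)
  next
    case (Cons a v)
    then show ?thesis using that I_Cons[of a v t] t by (auto simp: words_upto_def dI_def)
  qed
  have d1: "((\<lambda>t. \<Sum>w\<in>?W. poly (P w) t * I w t) has_field_derivative
      (\<Sum>w\<in>?W. poly (pderiv (P w)) t * I w t + dI w * poly (P w) t)) (at t)"
    by (auto intro!: derivative_eq_intros dI)
  have d2: "((\<lambda>t. \<Sum>w\<in>?W. poly (P w) t * I w t) has_field_derivative 0) (at t)"
    by (rule has_field_derivative_transform_within_open[of "\<lambda>_. 0", OF _ open_U t])
      (use assms in \<open>auto simp: relation_def\<close>)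
  have "(\<Sum>w\<in>?W. poly (pderiv (P w)) t * I w t) + (\<Sum>w\<in>?W. dI w * poly (P w) t) = 0"
    using DERIV_unique[OF d1 d2] by (simp only: sum.distrib)
  then have 0: "poly Q t * (\<Sum>w\<in>?W. poly (pderiv (P w)) t * I w t) + poly Q t * (\<Sum>w\<in>?W. dI w * poly (P w) t) = 0"
    by (simp flip: distrib_left)
  \<comment> \<open>Words of length D + 1 have coefficient 0. Including them makes the nonempty
    words exactly the pairs of a letter and a word of length at most D.\<close>
  have "(\<Sum>w\<in>?W. dI w * poly (P w) t) = (\<Sum>w\<in>words_upto S (Suc D). dI w * poly (P w) t)"
    using assms
    by (intro sum.mono_neutral_left finite_words_upto finite_S) (auto simp: words_upto_def relation_def)
  also have "\<dots> = (\<Sum>a\<in>S. \<Sum>w\<in>?W. I w t / (t - a) * poly (P (a # w)) t)"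
    unfolding sum_words_upto_Suc[OF finite_S] by (simp add: dI_def)
  finally have "poly Q t * (\<Sum>w\<in>?W. dI w * poly (P w) t)
      = (\<Sum>a\<in>S. \<Sum>w\<in>?W. poly Q t * (I w t / (t - a) * poly (P (a # w)) t))"
    by (simp add: sum_distrib_left)
  also have "\<dots> = (\<Sum>a\<in>S. \<Sum>w\<in>?W. poly (q a * P (a # w)) t * I w t)"
  proof (intro sum.cong refl)
    fix a w assume "a \<in> S"
    then have "t - a \<noteq> 0" using t disjoint by auto
    then show "poly Q t * (I w t / (t - a) * poly (P (a # w)) t) = poly (q a * P (a # w)) t * I w t"
      by (simp add: Q_eq[OF \<open>a \<in> S\<close>] field_simps)
  qed
  also have "\<dots> = (\<Sum>w\<in>?W. \<Sum>a\<in>S. poly (q a * P (a # w)) t * I w t)" by (rule sum.swap)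
  finally have "poly Q t * (\<Sum>w\<in>?W. dI w * poly (P w) t) = (\<Sum>w\<in>?W. \<Sum>a\<in>S. poly (q a * P (a # w)) t * I w t)" .
  with 0 show "(\<Sum>w\<in>?W. poly (D_op P w) t * I w t) = 0"
    by (simp add: D_op_def distrib_right sum.distrib sum_distrib_left sum_distrib_right poly_sum mult.assoc)
qed

lemma relation_combine:
  assumes "relation D P" "relation D P'"
  shows "relation D (\<lambda>w. f * P w - g * P' w)"
  unfolding relation_def
proof (intro conjI allI impI ballI)
  fix t assume t: "t \<in> U"
  have "(\<Sum>w\<in>words_upto S D. poly (f * P w - g * P' w) t * I w t)
    = poly f t * (\<Sum>w\<in>words_upto S D. poly (P w) t * I w t) - poly g t * (\<Sum>w\<in>words_upto S D. poly (P' w) t * I w t)"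
    by (simp add: sum_distrib_left sum_subtractf algebra_simps)
  then show "(\<Sum>w\<in>words_upto S D. poly (f * P w - g * P' w) t * I w t) = 0"
    using assms t by (simp add: relation_def)
qed (use assms in \<open>auto simp: relation_def\<close>)

text \<open>
  Induction on the maximal length \<open>D\<close> of the words that occur and on the number of words of
  length \<open>D\<close>: eliminating one of them between a relation and its derivative yields a smaller
  relation.
\<close>

theorem hyperlogs_independent: "relation D P \<Longrightarrow> P w = 0"
proof (induction D arbitrary: P w)
  case 0
  have "words_upto S 0 = {[]}" by (auto simp: words_upto_def)
  then have other: "P w = 0" if "w \<noteq> []" for w
    using 0 that by (auto simp: relation_def)
  have nil: "\<forall>t\<in>U. poly (P []) t = 0"
    using 0 I_Nil \<open>words_upto S 0 = {[]}\<close> by (auto simp: relation_def)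
  have "P [] = 0"
  proof (rule ccontr)
    assume "P [] \<noteq> 0"
    then have "finite {t. poly (P []) t = 0}" by (rule poly_roots_finite)
    moreover have "U \<subseteq> {t. poly (P []) t = 0}" using nil by blast
    ultimately have "finite U" using finite_subset by blast
    then show False using open_U U_nonempty finite_imp_not_open by blast
  qed
  then show ?case using other by (cases "w = []") auto
next
  case (Suc d)
  have top: "P w = 0" if "relation (Suc d) P" for P w
    using that
  proof (induction "card {w. length w = Suc d \<and> P w \<noteq> 0}" arbitrary: P w rule: less_induct)
    case less
    have fin: "finite {w. length w = Suc d \<and> P w \<noteq> 0}"
      by (rule finite_subset[OF _ finite_words_upto[OF finite_S, of "Suc d"]]) (use less.prems in \<open>auto simp: relation_def\<close>)
    show ?case
    proof (cases "{w. length w = Suc d \<and> P w \<noteq> 0} = {}")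
      case True
      have "relation d P"
        unfolding relation_def
      proof (intro conjI allI impI ballI)
        fix w assume "w \<notin> words_upto S d"
        then show "P w = 0"
          using True less.prems by (auto simp: relation_def words_upto_def le_Suc_eq)
      next
        fix t assume "t \<in> U"
        have "(\<Sum>w\<in>words_upto S d. poly (P w) t * I w t) = (\<Sum>w\<in>words_upto S (Suc d). poly (P w) t * I w t)"
          using True by (intro sum.mono_neutral_left finite_words_upto finite_S) (auto simp: words_upto_def le_Suc_eq)
        then show "(\<Sum>w\<in>words_upto S d. poly (P w) t * I w t) = 0"
          using less.prems \<open>t \<in> U\<close> by (simp add: relation_def)
      qed
      then show ?thesis by (rule Suc.IH)
    next
      case False
      then obtain w0 where w0: "length w0 = Suc d" "P w0 \<noteq> 0" by blast
      then obtain a v where av: "w0 = a # v" "length v = d" by (cases w0) auto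
      have "w0 \<in> words_upto S (Suc d)" using less.prems w0(2) by (auto simp: relation_def)
      then have aS: "a \<in> S" by (simp add: words_upto_def av)
      have long: "P w = 0" if "length w > Suc d" for w
        using less.prems that by (simp add: relation_def words_upto_def)
      define P' where "P' w = P w0 * D_op P w - D_op P w0 * P w" for w
      have P': "relation (Suc d) P'"
        unfolding P'_def using relation_combine[OF relation_D_op[OF less.prems] less.prems] .
      have dtop: "D_op P w = Q * pderiv (P w)" if "length w = Suc d" for w
        using long that by (simp add: D_op_def)
      have "{w. length w = Suc d \<and> P' w \<noteq> 0} \<subseteq> {w. length w = Suc d \<and> P w \<noteq> 0} - {w0}"
        by (auto simp: P'_def dtop)
      then have "{w. length w = Suc d \<and> P' w \<noteq> 0} \<subset> {w. length w = Suc d \<and> P w \<noteq> 0}" using w0 by blast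
      then have "P' w = 0" for w
        using less.hyps[OF psubset_card_mono[OF fin] P'] by blast
      then have rel: "P w0 * D_op P w = Q * pderiv (P w0) * P w" for w
        by (simp add: P'_def dtop[OF w0(1)])
      have "Q \<noteq> 0" using finite_S by (simp add: Q_def)
      \<comment> \<open>At words of top length the vanishing of \<open>P'\<close> says that the
        Wronskian with \<open>P w0\<close> is zero.\<close>
      have "\<exists>c. P (b # v) = smult c (P w0)" for b
      proof -
        have "Q * (P w0 * pderiv (P (b # v))) = Q * (pderiv (P w0) * P (b # v))"
          using rel[of "b # v"] av(2) by (simp add: dtop mult_ac)
        then show ?thesis using \<open>Q \<noteq> 0\<close> wronskian_eq_0[OF w0(2)] by (metis mult_cancel_left)
      qed
      then obtain c where c: "P (b # v) = smult (c b) (P w0)" for b by metis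
      have "c a = 1"
        using arg_cong[OF c[of a], of "\<lambda>p. coeff p (degree (P w0))"] w0(2) av(1) by simp
      \<comment> \<open>At the word v the relation reads (P_v / P_w0)' = R / Q = - \<Sum> c_b / (t -
        b). Its right side has a simple pole at a with residue - c_a = -1, which is
        impossible.\<close>
      define R where "R = - (\<Sum>b\<in>S. smult (c b) (q b))"
      have "(\<Sum>b\<in>S. q b * P (b # v)) = - (P w0 * R)"
        by (simp add: c R_def sum_distrib_left mult_ac)
      then have "Q * (P w0 * pderiv (P v) - pderiv (P w0) * P v) = P w0 * P w0 * R"
        using rel[of v] by (simp add: D_op_def algebra_simps)
      then have "[:- a, 1:] * q a * (P w0 * pderiv (P v) - pderiv (P w0) * P v) = P w0 * P w0 * R"
        by (simp only: Q_eq[OF aS])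
      moreover have "poly R a \<noteq> 0"
      proof -
        have "poly R a = - (\<Sum>b\<in>S. c b * poly (q b) a)" by (simp add: R_def poly_sum)
        also have "(\<Sum>b\<in>S. c b * poly (q b) a) = (\<Sum>b\<in>{a}. c b * poly (q b) a)"
          by (rule sum.mono_neutral_right) (use finite_S aS poly_q_other in auto)
        finally show ?thesis using \<open>c a = 1\<close> poly_q by simp
      qed
      ultimately show ?thesis
        using no_simple_pole_of_derivative[OF _ w0(2) poly_q] by blast
    qed
  qed
  show ?case by (rule top[OF Suc.prems])
qed

end

section \<open>Holomorphic functions on the polydisc\<close>

lemma open_polydisc: "open (polydisc :: (complex ^ 'n::finite) set)"
proof -
  have "polydisc = (\<Inter>i::'n. {x. norm (x $ i) < 1})" by (auto simp: polydisc_def)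
  also have "open \<dots>" by (intro open_INT ballI open_Collect_less continuous_intros) auto
  finally show ?thesis .
qed

definition upd :: "complex ^ 'n::finite \<Rightarrow> 'n \<Rightarrow> complex \<Rightarrow> complex ^ 'n" where
  "upd x k t = (\<chi> j. if j = k then t else x $ j)"

lemma upd_nth: "upd x k t $ j = (if j = k then t else x $ j)"
  by (simp add: upd_def)

lemma upd_same: "upd x k (x $ k) = x"
  by (simp add: upd_def vec_eq_iff)

lemma upd_upd: "upd (upd x k t) k u = upd x k u"
  by (simp add: upd_def vec_eq_iff)

lemma upd_polydisc: "x \<in> polydisc \<Longrightarrow> norm t < 1 \<Longrightarrow> upd x k t \<in> polydisc"
  by (simp add: polydisc_def upd_nth)

text \<open>Complex homogeneity of the real derivative makes the chain rule a complex one. The same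
  rule along a coordinate line identifies the values on basis vectors with
  \<open>partial_deriv\<close>.\<close>

lemma polydisc_curve_derivative:
  fixes \<gamma> :: "complex \<Rightarrow> complex ^ 'n::finite"
  assumes f: "f \<in> holo_polydisc" and mem: "\<gamma> t \<in> polydisc"
    and \<gamma>: "\<And>j. ((\<lambda>t. \<gamma> t $ j) has_field_derivative \<gamma>' j) (at t)"
  shows "((\<lambda>t. f (\<gamma> t)) has_field_derivative (\<Sum>j\<in>UNIV. partial_deriv j f (\<gamma> t) * \<gamma>' j)) (at t)"
proof -
  obtain f' where f': "(f has_derivative f') (at (\<gamma> t))" "\<And>c v. f' (c *s v) = c * f' v"
    using f mem unfolding holo_polydisc_def by blast
  have lin: "linear f'" using f'(1) has_derivative_linear by blast
  have chain: "((\<lambda>t. f (g t)) has_field_derivative (\<Sum>j\<in>UNIV. f' (axis j 1) * g' j)) (at u)"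
    if "\<And>j. ((\<lambda>t. g t $ j) has_field_derivative g' j) (at u)" "g u = \<gamma> t"
    for g :: "complex \<Rightarrow> complex ^ 'n" and g' u
  proof -
    have "(g has_derivative (\<lambda>h. \<chi> j. g' j * h)) (at u)"
      unfolding has_derivative_componentwise_within[of g] using that(1)
      by (auto simp: Basis_vec_def inner_axis has_field_derivative_def intro!: has_derivative_inner_left)
    then have "((\<lambda>t. f (g t)) has_derivative (\<lambda>h. f' (\<chi> j. g' j * h))) (at u)"
      using f'(1) that(2) by (metis has_derivative_compose)
    moreover have "f' (\<chi> j. g' j * h) = (\<Sum>j\<in>UNIV. f' (axis j 1) * g' j) * h" for h
    proof -
      have "(\<chi> j. g' j * h) = (\<Sum>j\<in>UNIV. (g' j * h) *s axis j 1)"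
        by (simp add: vec_eq_iff axis_def if_distrib cong: if_cong)
      then show ?thesis
        by (simp add: linear_sum[OF lin] f'(2) sum_distrib_left sum_distrib_right mult_ac)
    qed
    ultimately show ?thesis by (simp add: has_field_derivative_def)
  qed
  have "partial_deriv j f (\<gamma> t) = f' (axis j 1)" for j
  proof -
    have "((\<lambda>u. f (upd (\<gamma> t) j u)) has_field_derivative
        (\<Sum>i\<in>UNIV. f' (axis i 1) * (if i = j then 1 else 0))) (at (\<gamma> t $ j))"
      by (rule chain) (auto simp: upd_nth upd_same intro!: derivative_eq_intros)
    then show ?thesis
      unfolding partial_deriv_def upd_def[symmetric] by (intro DERIV_imp_deriv) (simp add: if_distrib cong: if_cong)
  qed
  with chain[OF \<gamma>] show ?thesis by simp
qed

lemma polydisc_partial_derivative: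
  fixes x :: "complex ^ 'n::finite"
  assumes f: "f \<in> holo_polydisc" and "x \<in> polydisc" "norm t < 1"
  shows "((\<lambda>t. f (upd x k t)) has_field_derivative partial_deriv k f (upd x k t)) (at t)"
proof -
  have "((\<lambda>t. f (upd x k t)) has_field_derivative
      (\<Sum>j\<in>UNIV. partial_deriv j f (upd x k t) * (if j = k then 1 else 0))) (at t)"
    by (rule polydisc_curve_derivative[OF f])
      (auto simp: upd_nth upd_polydisc assms intro!: derivative_eq_intros)
  then show ?thesis by (simp add: if_distrib cong: if_cong)
qed

lemma continuous_on_holo_polydisc:
  assumes "f \<in> holo_polydisc"
  shows "continuous_on polydisc f"
proof (rule continuous_at_imp_continuous_on, rule)
  fix x :: "complex ^ 'a" assume "x \<in> polydisc"
  then show "isCont f x"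
    using assms has_derivative_continuous unfolding holo_polydisc_def by blast
qed

text \<open>As y tends to x, the slices of f through y in direction k converge uniformly on a small
  disc, because f is uniformly continuous on a compact ball. Holomorphic functions pass uniform
  convergence on to their derivatives.\<close>

lemma continuous_on_partial_deriv:
  fixes f :: "complex ^ 'n::finite \<Rightarrow> complex"
  assumes f: "f \<in> holo_polydisc"
  shows "continuous_on polydisc (partial_deriv k f)"
proof (rule continuous_at_imp_continuous_on, rule)
  fix x :: "complex ^ 'n" assume "x \<in> polydisc"
  then obtain r where r: "r > 0" "cball x (2 * r) \<subseteq> polydisc"
  proof -
    obtain e where "e > 0" "cball x e \<subseteq> polydisc"
      using \<open>x \<in> polydisc\<close> open_polydisc open_contains_cball by blast
    then show ?thesis using that[of "e / 2"] by simp
  qed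
  define g where "g y \<zeta> = f (y + \<zeta> *s axis k 1)" for y \<zeta>
  have nrm: "norm (\<zeta> *s axis k 1 :: complex ^ 'n) = norm \<zeta>" for \<zeta>
    by (simp add: norm_vec_def L2_set_def axis_def if_distrib[of norm] if_distrib[of "\<lambda>z. z\<^sup>2"]
        if_distrib[of "\<lambda>z. _ * z"] cong: if_cong)
  have mem: "y + \<zeta> *s axis k 1 \<in> cball x (2 * r)" if "y \<in> ball x r" "\<zeta> \<in> ball 0 r" for y \<zeta>
  proof -
    have "dist x (y + \<zeta> *s axis k 1) \<le> dist x y + norm (\<zeta> *s axis k 1 :: complex ^ 'n)"
      by norm
    then show ?thesis using that by (simp add: nrm)
  qed
  have gd: "(g y has_field_derivative partial_deriv k f (y + \<zeta> *s axis k 1)) (at \<zeta>)"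
    if "y \<in> ball x r" "\<zeta> \<in> ball 0 r" for y \<zeta>
  proof -
    have "(g y has_field_derivative
        (\<Sum>j\<in>UNIV. partial_deriv j f (y + \<zeta> *s axis k 1) * (if j = k then 1 else 0))) (at \<zeta>)"
      unfolding g_def using mem[OF that] r(2)
      by (intro polydisc_curve_derivative[OF f, of "\<lambda>\<zeta>. y + \<zeta> *s axis k 1"])
        (auto simp: axis_def intro!: derivative_eq_intros)
    then show ?thesis by (simp add: if_distrib cong: if_cong)
  qed
  have ul: "uniform_limit (ball 0 r) g (g x) (at x)"
    unfolding uniform_limit_iff
  proof (intro allI impI)
    fix e :: real assume "e > 0"
    have "uniformly_continuous_on (cball x (2 * r)) f"
      by (rule compact_uniformly_continuous) (use continuous_on_subset[OF continuous_on_holo_polydisc[OF f] r(2)] in auto)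
    then obtain d where d: "d > 0" "\<And>u v. u \<in> cball x (2 * r) \<Longrightarrow> v \<in> cball x (2 * r) \<Longrightarrow> dist u v < d \<Longrightarrow> dist (f u) (f v) < e"
      unfolding uniformly_continuous_on_def using \<open>e > 0\<close> by metis
    have "eventually (\<lambda>y. dist y x < min d r) (at x)"
      using d(1) r(1) unfolding eventually_at by (intro exI[of _ "min d r"]) auto
    then show "\<forall>\<^sub>F y in at x. \<forall>\<zeta>\<in>ball 0 r. dist (g y \<zeta>) (g x \<zeta>) < e"
    proof eventually_elim
      case (elim y)
      show ?case
        unfolding g_def
        using elim r(1) by (intro ballI d(2) mem) (auto simp: dist_commute)
    qed
  qed
  have "((\<lambda>y. (deriv ^^ 1) (g y) 0) \<longlongrightarrow> (deriv ^^ 1) (g x) 0) (at x)"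
  proof (rule higher_deriv_complex_uniform_limit[OF ul])
    have "eventually (\<lambda>y. dist y x < r) (at x)"
      using r(1) unfolding eventually_at by (intro exI[of _ r]) auto
    then show "\<forall>\<^sub>F y in at x. g y holomorphic_on ball 0 r"
    proof eventually_elim
      case (elim y)
      then show ?case using gd[of y]
        by (auto simp: holomorphic_on_open dist_commute) blast
    qed
  qed (use r in auto)
  moreover have "deriv (g y) 0 = partial_deriv k f y" if "y \<in> ball x r" for y
    using DERIV_imp_deriv[OF gd[OF that, of 0]] r(1) by simp
  moreover have "eventually (\<lambda>y. y \<in> ball x r) (at x)"
    using r(1) unfolding eventually_at by (intro exI[of _ r]) (auto simp: dist_commute)
  ultimately have "(partial_deriv k f \<longlongrightarrow> partial_deriv k f x) (at x)"
    using r(1) by (auto elim!: Lim_transform_eventually eventually_mono simp: tendsto_cong)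
  then show "isCont (partial_deriv k f) x" by (simp add: isCont_def)
qed

text \<open>
  \<open>G m\<close> is the coefficient of \<open>(log t)\<^sup>m\<close> in a polynomial whose derivative, times \<open>t\<close>, vanishes.
\<close>

lemma logpoly_const_of_deriv_0:
  fixes G :: "nat \<Rightarrow> complex \<Rightarrow> complex"
  assumes deriv: "\<And>m t. norm t < 1 \<Longrightarrow> (G m has_field_derivative G' m t) (at t)"
    and eq: "\<And>m t. norm t < 1 \<Longrightarrow> t * G' m t + of_nat (Suc m) * G (Suc m) t = 0"
    and fin: "\<And>m t. m \<ge> M \<Longrightarrow> norm t < 1 \<Longrightarrow> G m t = 0"
    and t: "norm t < 1"
  shows "G m t = (if m = 0 then G 0 0 else 0)"
proof -
  have const: "G m t = G m 0" if "\<And>t. norm t < 1 \<Longrightarrow> G (Suc m) t = 0" "norm t < 1" for m t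
  proof -
    have "continuous_on (ball 0 1) (G m)"
      using deriv by (intro continuous_at_imp_continuous_on ballI DERIV_isCont) auto
    \<comment> \<open>The factor t hides the derivative at t = 0; continuity of \<open>G m\<close>
      bridges this one exceptional point.\<close>
    moreover have "DERIV (G m) u :> 0" if "u \<in> ball 0 1 - {0}" for u
      using eq[of u m] deriv[of u m] \<open>\<And>t. norm t < 1 \<Longrightarrow> G (Suc m) t = 0\<close>[of u] that by auto
    ultimately obtain c where "\<And>u. u \<in> ball 0 1 \<Longrightarrow> G m u = c"
      using DERIV_zero_connected_constant[of "ball 0 1" "{0}" "G m"] by auto
    then show ?thesis using that(2) by simp
  qed
  have pos: "\<forall>t. norm t < 1 \<longrightarrow> G (Suc m) t = 0" for m
  proof (induction "M - m" arbitrary: m)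
    case 0
    then show ?case using fin by auto
  next
    case (Suc d)
    then have "\<And>t. norm t < 1 \<Longrightarrow> G (Suc (Suc m)) t = 0" by (metis Suc_diff_Suc diff_Suc_1 zero_less_Suc zero_less_diff)
    then have "G (Suc m) t = G (Suc m) 0" if "norm t < 1" for t using const that by blast
    \<comment> \<open>Evaluating the equation at t = 0 kills the constant value of every coefficient
      of positive index; downward induction from \<open>M\<close> supplies the constancy.\<close>
    moreover have "of_nat (Suc m) * G (Suc m) 0 = 0" using eq[of 0 m] by simp
    then have "G (Suc m) 0 = 0" by (metis mult_eq_0_iff of_nat_eq_0_iff nat.distinct(1))
    ultimately show ?case by simp
  qed
  show ?thesis using pos const[of 0 t] t by (cases m) auto
qed

section \<open>Polylogarithms as nested sums\<close>

definition tuples :: "nat \<Rightarrow> (nat \<Rightarrow> nat) set" where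
  "tuples N = {k \<in> {1..N} \<rightarrow>\<^sub>E {1..}. strict_mono_on {1..N} k}"

definition tuples_below :: "nat \<Rightarrow> nat \<Rightarrow> (nat \<Rightarrow> nat) set" where
  "tuples_below N K = {k \<in> tuples N. \<forall>i\<in>{1..N}. k i < K}"

lemma finite_tuples_below: "finite (tuples_below N K)"
proof (rule finite_subset)
  show "tuples_below N K \<subseteq> {1..N} \<rightarrow>\<^sub>E {..<K}"
    by (auto simp: tuples_below_def tuples_def PiE_iff extensional_def)
qed (auto intro: finite_PiE)

text \<open>The set \<open>J\<close> of admissible largest entries is left open so that both the
  truncated sums, with J = {1..<K}, and the full infinite sum, with J = {1..}, can be split in this
  way.\<close>

lemma bij_betw_tuples_Suc:
  assumes "J \<subseteq> {1..}"
  shows "bij_betw (\<lambda>(j, k). k(Suc N := j)) (SIGMA j:J. tuples_below N j) {k \<in> tuples (Suc N). k (Suc N) \<in> J}"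
proof (rule bij_betw_byWitness[where f' = "\<lambda>k. (k (Suc N), restrict k {1..N})"])
  have fun_upd: "restrict k {1..N} = k" if "k \<in> tuples N" for k
    using that by (auto simp: tuples_def PiE_restrict)
  show "\<forall>p\<in>SIGMA j:J. tuples_below N j. (\<lambda>k. (k (Suc N), restrict k {1..N})) ((\<lambda>(j, k). k(Suc N := j)) p) = p"
  proof
    fix p assume "p \<in> (SIGMA j:J. tuples_below N j)"
    then obtain j k where p: "p = (j, k)" and "k \<in> tuples N" by (auto simp: tuples_below_def)
    moreover have "restrict (k(Suc N := j)) {1..N} = restrict k {1..N}" by auto
    ultimately show "(\<lambda>k. (k (Suc N), restrict k {1..N})) ((\<lambda>(j, k). k(Suc N := j)) p) = p"
      using fun_upd by (simp add: p)
  qed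
  show "\<forall>k\<in>{k \<in> tuples (Suc N). k (Suc N) \<in> J}. (\<lambda>(j, k). k(Suc N := j)) (k (Suc N), restrict k {1..N}) = k"
    by (auto simp: tuples_def fun_eq_iff PiE_iff extensional_def)
  show "(\<lambda>(j, k). k(Suc N := j)) ` (SIGMA j:J. tuples_below N j) \<subseteq> {k \<in> tuples (Suc N). k (Suc N) \<in> J}"
    using assms
    by (auto simp: tuples_def tuples_below_def PiE_iff extensional_def strict_mono_on_def le_Suc_eq)
  show "(\<lambda>k. (k (Suc N), restrict k {1..N})) ` {k \<in> tuples (Suc N). k (Suc N) \<in> J} \<subseteq> (SIGMA j:J. tuples_below N j)"
    by (auto simp: tuples_def tuples_below_def PiE_iff strict_mono_on_def)
qed

text \<open>The multiple harmonic sum over 0 < k_1 < ... < k_m < K, with the largest index summed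
  outermost.\<close>

primrec nsum :: "(nat \<Rightarrow> complex) \<Rightarrow> (nat \<Rightarrow> nat) \<Rightarrow> nat \<Rightarrow> nat \<Rightarrow> complex" where
  "nsum v a 0 K = 1"
| "nsum v a (Suc m) K = (\<Sum>k\<in>{1..<K}. v (Suc m) ^ k / of_nat k ^ a (Suc m) * nsum v a m k)"

definition nsum_term :: "(nat \<Rightarrow> complex) \<Rightarrow> (nat \<Rightarrow> nat) \<Rightarrow> nat \<Rightarrow> (nat \<Rightarrow> nat) \<Rightarrow> complex" where
  "nsum_term v a N k = (\<Prod>i\<in>{1..N}. v i ^ k i / of_nat (k i) ^ a i)"

lemma nsum_term_upd:
  "nsum_term v a (Suc N) (k(Suc N := j)) = v (Suc N) ^ j / of_nat j ^ a (Suc N) * nsum_term v a N k"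
proof -
  have "(\<Prod>i\<in>{1..N}. v i ^ (k(Suc N := j)) i / of_nat ((k(Suc N := j)) i) ^ a i)
      = (\<Prod>i\<in>{1..N}. v i ^ k i / of_nat (k i) ^ a i)"
    by (rule prod.cong) auto
  then show ?thesis by (simp add: nsum_term_def del: fun_upd_apply) simp
qed

lemma sum_nsum_term: "(\<Sum>k\<in>tuples_below N K. nsum_term v a N k) = nsum v a N K"
proof (induction N arbitrary: K)
  case 0
  have "tuples_below 0 K = {\<lambda>_. undefined}"
    by (auto simp: tuples_below_def tuples_def strict_mono_on_def)
  then show ?case by (simp add: nsum_term_def)
next
  case (Suc N)
  have 1: "k i < K" if "k \<in> tuples (Suc N)" "k (Suc N) < K" "i \<in> {1..Suc N}" for k i
    using that strict_mono_onD[of "{1..Suc N}" k i "Suc N"]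
    by (cases "i = Suc N") (auto simp: tuples_def)
  have 2: "1 \<le> k (Suc N)" if "k \<in> tuples (Suc N)" for k
    using that by (auto simp: tuples_def PiE_iff)
  have "k \<in> tuples_below (Suc N) K \<longleftrightarrow> k \<in> tuples (Suc N) \<and> k (Suc N) \<in> {1..<K}" for k
    unfolding tuples_below_def using 1[of k] 2[of k] by force
  then have "tuples_below (Suc N) K = {k \<in> tuples (Suc N). k (Suc N) \<in> {1..<K}}"
    by blast
  then have "(\<Sum>k\<in>tuples_below (Suc N) K. nsum_term v a (Suc N) k)
      = (\<Sum>p\<in>(SIGMA j:{1..<K}. tuples_below N j). nsum_term v a (Suc N) ((\<lambda>(j, k). k(Suc N := j)) p))"
    using sum.reindex_bij_betw[OF bij_betw_tuples_Suc[of "{1..<K}" N], of "nsum_term v a (Suc N)"]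
    by (simp add: atLeastLessThan_def)
  also have "\<dots> = (\<Sum>j\<in>{1..<K}. \<Sum>k\<in>tuples_below N j. v (Suc N) ^ j / of_nat j ^ a (Suc N) * nsum_term v a N k)"
    by (subst sum.Sigma) (auto simp: finite_tuples_below case_prod_unfold nsum_term_upd simp del: fun_upd_apply)
  finally show ?case by (simp only: Suc sum_distrib_left[symmetric] nsum.simps)
qed

text \<open>A crude polynomial bound in K suffices, because the variable attached to the next index
  has norm below 1 and gives geometric decay.\<close>

lemma norm_nsum_le:
  assumes "\<And>i. i \<in> {1..m} \<Longrightarrow> norm (v i) \<le> 1"
  shows "norm (nsum v a m K) \<le> real K ^ m"
  using assms
proof (induction m arbitrary: K)
  case (Suc m)
  have "norm (nsum v a (Suc m) K) \<le> (\<Sum>k\<in>{1..<K}. norm (v (Suc m) ^ k / of_nat k ^ a (Suc m) * nsum v a m k))"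
    by (simp add: norm_sum)
  also have "\<dots> \<le> (\<Sum>k\<in>{1..<K}. real K ^ m)"
  proof (rule sum_mono)
    fix k assume k: "k \<in> {1..<K}"
    have "norm (v (Suc m) ^ k / of_nat k ^ a (Suc m)) \<le> 1"
      using Suc.prems[of "Suc m"] k
      by (auto simp: norm_divide norm_power divide_le_eq_1 intro!: order_trans[OF power_le_one one_le_power])
    moreover have "norm (nsum v a m k) \<le> real K ^ m"
      using Suc.IH[of k] Suc.prems k by (smt (verit) atLeastAtMost_iff atLeastLessThan_iff le_SucI of_nat_0_le_iff of_nat_mono order_less_imp_le power_mono)
    ultimately show "norm (v (Suc m) ^ k / of_nat k ^ a (Suc m) * nsum v a m k) \<le> real K ^ m"
      unfolding norm_mult using mult_mono[of _ 1 _ "real K ^ m"] by auto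
  qed
  also have "\<dots> \<le> real K ^ Suc m" by (auto intro: mult_right_mono)
  finally show ?case .
qed simp

text \<open>Termwise differentiation preserves the disc of convergence and raises the exponent m by
  one, up to a shift of the index.\<close>

lemma summable_poly_geometric:
  fixes z :: complex
  assumes "norm z < 1"
  shows "summable (\<lambda>K. of_nat K ^ m * z ^ K)"
  using assms
proof (induction m arbitrary: z)
  case 0
  then show ?case by (simp add: summable_geometric)
next
  case (Suc m)
  have "summable (\<lambda>n. diffs (\<lambda>K. of_nat K ^ m) n * z ^ n)"
    by (rule termdiff_converges[OF Suc.prems Suc.IH])
  then have "summable (\<lambda>n. z * (diffs (\<lambda>K. of_nat K ^ m) n * z ^ n))"
    by (rule summable_mult)
  then have "summable (\<lambda>n. of_nat (Suc n) ^ Suc m * z ^ Suc n)"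
    by (simp add: diffs_def mult_ac del: of_nat_Suc)
  then show ?case by (subst (asm) summable_Suc_iff)
qed

lemma summable_poly_geometric_real:
  fixes r :: real
  assumes "0 \<le> r" "r < 1"
  shows "summable (\<lambda>K. real K ^ m * r ^ K)"
proof -
  have "summable (\<lambda>K. of_nat K ^ m * complex_of_real r ^ K)"
    by (rule summable_poly_geometric) (use assms in auto)
  then have "summable (\<lambda>K. complex_of_real (real K ^ m * r ^ K))" by simp
  then show ?thesis by (simp only: summable_complex_of_real)
qed

lemma summable_nsum:
  assumes v: "\<And>i. i \<in> {1..m} \<Longrightarrow> norm (v i) \<le> 1" and c: "\<And>K. norm (c K) \<le> 1" and z: "norm z < 1"
  shows "summable (\<lambda>K. norm (c K * nsum v a m K * z ^ K))"
proof (rule summable_comparison_test'[OF summable_poly_geometric_real[of "norm z" m]])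
  fix K
  have "norm (c K * nsum v a m K) \<le> 1 * real K ^ m"
    unfolding norm_mult by (intro mult_mono c norm_nsum_le v) auto
  then show "norm (norm (c K * nsum v a m K * z ^ K)) \<le> real K ^ m * norm z ^ K"
    by (simp add: norm_mult norm_power mult_right_mono del: of_nat_power)
qed (use z in auto)

text \<open>Absolute summability over all tuples permits grouping them by their largest
  entry.\<close>

lemma infsum_nsum_term:
  assumes v: "\<And>i. i \<in> {1..N} \<Longrightarrow> norm (v i) \<le> 1" and z: "norm (v (Suc N)) < 1" and a: "1 \<le> a (Suc N)"
  shows "(\<Sum>\<^sub>\<infinity>k\<in>tuples (Suc N). nsum_term v a (Suc N) k)
    = suminf (\<lambda>K. 1 / of_nat K ^ a (Suc N) * nsum v a N K * v (Suc N) ^ K)"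
proof -
  define z where "z = v (Suc N)"
  define f where "f = (\<lambda>(j, k). z ^ j / of_nat j ^ a (Suc N) * nsum_term v a N k)"
  let ?S = "SIGMA j:{1..}. tuples_below N j"
  \<comment> \<open>With all variables replaced by their norms, the sum of the norms is again an
    \<open>nsum\<close>, to which the polynomial bound applies.\<close>
  define v' where "v' i = complex_of_real (norm (v i))" for i
  have abs: "(\<Sum>k\<in>tuples_below N j. norm (nsum_term v a N k)) \<le> real j ^ N" for j
  proof -
    have "complex_of_real (\<Sum>k\<in>tuples_below N j. norm (nsum_term v a N k)) = nsum v' a N j"
      unfolding sum_nsum_term[symmetric] of_real_sum
      by (intro sum.cong refl) (simp add: nsum_term_def v'_def prod_norm[symmetric] norm_divide norm_power)
    moreover have "norm (nsum v' a N j) \<le> real j ^ N"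
      by (rule norm_nsum_le) (use v in \<open>auto simp: v'_def\<close>)
    ultimately show ?thesis by (metis abs_ge_self norm_of_real order_trans)
  qed
  have c1: "norm (1 / of_nat K ^ a (Suc N) :: complex) \<le> 1" for K
    using a by (cases "K = 0") (auto simp: norm_divide norm_power divide_le_eq_1)
  have fs: "(\<lambda>p. norm (f p)) summable_on ?S"
    unfolding Infinite_Sum.abs_summable_on_Sigma_iff
  proof (intro conjI ballI)
    show "(\<lambda>k. norm (f (j, k))) summable_on tuples_below N j" for j
      by (rule summable_on_finite[OF finite_tuples_below])
    have "norm (\<Sum>\<^sub>\<infinity>k\<in>tuples_below N j. norm (f (j, k))) \<le> real j ^ N * norm z ^ j" for j
    proof -
      have "(\<Sum>\<^sub>\<infinity>k\<in>tuples_below N j. norm (f (j, k))) = (\<Sum>k\<in>tuples_below N j. norm (f (j, k)))"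
        by (rule infsum_finite[OF finite_tuples_below])
      also have "\<dots> = norm (z ^ j / of_nat j ^ a (Suc N)) * (\<Sum>k\<in>tuples_below N j. norm (nsum_term v a N k))"
        by (simp only: f_def prod.case norm_mult sum_distrib_left)
      also have "\<dots> \<le> norm z ^ j * real j ^ N"
      proof (rule mult_mono[OF _ abs])
        show "norm (z ^ j / of_nat j ^ a (Suc N)) \<le> norm z ^ j"
          using mult_left_mono[OF c1[of j], of "norm z ^ j"] by (simp add: norm_divide norm_power)
      qed (auto intro: sum_nonneg)
      finally show ?thesis by (simp add: mult.commute infsum_nonneg)
    qed
    then have "summable (\<lambda>j. norm (\<Sum>\<^sub>\<infinity>k\<in>tuples_below N j. norm (f (j, k))))"
      by (intro summable_comparison_test'[OF summable_poly_geometric_real[of "norm z" N]]) (use z in \<open>auto simp: z_def\<close>)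
    then have "(\<lambda>j. norm (\<Sum>\<^sub>\<infinity>k\<in>tuples_below N j. norm (f (j, k)))) summable_on UNIV"
      by (subst summable_on_UNIV_nonneg_real_iff) auto
    then show "(\<lambda>j. norm (\<Sum>\<^sub>\<infinity>k\<in>tuples_below N j. norm (f (j, k)))) summable_on {1..}"
      by (rule summable_on_subset_banach) auto
  qed
  have bij: "bij_betw (\<lambda>(j, k). k(Suc N := j)) ?S (tuples (Suc N))"
  proof -
    have "tuples (Suc N) = {k \<in> tuples (Suc N). k (Suc N) \<in> {1..}}" by (auto simp: tuples_def)
    then show ?thesis using bij_betw_tuples_Suc[of "{1..}" N] by simp
  qed
  have "(\<Sum>\<^sub>\<infinity>k\<in>tuples (Suc N). nsum_term v a (Suc N) k) = (\<Sum>\<^sub>\<infinity>p\<in>?S. f p)"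
    unfolding infsum_reindex_bij_betw[OF bij, symmetric] f_def z_def
    by (intro infsum_cong) (auto simp: nsum_term_upd simp del: fun_upd_apply)
  also have "\<dots> = (\<Sum>\<^sub>\<infinity>j\<in>{1..}. \<Sum>\<^sub>\<infinity>k\<in>tuples_below N j. f (j, k))"
    by (rule infsum_Sigma_banach[symmetric, OF abs_summable_summable[OF fs]])
  also have "\<dots> = (\<Sum>\<^sub>\<infinity>j\<in>{1..}. 1 / of_nat j ^ a (Suc N) * nsum v a N j * z ^ j)"
    by (intro infsum_cong)
      (simp only: infsum_finite[OF finite_tuples_below] f_def prod.case sum_distrib_left[symmetric] sum_nsum_term, simp)
  \<comment> \<open>The added term at j = 0 vanishes: division by zero yields 0, and the exponent is
    positive.\<close>
  also have "\<dots> = (\<Sum>\<^sub>\<infinity>j. 1 / of_nat j ^ a (Suc N) * nsum v a N j * z ^ j)"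
    by (rule infsum_cong_neutral) (use a in \<open>auto simp: not_le\<close>)
  also have "\<dots> = suminf (\<lambda>j. 1 / of_nat j ^ a (Suc N) * nsum v a N j * z ^ j)"
    by (intro infsumI norm_summable_imp_has_sum summable_sums summable_norm_cancel[OF summable_nsum] summable_nsum)
      (use v c1 z in \<open>auto simp: z_def\<close>)
  finally show ?thesis by (simp add: z_def)
qed

lemma nsum_cong:
  "(\<And>i. i \<in> {1..m} \<Longrightarrow> v i = v' i) \<Longrightarrow> (\<And>i. i \<in> {1..m} \<Longrightarrow> a i = a' i) \<Longrightarrow> nsum v a m K = nsum v' a' m K"
  by (induction m arbitrary: K) auto

text \<open>Partial sums are the coefficients of the Cauchy product with the geometric series; the
  extra factor z comes from the strict bound k < K.\<close>

lemma suminf_partial_sums: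
  fixes f :: "nat \<Rightarrow> complex"
  assumes "summable (\<lambda>k. norm (f k * z ^ k))" and "norm z < 1"
  shows "suminf (\<lambda>K. (\<Sum>k<K. f k) * z ^ K) = z / (1 - z) * suminf (\<lambda>k. f k * z ^ k)"
proof -
  have g: "summable (\<lambda>k. norm (z ^ k))" using assms(2) by (simp add: norm_power summable_geometric)
  have "(\<lambda>K. \<Sum>i\<le>K. (f i * z ^ i) * z ^ (K - i)) sums (suminf (\<lambda>k. f k * z ^ k) * suminf (\<lambda>k. z ^ k))"
    by (rule Cauchy_product_sums[OF assms(1) g])
  moreover have "(\<Sum>i\<le>K. (f i * z ^ i) * z ^ (K - i)) = (\<Sum>k<Suc K. f k) * z ^ K" for K
    unfolding sum_distrib_right lessThan_Suc_atMost
    by (intro sum.cong refl) (simp flip: power_add)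
  ultimately have "(\<lambda>K. z * ((\<Sum>k<Suc K. f k) * z ^ K)) sums (z * (suminf (\<lambda>k. f k * z ^ k) * (1 / (1 - z))))"
    using suminf_geometric[OF assms(2)] by (intro sums_mult) simp
  then have "(\<lambda>K. (\<Sum>k<Suc K. f k) * z ^ Suc K) sums (z / (1 - z) * suminf (\<lambda>k. f k * z ^ k))"
    by (simp add: mult_ac)
  then have "(\<lambda>K. (\<Sum>k<K. f k) * z ^ K) sums (z / (1 - z) * suminf (\<lambda>k. f k * z ^ k))"
    by (subst (asm) sums_Suc_iff) simp
  then show ?thesis by (rule sums_unique[symmetric])
qed

section \<open>The polylogarithm as a power series in the last coordinate\<close>

lemma norm_prod_le_1:
  fixes x :: "complex ^ 'n::finite"
  shows "x \<in> polydisc \<Longrightarrow> norm (\<Prod>j\<in>A. x $ j) \<le> 1"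
  unfolding prod_norm[symmetric] by (intro prod_le_1) (auto simp: polydisc_def less_imp_le)

lemma norm_y_mon_le: "x \<in> polydisc \<Longrightarrow> norm (y_mon N \<kappa> i x) \<le> 1"
  unfolding y_mon_def by (rule norm_prod_le_1)

lemma norm_prod_less_1:
  fixes x :: "complex ^ 'n::finite"
  assumes "x \<in> polydisc" "A \<noteq> {}"
  shows "norm (\<Prod>j\<in>A. x $ j) < 1"
proof -
  obtain k where k: "k \<in> A" using assms by blast
  have "(\<Prod>j\<in>A. x $ j) = x $ k * (\<Prod>j\<in>A - {k}. x $ j)" by (rule prod.remove[OF _ k]) simp
  moreover have "norm (x $ k) < 1" using assms(1) by (simp add: polydisc_def)
  ultimately show ?thesis
    using norm_prod_le_1[OF assms(1), of "A - {k}"] by (simp add: norm_mult) (metis mult_left_le norm_ge_zero order_le_less_trans)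
qed

lemma norm_zc_less: "x \<in> polydisc \<Longrightarrow> norm (zc i x) < 1"
  unfolding zc_def by (rule norm_prod_less_1) auto

lemma y_mon_last: "y_mon N \<kappa> N x = zc (\<kappa> N) x"
proof -
  have "{j. \<kappa> N \<le> j} = {\<kappa> N..}" by auto
  then show ?thesis by (simp add: y_mon_def zc_def)
qed

lemma polylog_Suc:
  assumes x: "x \<in> polydisc" and a: "1 \<le> a (Suc N)"
  shows "polylog (Suc N) a \<kappa> x
    = suminf (\<lambda>K. 1 / of_nat K ^ a (Suc N) * nsum (\<lambda>i. y_mon (Suc N) \<kappa> i x) a N K * zc (\<kappa> (Suc N)) x ^ K)"
  using infsum_nsum_term[where v = "\<lambda>i. y_mon (Suc N) \<kappa> i x", where N = N, where a = a] a
    norm_y_mon_le[OF x] norm_zc_less[OF x]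
  unfolding polylog_def tuples_def nsum_term_def y_mon_last by simp

lemma polylog_0: "polylog 0 a \<kappa> x = 1"
  by (simp add: polylog_def strict_mono_on_def)

lemma zc_split:
  fixes x :: "complex ^ 'n::{finite,linorder}"
  shows "zc i x = x $ Max UNIV * (\<Prod>j\<in>{i..} - {Max UNIV}. x $ j)"
  unfolding zc_def by (rule prod.remove) auto

lemma zc_mult:
  fixes x :: "complex ^ 'n::{finite,linorder}"
  assumes "i \<le> j"
  shows "(\<Prod>l\<in>{i..<j}. x $ l) * zc j x = zc i x"
proof -
  have "{i..} = {i..<j} \<union> {j..}" using assms by auto
  moreover have "{i..<j} \<inter> {j..} = {}" by auto
  ultimately show ?thesis unfolding zc_def by (subst \<open>{i..} = _\<close>, subst prod.union_disjoint) auto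
qed

lemma zc_0:
  fixes x :: "complex ^ 'n::{finite,linorder}"
  shows "x $ Max UNIV = 0 \<Longrightarrow> zc i x = 0"
  by (simp add: zc_split)

lemma polylog_boundary:
  fixes x :: "complex ^ 'n::{finite,linorder}"
  assumes x: "x \<in> polydisc" and a: "1 \<le> a (Suc N)" and 0: "x $ Max UNIV = 0"
  shows "polylog (Suc N) a \<kappa> x = 0"
proof -
  have "1 / of_nat K ^ a (Suc N) * nsum (\<lambda>i. y_mon (Suc N) \<kappa> i x) a N K * zc (\<kappa> (Suc N)) x ^ K = 0" for K
    using a by (cases "K = 0") (simp_all add: zc_0[OF 0])
  then show ?thesis by (simp only: polylog_Suc[of x a N, OF x a] suminf_zero)
qed

text \<open>The coordinate x_n occurs only in the variable of the largest index K, so x_n d/dx_n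
  multiplies the K-th term by K and lowers the last exponent by one. If this exponent drops to 0,
  the sum over K is geometric and leaves z / (1 - z) times the shorter polylogarithm.\<close>

lemma polylog_deriv:
  fixes x :: "complex ^ 'n::{finite,linorder}"
  assumes x: "x \<in> polydisc" and a: "\<And>i. i \<in> {1..Suc N} \<Longrightarrow> 1 \<le> a i" and \<kappa>: "mono_on {1..Suc N} \<kappa>"
  shows "\<exists>D. ((\<lambda>t. polylog (Suc N) a \<kappa> (upd x (Max UNIV) t)) has_field_derivative D) (at (x $ Max UNIV)) \<and>
     x $ Max UNIV * D = (if a (Suc N) = 1 then zc (\<kappa> (Suc N)) x / (1 - zc (\<kappa> (Suc N)) x) * polylog N a \<kappa> x
       else polylog (Suc N) (a(Suc N := a (Suc N) - 1)) \<kappa> x)"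
proof -
  let ?n = "Max UNIV :: 'n"
  define v where "v i = y_mon (Suc N) \<kappa> i x" for i
  define c where "c = (\<Prod>j\<in>{\<kappa> (Suc N)..} - {?n}. x $ j)"
  define t0 where "t0 = x $ ?n"
  define z where "z = zc (\<kappa> (Suc N)) x"
  have z: "z = t0 * c" unfolding z_def t0_def c_def by (rule zc_split)
  have t0: "norm t0 < 1" using x by (simp add: t0_def polydisc_def)
  have z1: "norm z < 1" unfolding z_def by (rule norm_zc_less[OF x])
  have c1: "norm c \<le> 1" unfolding c_def by (rule norm_prod_le_1[OF x])
  obtain b where b: "a (Suc N) = Suc b" using a[of "Suc N"] by (cases "a (Suc N)") auto
  have v1: "norm (v i) \<le> 1" for i unfolding v_def by (rule norm_y_mon_le[OF x])
  have v_upd: "y_mon (Suc N) \<kappa> i (upd x ?n t) = v i" if "i \<in> {1..N}" for i t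
  proof -
    have "j \<noteq> ?n" if "j < \<kappa> (Suc i)" for j using that Max_ge[of UNIV "\<kappa> (Suc i)"] by auto
    then show ?thesis unfolding v_def y_mon_def using that by (intro prod.cong) (auto simp: upd_nth)
  qed
  have z_upd: "zc (\<kappa> (Suc N)) (upd x ?n t) = t * c" for t
    unfolding zc_split c_def by (auto simp: upd_nth intro!: arg_cong2[of _ _ _ _ "(*)"] prod.cong)
  define g where "g K = 1 / of_nat K ^ Suc b * nsum v a N K * c ^ K" for K
  have F: "polylog (Suc N) a \<kappa> (upd x ?n t) = suminf (\<lambda>K. g K * t ^ K)" if "norm t < 1" for t
  proof -
    have "nsum (\<lambda>i. y_mon (Suc N) \<kappa> i (upd x ?n t)) a N K = nsum v a N K" for K
      by (rule nsum_cong) (simp_all add: v_upd)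
    then show ?thesis
      using polylog_Suc[OF upd_polydisc[OF x that], of a N \<kappa>]
      by (simp add: b z_upd g_def power_mult_distrib mult_ac)
  qed
  have inv1: "norm (1 / of_nat K ^ Suc b * c ^ K) \<le> 1" for K
    using c1 by (cases "K = 0") (auto simp: norm_mult norm_divide norm_power divide_le_eq_1 power_le_one
        intro!: order_trans[OF power_le_one] mult_ge1_I one_le_power)
  have conv: "summable (\<lambda>K. g K * t ^ K)" if "norm t < 1" for t
  proof -
    have "summable (\<lambda>K. norm (1 / of_nat K ^ Suc b * c ^ K * nsum v a N K * t ^ K))"
      by (rule summable_nsum) (use v1 inv1 that in auto)
    then show ?thesis by (auto simp: g_def mult_ac dest: summable_norm_cancel)
  qed
  have "((\<lambda>t. suminf (\<lambda>K. g K * t ^ K)) has_field_derivative suminf (\<lambda>K. diffs g K * t0 ^ K)) (at t0)"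
    by (rule termdiffs_strong'[of 1]) (use conv t0 in auto)
  then have D: "((\<lambda>t. polylog (Suc N) a \<kappa> (upd x ?n t)) has_field_derivative suminf (\<lambda>K. diffs g K * t0 ^ K)) (at t0)"
    by (rule has_field_derivative_transform_within_open[of _ _ _ "ball 0 1"]) (use t0 F in auto)
  have "summable (\<lambda>K. diffs g K * t0 ^ K)" by (rule termdiff_converges[OF t0 conv])
  then have "t0 * suminf (\<lambda>K. diffs g K * t0 ^ K) = suminf (\<lambda>K. t0 * (diffs g K * t0 ^ K))"
    by (simp add: suminf_mult)
  also have "\<dots> = suminf (\<lambda>K. of_nat (Suc K) * g (Suc K) * t0 ^ Suc K)"
    by (simp add: diffs_def mult_ac)
  also have "\<dots> = suminf (\<lambda>K. of_nat K * g K * t0 ^ K)"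
  proof -
    have "summable (\<lambda>K. t0 * (diffs g K * t0 ^ K))"
      by (intro summable_mult termdiff_converges[OF t0 conv])
    then have "summable (\<lambda>K. of_nat (Suc K) * g (Suc K) * t0 ^ Suc K)" by (simp add: diffs_def mult_ac)
    then have "summable (\<lambda>K. of_nat K * g K * t0 ^ K)" by (subst (asm) summable_Suc_iff)
    from suminf_split_head[OF this] show ?thesis by simp
  qed
  finally have main: "t0 * suminf (\<lambda>K. diffs g K * t0 ^ K) = suminf (\<lambda>K. of_nat K * g K * t0 ^ K)" .
  have "suminf (\<lambda>K. of_nat K * g K * t0 ^ K) = (if a (Suc N) = 1 then z / (1 - z) * polylog N a \<kappa> x
       else polylog (Suc N) (a(Suc N := a (Suc N) - 1)) \<kappa> x)"
  proof (cases "b = 0")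
    case False
    have "of_nat K * g K * t0 ^ K = 1 / of_nat K ^ b * nsum v a N K * z ^ K" for K
      using False by (cases "K = 0") (simp_all add: g_def z power_mult_distrib)
    moreover have "nsum v a N K = nsum v (a(Suc N := b)) N K" for K by (rule nsum_cong) auto
    ultimately show ?thesis
      using False polylog_Suc[OF x, of "a(Suc N := b)" N \<kappa>] by (simp add: b z_def v_def[abs_def])
  next
    case True
    have pw: "of_nat K * g K * t0 ^ K = (if K = 0 then 0 else nsum v a N K * z ^ K)" for K
      using True by (simp add: g_def z power_mult_distrib)
    show ?thesis
    proof (cases N)
      case 0
      \<comment> \<open>For N = 0 the inner sum is 1 for K > 0; written as partial sums of the
        indicator of 0 it also has the correct value 0 at K = 0.\<close>
      have "suminf (\<lambda>K. of_nat K * g K * t0 ^ K) = suminf (\<lambda>K. (\<Sum>k<K. if k = 0 then 1 else 0) * z ^ K)"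
        unfolding pw by (intro suminf_cong) (auto simp: 0)
      also have "\<dots> = z / (1 - z) * suminf (\<lambda>k. (if k = 0 then 1 else 0) * z ^ k)"
        by (rule suminf_partial_sums[OF _ z1]) (rule summable_finite[of "{0}"], auto)
      also have "suminf (\<lambda>k. (if k = 0 then 1 else 0) * z ^ k) = 1"
        using suminf_finite[of "{0}" "\<lambda>k. (if k = 0 then 1 else 0) * z ^ k"] by simp
      finally show ?thesis using True b by (simp add: 0 polylog_0)
    next
      case (Suc M)
      define w where "w i = y_mon (Suc M) \<kappa> i x" for i
      have aN: "1 \<le> a (Suc M)" using a Suc by auto
      have vw: "v i = w i" if "i \<in> {1..M}" for i
        using that Suc by (simp add: v_def w_def y_mon_def)
      \<comment> \<open>After the geometric summation the variable of the new largest index absorbs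
        z, and the product telescopes to the last variable of the shorter polylogarithm.\<close>
      have vz: "v (Suc M) * z = zc (\<kappa> (Suc M)) x"
      proof -
        have "v (Suc M) = (\<Prod>l\<in>{\<kappa> (Suc M)..<\<kappa> (Suc N)}. x $ l)"
          unfolding v_def y_mon_def Suc by (intro prod.cong) auto
        moreover have "\<kappa> (Suc M) \<le> \<kappa> (Suc N)" using \<kappa> Suc by (auto simp: mono_on_def)
        ultimately show ?thesis unfolding z_def by (simp add: zc_mult)
      qed
      define f where "f k = v (Suc M) ^ k / of_nat k ^ a (Suc M) * nsum v a M k" for k
      have f0: "f 0 = 0" using aN by (simp add: f_def)
      have fz: "f k * z ^ k = 1 / of_nat k ^ a (Suc M) * nsum w a M k * zc (\<kappa> (Suc M)) x ^ k" for k
        using nsum_cong[of M v w a a k] vw by (simp add: f_def power_mult_distrib flip: vz)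
      have "suminf (\<lambda>K. of_nat K * g K * t0 ^ K) = suminf (\<lambda>K. (\<Sum>k<K. f k) * z ^ K)"
      proof (intro suminf_cong)
        fix K
        have "(\<Sum>k<K. f k) = (\<Sum>k\<in>{1..<K}. f k)"
          by (rule sum.mono_neutral_right) (auto simp: f0 not_less_eq_eq)
        then show "of_nat K * g K * t0 ^ K = (\<Sum>k<K. f k) * z ^ K"
          unfolding pw by (simp add: Suc f_def)
      qed
      also have "\<dots> = z / (1 - z) * suminf (\<lambda>k. f k * z ^ k)"
      proof (rule suminf_partial_sums[OF _ z1])
        have "norm (1 / of_nat k ^ a (Suc M) :: complex) \<le> 1" for k
          using aN by (cases "k = 0") (auto simp: norm_divide norm_power divide_le_eq_1)
        then show "summable (\<lambda>k. norm (f k * z ^ k))"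
          unfolding fz by (intro summable_nsum norm_zc_less[OF x]) (auto simp: w_def norm_y_mon_le[OF x])
      qed
      also have "suminf (\<lambda>k. f k * z ^ k) = polylog (Suc M) a \<kappa> x"
        by (simp only: fz polylog_Suc[of x a M, OF x aN] w_def[abs_def])
      finally show ?thesis using True b by (simp add: Suc)
    qed
  qed
  then show ?thesis using D main unfolding t0_def z_def by auto
qed

section \<open>The iterated integral map\<close>

text \<open>The relations at \<alpha> and at all points, minus those at \<beta> and \<omega>,
  contain the right side twice. In direction x_n all forms dlog z_i and dlog (z_i - z_j) equal dx_n
  / x_n, and this identity collects their coefficients.\<close>

lemma gX_beta_omega:
  "gX \<beta> \<omega> = (\<Sum>i\<in>UNIV. gX \<alpha> (i_pt i)) + (\<Sum>(i, j)\<in>{(i, j). i < j}. gX (i_pt i) (i_pt (j :: 'n::{finite,linorder})))"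
proof -
  define T where "T = (\<Sum>i\<in>UNIV. gX \<alpha> (i_pt (i :: 'n)))"
  define P where "P = (\<Sum>(i, j)\<in>{(i, j). i < j}. gX (i_pt i) (i_pt (j :: 'n)))"
  define B where "B = (\<Sum>i\<in>UNIV. gX (i_pt (i :: 'n)) \<beta>)"
  define W where "W = (\<Sum>i\<in>UNIV. gX (i_pt (i :: 'n)) \<omega>)"
  have PP: "(\<Sum>i\<in>UNIV. \<Sum>j\<in>UNIV. gX (i_pt i) (i_pt (j :: 'n))) = P + P"
  proof -
    let ?f = "\<lambda>(i, j). gX (i_pt i) (i_pt (j :: 'n))"
    have "(\<Sum>i\<in>UNIV. \<Sum>j\<in>UNIV. gX (i_pt i) (i_pt (j :: 'n))) = sum ?f UNIV"
      by (simp add: sum.cartesian_product)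
    also have "(UNIV :: ('n \<times> 'n) set) = {(i, j). i < j} \<union> ({(i, j). j < i} \<union> {(i, j). i = j})"
      by auto
    also have "sum ?f \<dots> = sum ?f {(i, j). i < j} + (sum ?f {(i, j). j < i} + sum ?f {(i, j). i = j})"
      by (subst sum.union_disjoint; (subst sum.union_disjoint)?) auto
    also have "sum ?f {(i, j). i = j} = 0" by (rule sum.neutral) (auto simp: gX_diag)
    also have "sum ?f {(i, j). j < i} = P"
      unfolding P_def by (rule sum.reindex_bij_witness[of _ prod.swap prod.swap]) (auto intro: gX_sym)
    finally show ?thesis by (simp add: P_def)
  qed
  have a: "gX \<alpha> \<beta> + gX \<alpha> \<omega> + T = 0"
    using sum_gX[of "\<alpha> :: 'n idx"] by (simp add: sum_idx sum_base gX_diag T_def add.assoc)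
  have "(\<Sum>i\<in>UNIV. \<Sum>b\<in>UNIV. gX (i_pt (i :: 'n)) b) = 0" by (simp add: sum_gX)
  then have i: "B + (T + W + (P + P)) = 0"
    by (simp add: sum_idx sum_base sum.distrib PP B_def T_def W_def gX_sym[of "i_pt _" \<alpha>])
  have b: "gX \<alpha> \<beta> + gX \<beta> \<omega> + B = 0"
    using sum_gX[of "\<beta> :: 'n idx"] by (simp add: sum_idx sum_base gX_diag B_def gX_sym[of \<beta> \<alpha>] gX_sym[of \<beta> "i_pt _"])
  have o: "gX \<beta> \<omega> + gX \<alpha> \<omega> + W = 0"
    using sum_gX[of "\<omega> :: 'n idx"] by (simp add: sum_idx sum_base gX_diag W_def gX_sym[of \<omega>] add.assoc)
  have "(T + P) + (T + P) = (gX \<alpha> \<beta> + gX \<alpha> \<omega> + T) + (B + (T + W + (P + P)))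
      - (gX \<alpha> \<beta> + gX \<beta> \<omega> + B) - (gX \<beta> \<omega> + gX \<alpha> \<omega> + W) + (gX \<beta> \<omega> + gX \<beta> \<omega>)"
    by (simp add: algebra_simps)
  then have "(T + P) + (T + P) = gX \<beta> \<omega> + gX \<beta> \<omega>" unfolding a i b o by simp
  then have "2 *\<^sub>C (T + P) = 2 *\<^sub>C gX \<beta> \<omega>"
    using scaleC_add_left[of 1 1] scaleC_one by (metis one_add_one)
  then show ?thesis unfolding T_def P_def by (simp add: cvec.scale_left_imp_eq)
qed

section \<open>Operations on the graded dual\<close>

lemma graded_dualD: "\<phi> \<in> graded_dual \<Longrightarrow> clinear \<phi>"
  unfolding graded_dual_def clinear_functional by blast

lemma graded_dual_add: "\<phi> \<in> graded_dual \<Longrightarrow> \<psi> \<in> graded_dual \<Longrightarrow> (\<lambda>u. \<phi> u + \<psi> u) \<in> graded_dual"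
proof -
  assume *: "\<phi> \<in> graded_dual" "\<psi> \<in> graded_dual"
  then obtain D E where D: "\<forall>d>D. \<forall>u\<in>uea_deg d. \<phi> u = 0" "\<forall>d>E. \<forall>u\<in>uea_deg d. \<psi> u = 0"
    unfolding graded_dual_def by blast
  then have "\<forall>d>max D E. \<forall>u\<in>uea_deg d. \<phi> u + \<psi> u = 0"
    by (metis add.right_neutral max_less_iff_conj)
  moreover have "clinear (\<lambda>u. \<phi> u + \<psi> u)"
    using *[THEN graded_dualD] by (intro clinearI) (simp_all add: clinear_add clinear_scaleC scaleC_add_right)
  ultimately show ?thesis unfolding graded_dual_def clinear_functional by blast
qed

lemma graded_dual_scale: "\<phi> \<in> graded_dual \<Longrightarrow> (\<lambda>u. c * \<phi> u) \<in> graded_dual"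
proof -
  assume *: "\<phi> \<in> graded_dual"
  then obtain D where D: "\<forall>d>D. \<forall>u\<in>uea_deg d. \<phi> u = 0"
    unfolding graded_dual_def by blast
  then have "\<forall>d>D. \<forall>u\<in>uea_deg d. c * \<phi> u = 0" by simp
  moreover have "clinear (\<lambda>u. c * \<phi> u)"
    using *[THEN graded_dualD] by (intro clinearI) (simp_all add: clinear_add clinear_scaleC scaleC_complex_def algebra_simps)
  ultimately show ?thesis unfolding graded_dual_def clinear_functional by blast
qed

lemma uea_deg_Suc: "u \<in> uea_deg d \<Longrightarrow> uemb (gX a b) * u \<in> uea_deg (Suc d)"
  unfolding uea_deg_eq
proof (induction rule: cvec.span_induct_alt)
  case (step c x y)
  then obtain ps where "x = gens ps" "length ps = d" by blast
  then have "uemb (gX a b) * x = gens ((a, b) # ps)" "length ((a, b) # ps) = Suc d" by simp_all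
  then have "uemb (gX a b) * x \<in> cvec.span {gens ps |ps. length ps = Suc d}"
    by (intro cvec.span_base) blast
  with step show ?case
    unfolding distrib_left scaleC_mult_right by (intro cvec.span_add cvec.span_scale)
qed (simp add: cvec.span_zero)

lemma clinear_precomp: "clinear \<phi> \<Longrightarrow> clinear (precomp \<phi> X)"
  unfolding precomp_def by (rule clinear_compose[OF _ clinear_mult_left])

lemma graded_dual_precomp: "\<phi> \<in> graded_dual \<Longrightarrow> precomp \<phi> (gX a b) \<in> graded_dual"
proof -
  assume *: "\<phi> \<in> graded_dual"
  then obtain D where D: "\<forall>d>D. \<forall>u\<in>uea_deg d. \<phi> u = 0"
    unfolding graded_dual_def by blast
  then have "\<forall>d>D. \<forall>u\<in>uea_deg d. precomp \<phi> (gX a b) u = 0"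
    unfolding precomp_def using uea_deg_Suc less_SucI by blast
  then show ?thesis
    using clinear_precomp[OF graded_dualD[OF *]] unfolding graded_dual_def clinear_functional by blast
qed

lemma precomp_add: "clinear \<phi> \<Longrightarrow> precomp \<phi> (X + Y) u = precomp \<phi> X u + precomp \<phi> Y u"
  by (simp add: precomp_def clinear_add[OF clinear_uemb] distrib_right clinear_add)

lemma precomp_0: "clinear \<phi> \<Longrightarrow> precomp \<phi> 0 u = 0"
  by (simp add: precomp_def clinear_0[OF clinear_uemb] clinear_0)

lemma precomp_sum: "clinear \<phi> \<Longrightarrow> precomp \<phi> (sum X A) u = (\<Sum>a\<in>A. precomp \<phi> (X a) u)"
  by (induction A rule: infinite_finite_induct) (simp_all add: precomp_0 precomp_add)

lemma homogeneous_graded_dual: "homogeneous d \<phi> \<Longrightarrow> \<phi> \<in> graded_dual"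
  by (simp add: homogeneous_def)

lemma homogeneous_precomp: "homogeneous (Suc d) \<phi> \<Longrightarrow> homogeneous d (precomp \<phi> (gX a b))"
  unfolding homogeneous_def using graded_dual_precomp uea_deg_Suc
  by (metis (no_types, lifting) nat.inject precomp_def)

lemma gens_uea_deg: "gens ps \<in> uea_deg (length ps)"
  unfolding uea_deg_eq by (rule cvec.span_base) blast

lemma homogeneous_0_eq:
  assumes "homogeneous 0 \<phi>"
  shows "\<phi> = (\<lambda>u. \<phi> 1 * counit u)"
proof
  fix u
  show "\<phi> u = \<phi> 1 * counit u"
  proof (rule clinear_eq_on_gens[of \<phi>])
    show "clinear \<phi>" by (rule graded_dualD[OF homogeneous_graded_dual[OF assms]])
    show "clinear (\<lambda>u. \<phi> 1 * counit u)"
      by (rule clinearI) (simp_all add: clinear_add[OF clinear_counit] clinear_scaleC[OF clinear_counit] scaleC_complex_def algebra_simps)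
    show "\<phi> (gens ps) = \<phi> 1 * counit (gens ps)" for ps
    proof (cases "ps = []")
      case False
      then have "\<phi> (gens ps) = 0"
        using assms gens_uea_deg[of ps] unfolding homogeneous_def by (metis length_0_conv)
      then show ?thesis using False by (simp add: counit_gens)
    qed (simp add: counit_one)
  qed
qed

text \<open>\<open>coeff_b\<close> and \<open>coeff_c\<close> are x_k times the dx_k-components of
  dlog (z_i - 1) and dlog (z_i - z_j). With z_i = y z_j for i < j, the latter form is dlog z_j +
  dlog (y - 1), so both are regular on the whole polydisc.\<close>

definition coeff_b :: "'n \<Rightarrow> 'n \<Rightarrow> complex ^ 'n::{finite,linorder} \<Rightarrow> complex" where
  "coeff_b i k x = (if i \<le> k then - zc i x / (1 - zc i x) else 0)"

definition coeff_c :: "'n \<Rightarrow> 'n \<Rightarrow> 'n \<Rightarrow> complex ^ 'n::{finite,linorder} \<Rightarrow> complex" where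
  "coeff_c i j k x = (if j \<le> k then 1 else if i \<le> k then
     - (\<Prod>l\<in>{i..<j}. x $ l) / (1 - (\<Prod>l\<in>{i..<j}. x $ l)) else 0)"

lemma zc_upd:
  fixes x :: "complex ^ 'n::{finite,linorder}"
  shows "zc i (upd x k t) = (if i \<le> k then t * (\<Prod>j\<in>{i..} - {k}. x $ j) else zc i x)"
proof (cases "i \<le> k")
  case True
  have "zc i (upd x k t) = upd x k t $ k * (\<Prod>j\<in>{i..} - {k}. upd x k t $ j)"
    unfolding zc_def by (rule prod.remove) (use True in auto)
  also have "(\<Prod>j\<in>{i..} - {k}. upd x k t $ j) = (\<Prod>j\<in>{i..} - {k}. x $ j)"
    by (rule prod.cong) (auto simp: upd_nth)
  finally show ?thesis using True by (simp add: upd_nth)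
next
  case False
  then show ?thesis unfolding zc_def by (auto simp: upd_nth intro!: prod.cong)
qed

lemma partial_deriv_affine:
  fixes x :: "complex ^ 'n::finite"
  assumes "\<And>t. g (upd x k t) = A + t * B"
  shows "partial_deriv k g x = B"
  unfolding partial_deriv_def upd_def[symmetric] assms
  by (rule DERIV_imp_deriv) (auto intro!: derivative_eq_intros)

lemma partial_deriv_zc:
  fixes x :: "complex ^ 'n::{finite,linorder}"
  defines "B i k \<equiv> if i \<le> k then \<Prod>j\<in>{i..} - {k}. x $ j else 0"
  shows "partial_deriv k (zc i) x = B i k"
    and "partial_deriv k (\<lambda>y. zc i y - 1) x = B i k"
    and "partial_deriv k (\<lambda>y. zc i y - zc j y) x = B i k - B j k"
proof -
  define A where "A i = (if i \<le> k then 0 else zc i x)" for i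
  have aff: "zc i (upd x k t) = A i + t * B i k" for i t by (simp add: zc_upd A_def B_def)
  show "partial_deriv k (zc i) x = B i k" by (rule partial_deriv_affine) (rule aff)
  show "partial_deriv k (\<lambda>y. zc i y - 1) x = B i k"
    by (rule partial_deriv_affine[of _ _ _ "A i - 1"]) (simp add: aff)
  show "partial_deriv k (\<lambda>y. zc i y - zc j y) x = B i k - B j k"
    by (rule partial_deriv_affine[of _ _ _ "A i - A j"]) (simp add: aff algebra_simps)
qed

lemma dlog_times:
  fixes x :: "complex ^ 'n::{finite,linorder}"
  assumes x: "x \<in> polydisc" and nz: "\<And>i. x $ i \<noteq> 0"
  shows dlog_zc: "x $ k * dlog (zc i) k x = (if i \<le> k then 1 else 0)"
    and dlog_zc_1: "x $ k * dlog (\<lambda>y. zc i y - 1) k x = coeff_b i k x"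
    and dlog_zc_diff: "i < j \<Longrightarrow> x $ k * dlog (\<lambda>y. zc i y - zc j y) k x = coeff_c i j k x"
proof -
  define B where "B i = (if i \<le> k then \<Prod>j\<in>{i..} - {k}. x $ j else 0)" for i
  define A where "A i = (if i \<le> k then 0 else zc i x)" for i
  have aff: "zc i (upd x k t) = A i + t * B i" for i t by (simp add: zc_upd A_def B_def)
  have self: "zc i x = A i + x $ k * B i" for i using aff[of i "x $ k"] by (simp add: upd_same)
  have zn: "zc i x \<noteq> 0" for i using nz by (simp add: zc_def)
  note pd = partial_deriv_zc[where k = k and x = x, folded B_def]
  show "x $ k * dlog (zc i) k x = (if i \<le> k then 1 else 0)"
    using zn[of i] self[of i] unfolding dlog_def pd(1) by (auto simp: A_def B_def)
  have "zc i x \<noteq> 1" using norm_zc_less[OF x, of i] by auto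
  then show "x $ k * dlog (\<lambda>y. zc i y - 1) k x = coeff_b i k x"
    using self[of i] unfolding dlog_def pd(2) coeff_b_def by (auto simp: A_def B_def divide_simps) (auto simp: algebra_simps)
  assume ij: "i < j"
  define y where "y = (\<Prod>l\<in>{i..<j}. x $ l)"
  have y1: "y \<noteq> 1" using norm_prod_less_1[OF x, of "{i..<j}"] ij by (auto simp: y_def)
  have zij: "zc i x = y * zc j x" using zc_mult[of i j x] ij by (simp add: y_def)
  have main: "x $ k * (B i - B j) / (zc i x - zc j x) = coeff_c i j k x"
  proof -
    consider "j \<le> k" | "i \<le> k" "\<not> j \<le> k" | "\<not> i \<le> k" by blast
    then show ?thesis
    proof cases
      case 1
      then have "i \<le> k" using ij by auto
      then have "x $ k * (B i - B j) = zc i x - zc j x" using 1 self[of i] self[of j] by (simp add: A_def algebra_simps)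
      moreover have "zc i x - zc j x \<noteq> 0" using zij y1 zn[of j] by simp
      ultimately show ?thesis using 1 by (simp add: coeff_c_def)
    next
      case 2
      then have "x $ k * (B i - B j) = y * zc j x" using self[of i] zij by (simp add: A_def B_def[of j])
      moreover have "zc i x - zc j x = (y - 1) * zc j x" by (simp add: zij algebra_simps)
      ultimately have "x $ k * (B i - B j) / (zc i x - zc j x) = y / (y - 1)" using zn[of j] by simp
      also have "\<dots> = - y / (1 - y)" by (metis minus_diff_eq minus_divide_right minus_divide_left)
      finally show ?thesis using 2 by (simp add: coeff_c_def y_def)
    next
      case 3
      then show ?thesis using ij by (simp add: B_def coeff_c_def)
    qed
  qed
  then show "x $ k * dlog (\<lambda>y. zc i y - zc j y) k x = coeff_c i j k x"
    unfolding dlog_def pd(3) by simp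
qed

lemma continuous_on_zc: "continuous_on S (zc i)"
  unfolding zc_def by (intro continuous_intros)

lemma continuous_on_coeff_b: "continuous_on polydisc (coeff_b i k)"
proof (cases "i \<le> k")
  case True
  have "1 - zc i x \<noteq> 0" if "x \<in> polydisc" for x using norm_zc_less[OF that, of i] by auto
  then show ?thesis
    using True unfolding coeff_b_def by (auto intro!: continuous_intros continuous_on_zc)
qed (simp add: coeff_b_def)

lemma continuous_on_coeff_c:
  fixes i j k :: "'n::{finite,linorder}"
  assumes "i < j"
  shows "continuous_on polydisc (coeff_c i j k)"
proof (cases "i \<le> k \<and> \<not> j \<le> k")
  case True
  have "1 - (\<Prod>l\<in>{i..<j}. x $ l) \<noteq> 0" if "x \<in> polydisc" for x :: "(complex, 'n) vec"
    using norm_prod_less_1[OF that, of "{i..<j}"] assms by auto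
  then show ?thesis
    using True unfolding coeff_c_def by (auto intro!: continuous_intros)
next
  case False
  then show ?thesis by (cases "j \<le> k") (simp_all add: coeff_c_def[abs_def])
qed

lemma continuous_eq_0_of_nonzero_coords:
  fixes h :: "complex ^ 'm::finite \<Rightarrow> complex"
  assumes "continuous_on polydisc h" and "\<And>x :: complex ^ 'm. x \<in> polydisc \<Longrightarrow> \<forall>i. x $ i \<noteq> 0 \<Longrightarrow> h x = 0" and x: "x \<in> polydisc"
  shows "h x = 0"
proof -
  \<comment> \<open>Zero coordinates are replaced by 1 / (m + 2); the shift by two keeps the points
    inside the polydisc.\<close>
  define y where "y m = (\<chi> i. if x $ i = 0 then inverse (of_nat (Suc (Suc m))) else x $ i)" for m
  have "y \<longlonglongrightarrow> x"
  proof (rule vec_tendstoI)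
    fix i
    show "(\<lambda>m. y m $ i) \<longlonglongrightarrow> x $ i"
    proof (cases "x $ i = 0")
      case True
      have "(\<lambda>m. inverse (of_nat (Suc (Suc m))) :: complex) \<longlonglongrightarrow> 0"
        by (rule LIMSEQ_Suc[OF LIMSEQ_Suc[OF lim_inverse_n]])
      then show ?thesis using True by (simp add: y_def)
    qed (simp add: y_def)
  qed
  moreover have mem: "y m \<in> polydisc" for m
    using x by (auto simp: polydisc_def y_def norm_inverse inverse_less_1_iff norm_of_nat simp del: of_nat_Suc)
  ultimately have "(\<lambda>m. h (y m)) \<longlonglongrightarrow> h x"
    using assms(1) x by (auto intro: continuous_on_tendsto_compose)
  moreover have "h (y m) = 0" for m
    by (rule assms(2)[OF mem]) (auto simp: y_def simp del: of_nat_Suc)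
  ultimately show ?thesis by (simp add: LIMSEQ_const_iff)
qed

section \<open>Differential equations and boundary values of an iterated integral map\<close>

context
  fixes \<iota> :: "('n::{finite,linorder} idx braid_lie uea \<Rightarrow> complex) \<Rightarrow> 'n logpoly"
  assumes \<iota>: "is_iterated_integral \<iota>"
begin

lemma iota_holo: "\<phi> \<in> graded_dual \<Longrightarrow> \<iota> \<phi> e \<in> holo_polydisc"
  and iota_finite: "\<phi> \<in> graded_dual \<Longrightarrow> finite {e. \<iota> \<phi> e \<noteq> (\<lambda>_. 0)}"
  and iota_add: "\<phi> \<in> graded_dual \<Longrightarrow> \<psi> \<in> graded_dual \<Longrightarrow> \<iota> (\<lambda>u. \<phi> u + \<psi> u) = (\<lambda>e x. \<iota> \<phi> e x + \<iota> \<psi> e x)"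
  and iota_scale: "\<phi> \<in> graded_dual \<Longrightarrow> \<iota> (\<lambda>u. c * \<phi> u) = (\<lambda>e x. c * \<iota> \<phi> e x)"
  and iota_counit: "\<iota> counit = logpoly_const (\<lambda>_. 1)"
  and iota_base: "d > 0 \<Longrightarrow> homogeneous d \<phi> \<Longrightarrow> \<iota> \<phi> (\<lambda>_. 0) 0 = 0"
  using \<iota> by (auto simp: is_iterated_integral_def holo_log_def)

lemma iota_ode:
  fixes x :: "(complex, 'n) vec"
  assumes "\<phi> \<in> graded_dual" "x \<in> polydisc" "\<forall>i. x $ i \<noteq> 0"
  shows "logpoly_deriv k (\<iota> \<phi>) e x =
          (\<Sum>i\<in>UNIV. \<iota> (precomp \<phi> (gX \<alpha> (i_pt i))) e x * dlog (zc i) k x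
                    + \<iota> (precomp \<phi> (gX (i_pt i) \<beta>)) e x * dlog (\<lambda>y. zc i y - 1) k x)
          + (\<Sum>(i, j)\<in>{(i, j). i < j}.
               \<iota> (precomp \<phi> (gX (i_pt i) (i_pt j))) e x * dlog (\<lambda>y. zc i y - zc j y) k x)"
  using \<iota> assms unfolding is_iterated_integral_def by blast

lemma graded_dual_0: "(\<lambda>_. 0) \<in> graded_dual"
  by (auto simp: graded_dual_def clinear_functional clinearI)

lemma iota_0: "\<iota> (\<lambda>_. 0) = (\<lambda>e x. 0)"
  using iota_scale[OF graded_dual_0, of 0] by simp

lemma iota_sum:
  assumes "\<And>a. a \<in> A \<Longrightarrow> f a \<in> graded_dual"
  shows "\<iota> (\<lambda>u. \<Sum>a\<in>A. f a u) = (\<lambda>e x. \<Sum>a\<in>A. \<iota> (f a) e x) \<and> (\<lambda>u. \<Sum>a\<in>A. f a u) \<in> graded_dual"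
  using assms
  by (induction A rule: infinite_finite_induct) (simp_all add: iota_0 graded_dual_0 iota_add graded_dual_add)

lemma iota_exponent_bound:
  assumes "\<phi> \<in> graded_dual"
  shows "\<exists>M. \<forall>k e. M \<le> e k \<longrightarrow> \<iota> \<phi> e = (\<lambda>_. 0)"
proof (intro exI allI impI)
  let ?M = "Suc (\<Sum>e\<in>{e. \<iota> \<phi> e \<noteq> (\<lambda>_. 0)}. \<Sum>k\<in>UNIV. e k)"
  fix k :: 'n and e assume le: "?M \<le> e k"
  show "\<iota> \<phi> e = (\<lambda>_. 0)"
  proof (rule ccontr)
    assume "\<iota> \<phi> e \<noteq> (\<lambda>_. 0)"
    then have "(\<Sum>k\<in>UNIV. e k) \<le> (\<Sum>e\<in>{e. \<iota> \<phi> e \<noteq> (\<lambda>_. 0)}. \<Sum>k\<in>UNIV. e k)"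
      by (intro member_le_sum[of e _ "\<lambda>e. \<Sum>k\<in>UNIV. e k"]) (auto simp: iota_finite[OF assms])
    moreover have "e k \<le> (\<Sum>k\<in>UNIV. e k)" by (rule member_le_sum) auto
    ultimately show False using le by simp
  qed
qed

text \<open>The equation multiplied by x_k has continuous terms on the polydisc, so it persists
  where coordinates vanish, in particular at x_n = 0.\<close>

lemma iota_ode_reg:
  fixes x :: "(complex, 'n) vec"
  assumes \<phi>: "\<phi> \<in> graded_dual" and x: "x \<in> polydisc"
  shows "x $ k * partial_deriv k (\<iota> \<phi> e) x + of_nat (Suc (e k)) * \<iota> \<phi> (e(k := Suc (e k))) x =
    (\<Sum>i\<in>UNIV. \<iota> (precomp \<phi> (gX \<alpha> (i_pt i))) e x * (if i \<le> k then 1 else 0)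
              + \<iota> (precomp \<phi> (gX (i_pt i) \<beta>)) e x * coeff_b i k x)
    + (\<Sum>(i, j)\<in>{(i, j). i < j}. \<iota> (precomp \<phi> (gX (i_pt i) (i_pt j))) e x * coeff_c i j k x)" (is "?L x = ?R x")
proof -
  note hol = iota_holo[OF graded_dual_precomp[OF \<phi>]] iota_holo[OF \<phi>]
  note cont = hol[THEN continuous_on_holo_polydisc]
  have "(\<lambda>x. ?L x - ?R x) x = 0"
  proof (rule continuous_eq_0_of_nonzero_coords[OF _ _ x])
    show "continuous_on polydisc (\<lambda>x. ?L x - ?R x)"
      unfolding case_prod_unfold
      by (intro continuous_intros cont continuous_on_coeff_b continuous_on_coeff_c continuous_on_partial_deriv[OF hol(2)]) auto
  next
    fix x :: "(complex, 'n) vec" assume x: "x \<in> polydisc" and nz: "\<forall>i. x $ i \<noteq> 0"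
    have "?L x = x $ k * logpoly_deriv k (\<iota> \<phi>) e x"
      using nz by (simp add: logpoly_deriv_def distrib_left fun_upd_def)
    also have "\<dots> = (\<Sum>i\<in>UNIV. \<iota> (precomp \<phi> (gX \<alpha> (i_pt i))) e x * (x $ k * dlog (zc i) k x)
                    + \<iota> (precomp \<phi> (gX (i_pt i) \<beta>)) e x * (x $ k * dlog (\<lambda>y. zc i y - 1) k x))
          + (\<Sum>(i, j)\<in>{(i, j). i < j}.
               \<iota> (precomp \<phi> (gX (i_pt i) (i_pt j))) e x * (x $ k * dlog (\<lambda>y. zc i y - zc j y) k x))"
      unfolding iota_ode[OF \<phi> x nz]
      by (simp add: sum_distrib_left distrib_left case_prod_unfold mult_ac)
    also have "\<dots> = ?R x"
    proof -
      have nz': "x $ i \<noteq> 0" for i using nz by blast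
      show ?thesis
        unfolding dlog_zc[OF x nz'] dlog_zc_1[OF x nz']
        by (intro arg_cong2[of _ _ _ _ "(+)"] refl sum.cong) (auto simp: dlog_zc_diff[OF x nz'])
    qed
    finally show "?L x - ?R x = 0" by simp
  qed
  then show ?thesis by (simp only: right_minus_eq)
qed

lemma iota_ode_last:
  fixes x :: "(complex, 'n) vec"
  assumes \<phi>: "\<phi> \<in> graded_dual" and x: "x \<in> polydisc" and k: "k = Max UNIV"
  shows "x $ k * partial_deriv k (\<iota> \<phi> e) x + of_nat (Suc (e k)) * \<iota> \<phi> (e(k := Suc (e k))) x =
    \<iota> (precomp \<phi> (gX \<beta> \<omega>)) e x - (\<Sum>i\<in>UNIV. \<iota> (precomp \<phi> (gX (i_pt i) \<beta>)) e x * (zc i x / (1 - zc i x)))"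
proof -
  have le: "i \<le> k" for i by (simp add: k)
  let ?P = "{(i, j). i < j} :: ('n \<times> 'n) set"
  have "precomp \<phi> (gX \<beta> \<omega>) = (\<lambda>u. (\<Sum>i\<in>UNIV. precomp \<phi> (gX \<alpha> (i_pt i)) u)
      + (\<Sum>p\<in>?P. (case p of (i, j) \<Rightarrow> precomp \<phi> (gX (i_pt i) (i_pt j))) u))"
    unfolding gX_beta_omega
    by (auto simp: fun_eq_iff precomp_add[OF graded_dualD[OF \<phi>]] precomp_sum[OF graded_dualD[OF \<phi>]] case_prod_unfold)
  then have "\<iota> (precomp \<phi> (gX \<beta> \<omega>)) = (\<lambda>e x. (\<Sum>i\<in>UNIV. \<iota> (precomp \<phi> (gX \<alpha> (i_pt i))) e x)
      + (\<Sum>p\<in>?P. \<iota> (case p of (i, j) \<Rightarrow> precomp \<phi> (gX (i_pt i) (i_pt j))) e x))"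
    using iota_sum[of UNIV "\<lambda>i. precomp \<phi> (gX \<alpha> (i_pt i))"]
      iota_sum[of ?P "\<lambda>(i, j). precomp \<phi> (gX (i_pt i) (i_pt j))"] graded_dual_precomp[OF \<phi>]
    by (auto simp: iota_add)
  then show ?thesis
    unfolding iota_ode_reg[OF \<phi> x] coeff_b_def coeff_c_def using le
    by (simp add: sum.distrib sum_subtractf case_prod_unfold)
qed

text \<open>
  The equation in the direction \<open>x\<^sub>k\<close>, \<open>k < n\<close>, involves only \<open>s(\<pp>\<^sub>m\<^sub>-\<^sub>1)\<close> where \<open>x\<^sub>n = 0\<close>, because the
  forms \<open>dz\<^sub>i / (z\<^sub>i - 1)\<close> vanish there.
\<close>

lemma iota_boundary:
  fixes p :: "'n idx braid_lie \<Rightarrow> 'n base braid_lie" and s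
  assumes p: "is_pi_beta p" and s: "is_section p s"
    and "homogeneous (Suc d) \<phi>" and "\<And>u. u \<in> uea_left_ideal (range s) \<Longrightarrow> \<phi> u = 0"
    and "e (Max UNIV) = 0" and "x \<in> polydisc" and "(x :: (complex, 'n) vec) $ Max UNIV = 0"
  shows "\<iota> \<phi> e x = 0"
  using assms(3-)
proof (induction d arbitrary: \<phi> e x rule: less_induct)
  case (less d)
  let ?n = "Max UNIV :: 'n"
  note hom = less.prems(1) and Us = less.prems(2) and e = less.prems(3) and x = less.prems(4,5)
  note GD = homogeneous_graded_dual[OF hom]
  have pre: "\<iota> (precomp \<phi> (gX a b)) e x = 0" if "gX a b \<in> range s" "e ?n = 0" "x \<in> polydisc" "x $ ?n = 0" for a b e and x :: "(complex, 'n) vec"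
  proof -
    have h: "homogeneous d (precomp \<phi> (gX a b))" by (rule homogeneous_precomp[OF hom])
    have v: "precomp \<phi> (gX a b) u = 0" if "u \<in> uea_left_ideal (range s)" for u
      unfolding precomp_def by (rule Us[OF uea_left_ideal_mult[OF that]])
    show ?thesis
    proof (cases d)
      case 0
      \<comment> \<open>A functional of degree 0 is a multiple of the counit, so its value at 1
        decides; here this is the value of \<open>\<phi>\<close> at an element of the left
        ideal.\<close>
      have "1 * uemb (gX a b) \<in> uea_left_ideal (range s)"
        unfolding uea_left_ideal_def by (rule cvec.span_base) (use that(1) in blast)
      then have "precomp \<phi> (gX a b) 1 = 0" by (simp add: precomp_def Us)
      then have "precomp \<phi> (gX a b) = (\<lambda>_. 0)" using homogeneous_0_eq[of "precomp \<phi> (gX a b)"] h 0 by simp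
      then show ?thesis by (simp add: iota_0)
    next
      case (Suc d')
      then show ?thesis using less.IH[of d' "precomp \<phi> (gX a b)" e x] v that(2-) h by simp
    qed
  qed
  have sa: "gX \<alpha> (i_pt i) \<in> range s" if "i < ?n" for i
    using s that unfolding is_section_def by (metis rangeI)
  have sp: "gX (i_pt i) (i_pt j) \<in> range s" if "i < j" for i j
    using s that unfolding is_section_def by (metis rangeI)
  have ode: "x $ k * partial_deriv k (\<iota> \<phi> e) x + of_nat (Suc (e k)) * \<iota> \<phi> (e(k := Suc (e k))) x = 0"
    if k: "k \<noteq> ?n" and e: "e ?n = 0" and x: "x \<in> polydisc" "x $ ?n = 0" for k e and x :: "(complex, 'n) vec"
  proof -
    have "k < ?n" using k by (simp add: order.not_eq_order_implies_strict)
    have 1: "\<iota> (precomp \<phi> (gX \<alpha> (i_pt i))) e x * (if i \<le> k then 1 else 0) = 0" for i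
      using pre[OF sa, of i e x] e x \<open>k < ?n\<close> by auto
    have 2: "coeff_b i k x = 0" for i by (simp add: coeff_b_def zc_0 x)
    have 3: "\<iota> (precomp \<phi> (gX (i_pt i) (i_pt j))) e x = 0" if "i < j" for i j
      by (rule pre[of _ _ e x, OF sp[OF that] e x])
    show ?thesis
      unfolding iota_ode_reg[OF GD x(1)] 1 2 by (auto simp: 3 intro!: sum.neutral)
  qed
  obtain M where M: "\<And>k e. M \<le> e k \<Longrightarrow> \<iota> \<phi> e = (\<lambda>_. 0)"
    using iota_exponent_bound[OF GD] by blast
  \<comment> \<open>With zero right side, the part free of log x_n, restricted to x_n = 0, contains
    no log x_k and does not depend on x_k.\<close>
  have red: "\<iota> \<phi> e x = (if e k = 0 then \<iota> \<phi> e (upd x k 0) else 0)"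
    if k: "k \<noteq> ?n" and e: "e ?n = 0" and x: "x \<in> polydisc" "x $ ?n = 0" for k e and x :: "(complex, 'n) vec"
  proof -
    have "\<iota> \<phi> (e(k := m)) (upd x k t) = (if m = 0 then \<iota> \<phi> (e(k := 0)) (upd x k 0) else 0)" if "norm t < 1" for m t
    proof (rule logpoly_const_of_deriv_0[where M = M and G = "\<lambda>m t. \<iota> \<phi> (e(k := m)) (upd x k t)", OF _ _ _ that])
      fix m t assume t: "norm (t :: complex) < 1"
      show "((\<lambda>t. \<iota> \<phi> (e(k := m)) (upd x k t)) has_field_derivative partial_deriv k (\<iota> \<phi> (e(k := m))) (upd x k t)) (at t)"
        by (rule polydisc_partial_derivative[OF iota_holo[OF GD] x(1) t])
      show "t * partial_deriv k (\<iota> \<phi> (e(k := m))) (upd x k t) + of_nat (Suc m) * \<iota> \<phi> (e(k := Suc m)) (upd x k t) = 0"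
        using ode[of k "e(k := m)" "upd x k t"] k e x upd_polydisc[OF x(1) t] by (simp add: upd_nth)
      show "\<iota> \<phi> (e(k := m)) (upd x k t) = 0" if "M \<le> m" using M[of "e(k := m)" k] that by simp
    qed
    from this[of "x $ k" "e k"] show ?thesis
      using x by (auto simp: upd_same polydisc_def fun_upd_idem)
  qed
  show "\<iota> \<phi> e x = 0"
  proof (cases "e = (\<lambda>_. 0)")
    case False
    then obtain k where "e k \<noteq> 0" by auto
    then show ?thesis using red[of k e x] e x by (cases "k = ?n") auto
  next
    case True
    \<comment> \<open>The coordinates are moved to 0 one at a time until the origin is reached,
      where the normalisation of \<open>\<iota>\<close> applies.\<close>
    have "finite A \<Longrightarrow> ?n \<notin> A \<Longrightarrow> \<iota> \<phi> e x = \<iota> \<phi> e (\<chi> j. if j \<in> A then 0 else x $ j)" for A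
    proof (induction A rule: finite_induct)
      case (insert k A)
      let ?y = "\<chi> j. if j \<in> A then 0 else x $ j"
      have "\<iota> \<phi> e ?y = \<iota> \<phi> e (upd ?y k 0)"
      proof -
        have "?y \<in> polydisc" "?y $ ?n = 0" "k \<noteq> ?n" using x insert.prems by (auto simp: polydisc_def)
        then show ?thesis using red[of k e ?y] True by simp
      qed
      also have "upd ?y k 0 = (\<chi> j. if j \<in> insert k A then 0 else x $ j)"
        by (auto simp: upd_def vec_eq_iff)
      finally show ?case using insert by simp
    qed simp
    from this[of "UNIV - {?n}"] have "\<iota> \<phi> e x = \<iota> \<phi> e (\<chi> j. if j \<in> UNIV - {?n} then 0 else x $ j)" by simp
    also have "(\<chi> j. if j \<in> UNIV - {?n} then 0 else x $ j) = 0" using x by (auto simp: vec_eq_iff)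
    also have "\<iota> \<phi> e 0 = 0" using iota_base[OF _ hom] True by simp
    finally show ?thesis .
  qed
qed

text \<open>The form attached to a letter on a fibre, relative to dx_n / x_n: dz_i / (z_i - 1) for
  X_i\<beta>, and dx_n / x_n itself for X_\<beta>\<omega>.\<close>

definition letter_form :: "'n letter \<Rightarrow> (complex, 'n) vec \<Rightarrow> complex" where
  "letter_form l x = (case l of XB i \<Rightarrow> - (zc i x / (1 - zc i x)) | XBO \<Rightarrow> 1)"

text \<open>Uniqueness on a fibre: the difference of both sides solves the homogeneous equation in
  x_n, hence has no log x_n and is constant in x_n; at x_n = 0 both sides vanish.\<close>

lemma iota_word_fun_Cons:
  fixes p :: "'n idx braid_lie \<Rightarrow> 'n base braid_lie" and s
  assumes p: "is_pi_beta p" and s: "is_section p s"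
    and M: "\<iota> (word_fun w) = logpoly_const M"
    and K0: "\<And>x. x \<in> polydisc \<Longrightarrow> x $ Max UNIV = 0 \<Longrightarrow> K x = 0"
    and K: "\<And>x. x \<in> polydisc \<Longrightarrow> \<exists>D. ((\<lambda>t. K (upd x (Max UNIV) t)) has_field_derivative D) (at (x $ Max UNIV)) \<and>
        x $ Max UNIV * D = letter_form l x * M x"
  shows "\<iota> (word_fun (l # w)) = logpoly_const K"
proof (intro ext)
  fix e :: "'n \<Rightarrow> nat" and x :: "(complex, 'n) vec"
  let ?n = "Max UNIV :: 'n"
  define \<phi> where "\<phi> = word_fun (l # w)"
  have hom: "homogeneous (Suc (length w)) \<phi>" using homogeneous_word_fun[of "l # w"] by (simp add: \<phi>_def)
  note GD = homogeneous_graded_dual[OF hom]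
  have Us: "\<phi> u = 0" if "u \<in> uea_left_ideal (range s)" for u
    by (simp add: \<phi>_def word_fun_def fiber_proj_Us[OF p s that])
  have pre: "\<iota> (precomp \<phi> (letter_val l')) = (if l = l' then logpoly_const M else (\<lambda>e x. 0))" for l'
    by (simp add: \<phi>_def precomp_word_fun M iota_0)
  have ode: "x $ ?n * partial_deriv ?n (\<iota> \<phi> e) x + of_nat (Suc (e ?n)) * \<iota> \<phi> (e(?n := Suc (e ?n))) x
      = letter_form l x * logpoly_const M e x" if "x \<in> polydisc" for e x
  proof -
    have "\<iota> (precomp \<phi> (gX \<beta> \<omega>)) e x - (\<Sum>i\<in>UNIV. \<iota> (precomp \<phi> (gX (i_pt i) \<beta>)) e x * (zc i x / (1 - zc i x)))
      = letter_form l x * logpoly_const M e x"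
      using pre[of XBO] pre[of "XB _"]
      by (cases l) (simp_all add: letter_form_def if_distrib[of "\<lambda>f. f e x * _"] if_distrib[of "\<lambda>z. z / _"] cong: if_cong)
    then show ?thesis using iota_ode_last[OF GD that refl, of e] by simp
  qed
  show "\<iota> (word_fun (l # w)) e x = logpoly_const K e x"
  proof (cases "x \<in> polydisc")
    case False
    then have "\<iota> \<phi> e x = 0" using iota_holo[OF GD, of e] by (simp add: holo_polydisc_def)
    then show ?thesis using False by (simp add: \<phi>_def logpoly_const_def)
  next
    case x: True
    obtain M0 where M0: "\<And>k e. M0 \<le> e k \<Longrightarrow> \<iota> \<phi> e = (\<lambda>_. 0)"
      using iota_exponent_bound[OF GD] by blast
    have "\<exists>D. ((\<lambda>t. K (upd x ?n t)) has_field_derivative D) (at t) \<and>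
        t * D = letter_form l (upd x ?n t) * M (upd x ?n t)" if "norm t < 1" for t
      using K[OF upd_polydisc[OF x that], of ?n] by (simp add: upd_upd upd_nth)
    then obtain D where D: "\<And>t. norm t < 1 \<Longrightarrow> ((\<lambda>t. K (upd x ?n t)) has_field_derivative D t) (at t) \<and>
        t * D t = letter_form l (upd x ?n t) * M (upd x ?n t)"
      by metis
    define E where "E m = e(?n := m)" for m
    have E_0: "E m = (\<lambda>_. 0) \<longleftrightarrow> m = 0 \<and> E 0 = (\<lambda>_. 0)" for m
      by (auto simp: E_def fun_eq_iff)
    define G where "G m t = \<iota> \<phi> (E m) (upd x ?n t) - logpoly_const K (E m) (upd x ?n t)" for m t
    define G' where "G' m t = partial_deriv ?n (\<iota> \<phi> (E m)) (upd x ?n t) - (if E m = (\<lambda>_. 0) then D t else 0)" for m t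
    have "G (e ?n) (x $ ?n) = (if e ?n = 0 then G 0 0 else 0)"
    \<comment> \<open>The bound is \<open>M0\<close> plus one, so the indices beyond it are positive
      and the side without logarithms contributes nothing there.\<close>
    proof (rule logpoly_const_of_deriv_0[where G = G and G' = G' and M = "Suc M0"])
      show "norm (x $ ?n) < 1" using x by (simp add: polydisc_def)
    next
      fix m t assume t: "norm (t :: complex) < 1"
      have "((\<lambda>t. logpoly_const K (E m) (upd x ?n t)) has_field_derivative (if E m = (\<lambda>_. 0) then D t else 0)) (at t)"
      proof (cases "E m = (\<lambda>_. 0)")
        case True
        show ?thesis
          by (rule has_field_derivative_transform_within_open[of "\<lambda>t. K (upd x ?n t)" _ _ "ball 0 1"])
            (use D[OF t] True t upd_polydisc[OF x] in \<open>auto simp: logpoly_const_def\<close>)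
      qed (simp add: logpoly_const_def)
      then show "(G m has_field_derivative G' m t) (at t)"
        unfolding G_def G'_def
        by (intro DERIV_diff polydisc_partial_derivative[OF iota_holo[OF GD] x t])
      have A: "t * partial_deriv ?n (\<iota> \<phi> (E m)) (upd x ?n t) + of_nat (Suc m) * \<iota> \<phi> (E (Suc m)) (upd x ?n t)
          = letter_form l (upd x ?n t) * logpoly_const M (E m) (upd x ?n t)"
        using ode[where e = "E m", OF upd_polydisc[OF x t, of ?n]] by (simp add: upd_nth E_def)
      have B: "t * (if E m = (\<lambda>_. 0) then D t else 0) = letter_form l (upd x ?n t) * logpoly_const M (E m) (upd x ?n t)"
        using D[OF t] upd_polydisc[OF x t] by (simp add: logpoly_const_def)
      have C: "logpoly_const K (E (Suc m)) y = 0" for y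
        using E_0[of "Suc m"] by (simp add: logpoly_const_def)
      show "t * G' m t + of_nat (Suc m) * G (Suc m) t = 0"
        unfolding G_def G'_def right_diff_distrib B C A[symmetric] by simp
    next
      fix m t assume m: "Suc M0 \<le> m" and "norm (t :: complex) < 1"
      have "\<iota> \<phi> (E m) = (\<lambda>_. 0)" by (rule M0[of _ ?n]) (use m in \<open>simp add: E_def\<close>)
      moreover have "logpoly_const K (E m) y = 0" for y
        using E_0[of m] m by (simp add: logpoly_const_def)
      ultimately show "G m t = 0" by (simp add: G_def)
    qed
    moreover have "G 0 0 = 0"
    proof -
      have y: "upd x ?n 0 \<in> polydisc" by (rule upd_polydisc[OF x]) simp
      have "\<iota> \<phi> (E 0) (upd x ?n 0) = 0"
        by (rule iota_boundary[OF p s hom Us _ y]) (simp_all add: E_def upd_nth)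
      moreover have "K (upd x ?n 0) = 0" by (rule K0[OF y]) (simp add: upd_nth)
      ultimately show ?thesis by (simp add: G_def logpoly_const_def)
    qed
    moreover have "E (e ?n) = e" by (simp add: E_def)
    ultimately show ?thesis by (simp add: G_def upd_same \<phi>_def split: if_splits)
  qed
qed

section \<open>Polylogarithms as values of the iterated integral map\<close>

lemma polylog_word_0: "polylog_word 0 a \<kappa> = []"
  by (simp add: polylog_word_def)

lemma polylog_word_Suc:
  "polylog_word (Suc N) a \<kappa> = replicate (a (Suc N) - 1) XBO @ XB (\<kappa> (Suc N)) # polylog_word N a \<kappa>"
  by (simp add: polylog_word_def)

lemma polylog_word_cong:
  "(\<And>i. i \<in> {1..N} \<Longrightarrow> a i = b i) \<Longrightarrow> polylog_word N a \<kappa> = polylog_word N b \<kappa>"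
  unfolding polylog_word_def by (intro arg_cong[of _ _ concat] map_cong) auto

text \<open>The outer induction adds an index, the inner one raises its exponent; each inner case
  prepends one letter. The sign changes exactly when a letter X_i\<beta> is added, because its form
  is -dz_i / (1 - z_i).\<close>

lemma iota_polylog:
  fixes p :: "'n idx braid_lie \<Rightarrow> 'n base braid_lie" and s
  assumes p: "is_pi_beta p" and s: "is_section p s"
    and "\<forall>i\<in>{1..N}. 1 \<le> a i" and "mono_on {1..N} \<kappa>"
  shows "\<iota> (word_fun (polylog_word N a \<kappa>)) = logpoly_const (\<lambda>x. (- 1) ^ N * polylog N a \<kappa> x)"
  using assms(3,4)
proof (induction N arbitrary: a)
  case 0
  then show ?case by (simp add: polylog_word_0 word_fun_Nil iota_counit polylog_0)
next
  case (Suc N)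
  have IH: "\<iota> (word_fun (polylog_word N a \<kappa>)) = logpoly_const (\<lambda>x. (- 1) ^ N * polylog N a \<kappa> x)"
    using Suc.prems by (intro Suc.IH) (auto simp: mono_on_def)
  obtain b where "a (Suc N) = Suc b" using bspec[OF Suc.prems(1), of "Suc N"] by (cases "a (Suc N)") auto
  then show ?case using Suc.prems(1) IH
  proof (induction b arbitrary: a)
    case (0 a)
    have w: "polylog_word (Suc N) a \<kappa> = XB (\<kappa> (Suc N)) # polylog_word N a \<kappa>"
      using 0 by (simp add: polylog_word_Suc)
    show ?case
      unfolding w
    proof (rule iota_word_fun_Cons[OF p s 0(3)])
      fix x :: "(complex, 'n) vec" assume x: "x \<in> polydisc"
      show "(- 1) ^ Suc N * polylog (Suc N) a \<kappa> x = 0" if "x $ Max UNIV = 0"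
        using polylog_boundary[of x a N, OF x _ that] 0 by simp
      from polylog_deriv[OF x _ Suc.prems(2), of a] 0
      obtain D where D: "((\<lambda>t. polylog (Suc N) a \<kappa> (upd x (Max UNIV) t)) has_field_derivative D) (at (x $ Max UNIV))"
        "x $ Max UNIV * D = zc (\<kappa> (Suc N)) x / (1 - zc (\<kappa> (Suc N)) x) * polylog N a \<kappa> x"
        by auto
      show "\<exists>D. ((\<lambda>t. (- 1) ^ Suc N * polylog (Suc N) a \<kappa> (upd x (Max UNIV) t)) has_field_derivative D) (at (x $ Max UNIV)) \<and>
          x $ Max UNIV * D = letter_form (XB (\<kappa> (Suc N))) x * ((- 1) ^ N * polylog N a \<kappa> x)"
      proof (intro exI conjI)
        show "x $ Max UNIV * ((- 1) ^ Suc N * D) = letter_form (XB (\<kappa> (Suc N))) x * ((- 1) ^ N * polylog N a \<kappa> x)"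
          by (subst mult.left_commute, subst D(2)) (simp add: letter_form_def)
      qed (rule DERIV_cmult[OF D(1)])
    qed
  next
    case (Suc b a)
    let ?a = "a(Suc N := Suc b)"
    have w: "polylog_word (Suc N) a \<kappa> = XBO # polylog_word (Suc N) ?a \<kappa>"
      using Suc.prems polylog_word_cong[of N a ?a \<kappa>] by (simp add: polylog_word_Suc)
    have eqs: "polylog N ?a \<kappa> = polylog N a \<kappa>" "polylog_word N ?a \<kappa> = polylog_word N a \<kappa>"
      using polylog_word_cong[of N ?a a \<kappa>]
      unfolding polylog_def fun_eq_iff by (auto intro!: infsum_cong prod.cong)
    have "\<iota> (word_fun (polylog_word (Suc N) ?a \<kappa>)) = logpoly_const (\<lambda>x. (- 1) ^ Suc N * polylog (Suc N) ?a \<kappa> x)"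
    proof (rule Suc.IH)
      show "\<iota> (word_fun (polylog_word N ?a \<kappa>)) = logpoly_const (\<lambda>x. (- 1) ^ N * polylog N ?a \<kappa> x)"
        using Suc.prems(3) by (simp only: eqs)
    qed (use Suc.prems in auto)
    then show ?case
      unfolding w
    proof (rule iota_word_fun_Cons[OF p s])
      fix x :: "(complex, 'n) vec" assume x: "x \<in> polydisc"
      show "(- 1) ^ Suc N * polylog (Suc N) a \<kappa> x = 0" if "x $ Max UNIV = 0"
        using polylog_boundary[of x a N, OF x _ that] Suc.prems by simp
      from polylog_deriv[OF x _ \<open>mono_on {1..Suc N} \<kappa>\<close>, of a] Suc.prems
      obtain D where D: "((\<lambda>t. polylog (Suc N) a \<kappa> (upd x (Max UNIV) t)) has_field_derivative D) (at (x $ Max UNIV))"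
        "x $ Max UNIV * D = polylog (Suc N) ?a \<kappa> x"
        by auto
      show "\<exists>D. ((\<lambda>t. (- 1) ^ Suc N * polylog (Suc N) a \<kappa> (upd x (Max UNIV) t)) has_field_derivative D) (at (x $ Max UNIV)) \<and>
          x $ Max UNIV * D = letter_form XBO x * ((- 1) ^ Suc N * polylog (Suc N) ?a \<kappa> x)"
      proof (intro exI conjI)
        show "x $ Max UNIV * ((- 1) ^ Suc N * D) = letter_form XBO x * ((- 1) ^ Suc N * polylog (Suc N) ?a \<kappa> x)"
          by (subst mult.left_commute, subst D(2)) (simp add: letter_form_def)
      qed (rule DERIV_cmult[OF D(1)])
    qed
  qed
qed

end

section \<open>Restriction to a generic line\<close>

definition gen_pairs :: "('n::{finite,linorder} idx \<times> 'n idx) set" where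
  "gen_pairs = range (\<lambda>i. (\<alpha>, i_pt i)) \<union> range (\<lambda>i. (i_pt i, \<beta>)) \<union> {(i_pt i, i_pt j) | i j. i < j}"

lemma finite_gen_pairs: "finite gen_pairs"
  by (rule finite_subset[of _ UNIV]) auto

lemma sum_gen_pairs:
  "(\<Sum>p\<in>gen_pairs. f p) = (\<Sum>i\<in>UNIV. f (\<alpha>, i_pt i) + f (i_pt i, \<beta>))
     + (\<Sum>(i, j)\<in>{(i, j). i < j}. f (i_pt i, i_pt (j :: 'n::{finite,linorder})))"
  for f :: "'n::{finite,linorder} idx \<times> 'n idx \<Rightarrow> 'a::comm_monoid_add"
proof -
  have 1: "(\<Sum>p\<in>range (\<lambda>i. (\<alpha>, i_pt i)). f p) = (\<Sum>i\<in>UNIV. f (\<alpha>, i_pt i))"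
    by (subst sum.reindex) (auto simp: inj_def)
  have 2: "(\<Sum>p\<in>range (\<lambda>i. (i_pt i, \<beta>)). f p) = (\<Sum>i\<in>UNIV. f (i_pt i, \<beta>))"
    by (subst sum.reindex) (auto simp: inj_def)
  have "{(i_pt i, i_pt j) | i j. i < j} = (\<lambda>(i, j). (i_pt i, i_pt j)) ` {(i, j :: 'n). i < j}" by auto
  moreover have "inj_on (\<lambda>(i, j). (i_pt i, i_pt j)) {(i, j :: 'n). i < j}" by (auto simp: inj_on_def)
  ultimately have 3: "(\<Sum>p\<in>{(i_pt i, i_pt j) | i j. i < j}. f p) = (\<Sum>(i, j)\<in>{(i, j). i < j}. f (i_pt i, i_pt j))"
    by (simp add: sum.reindex case_prod_unfold)
  show ?thesis
    unfolding gen_pairs_def 1[symmetric] 2[symmetric] 3[symmetric] sum.distrib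
    by (subst sum.union_disjoint; (subst sum.union_disjoint)?) (auto simp: finite_subset[of _ UNIV])
qed

text \<open>The relations are solved successively for X_\<beta>\<omega>, X_\<alpha>\<beta>,
  X_\<alpha>\<omega> and X_i\<omega>. It follows that a functional is controlled by the generators
  whose forms occur in the differential equation.\<close>

lemma gX_span: "gX a b \<in> cvec.span ((\<lambda>(a, b). gX a b) ` gen_pairs)" (is "_ \<in> ?V")
proof -
  have ai: "gX \<alpha> (i_pt i) \<in> ?V" and ib: "gX (i_pt i) \<beta> \<in> ?V" for i :: 'a
    by (rule cvec.span_base; force simp: gen_pairs_def)+
  have lt: "gX (i_pt i) (i_pt j) \<in> ?V" if "i < j" for i j :: 'a
    by (rule cvec.span_base) (use that in \<open>force simp: gen_pairs_def\<close>)
  have ij: "gX (i_pt i) (i_pt j) \<in> ?V" for i j :: 'a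
    using lt[of i j] lt[of j i] gX_sym[of "i_pt i" "i_pt j"]
    by (cases i j rule: linorder_cases) (auto simp: gX_diag cvec.span_zero)
  have bo: "gX \<beta> \<omega> \<in> ?V"
    unfolding gX_beta_omega by (intro cvec.span_add cvec.span_sum) (auto simp: ai ij)
  have neg: "x \<in> ?V" if "x + y = 0" "y \<in> ?V" for x y
    using that cvec.span_neg by (metis eq_neg_iff_add_eq_0)
  have ab: "gX \<alpha> \<beta> \<in> ?V"
  proof (rule neg)
    show "gX \<alpha> \<beta> + (gX \<beta> \<omega> + (\<Sum>i\<in>UNIV. gX (i_pt (i :: 'a)) \<beta>)) = 0"
      using sum_gX[of "\<beta> :: 'a idx"]
      by (simp add: sum_idx sum_base gX_diag gX_sym[of \<beta> \<alpha>] gX_sym[of \<beta> "i_pt _"] add.assoc)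
  qed (intro cvec.span_add cvec.span_sum bo ib)
  have ao: "gX \<alpha> \<omega> \<in> ?V"
  proof (rule neg)
    show "gX \<alpha> \<omega> + (gX \<alpha> \<beta> + (\<Sum>i\<in>UNIV. gX \<alpha> (i_pt (i :: 'a)))) = 0"
      using sum_gX[of "\<alpha> :: 'a idx"] by (simp add: sum_idx sum_base gX_diag ac_simps)
  qed (intro cvec.span_add cvec.span_sum ab ai)
  have io: "gX (i_pt i) \<omega> \<in> ?V" for i :: 'a
  proof (rule neg)
    show "gX (i_pt i) \<omega> + (gX (i_pt i) \<beta> + (gX \<alpha> (i_pt i) + (\<Sum>j\<in>UNIV. gX (i_pt i) (i_pt j)))) = 0"
      using sum_gX[of "i_pt i"] by (simp add: sum_idx sum_base gX_sym[of "i_pt i" \<alpha>] ac_simps)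
  qed (intro cvec.span_add cvec.span_sum ib ai ij)
  have *: "a = \<beta> \<or> a = \<alpha> \<or> a = \<omega> \<or> (\<exists>i. a = i_pt i)" for a :: "'a idx"
    by (metis base.exhaust idx.exhaust)
  have z: "gX a a \<in> ?V" for a by (simp add: gX_diag cvec.span_zero)
  have sym: "gX b a \<in> ?V" if "gX a b \<in> ?V" for a b
    using that by (subst gX_sym)
  show ?thesis
    using *[of a] *[of b]
    by (elim disjE exE; simp add: ai ib ij bo ab ao io z ai[THEN sym] ib[THEN sym] bo[THEN sym] ab[THEN sym] ao[THEN sym] io[THEN sym])
qed

text \<open>Given d for the old functionals and e for the new one, every functional is a nonzero
  polynomial of degree at most one in t on the line d + t e, so only finitely many t are
  excluded.\<close>

lemma avoid_finitely_many_hyperplanes: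
  fixes L :: "(('n \<Rightarrow> complex) \<Rightarrow> complex) set"
  assumes "finite L"
    and "\<And>\<Psi> x y t. \<Psi> \<in> L \<Longrightarrow> \<Psi> (\<lambda>i. x i + t * y i) = \<Psi> x + t * \<Psi> y"
    and "\<And>\<Psi>. \<Psi> \<in> L \<Longrightarrow> \<exists>d. \<Psi> d \<noteq> 0"
  shows "\<exists>d. \<forall>\<Psi>\<in>L. \<Psi> d \<noteq> 0"
  using assms
proof (induction L rule: finite_induct)
  case (insert \<Psi>0 L)
  have "\<exists>d. \<forall>\<Psi>\<in>L. \<Psi> d \<noteq> 0"
    by (rule insert.IH) (rule insert.prems[OF insertI2], assumption)+
  then obtain d where d: "\<forall>\<Psi>\<in>L. \<Psi> d \<noteq> 0" by blast
  obtain e where e: "\<Psi>0 e \<noteq> 0" using insert.prems(2) by blast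
  have "finite ((\<lambda>\<Psi>. - \<Psi> d / \<Psi> e) ` insert \<Psi>0 L)" using insert.hyps by blast
  then obtain t where t: "t \<notin> (\<lambda>\<Psi>. - \<Psi> d / \<Psi> e) ` insert \<Psi>0 L"
    using ex_new_if_finite[OF infinite_UNIV_char_0] by blast
  have "\<Psi> (\<lambda>i. d i + t * e i) \<noteq> 0" if \<Psi>: "\<Psi> \<in> insert \<Psi>0 L" for \<Psi>
  proof -
    have "\<Psi> d + t * \<Psi> e \<noteq> 0"
    proof (cases "\<Psi> e = 0")
      case True
      then show ?thesis using e d \<Psi> by auto
    next
      case False
      have "t \<noteq> - \<Psi> d / \<Psi> e" using t \<Psi> by blast
      then show ?thesis using False by (auto simp: field_simps eq_neg_iff_add_eq_0 add.commute)
    qed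
    then show ?thesis using insert.prems(1)[OF \<Psi>] by simp
  qed
  then show ?case by blast
qed simp

text \<open>Strictly increasing real values in (0, 1); the quotients of consecutive values then give
  a starting point with coordinates in (0, 1), inside the polydisc and off the branch cut of the
  logarithm.\<close>

definition line_start :: "'n::{finite,linorder} \<Rightarrow> real" where
  "line_start i = real (card {..i}) / real (Suc (card (UNIV :: 'n set)))"

lemma line_start_pos: "0 < line_start i"
  by (auto simp: line_start_def card_gt_0_iff)

lemma line_start_less_1: "line_start i < 1"
proof -
  have "card {..i} \<le> card (UNIV :: 'a set)" by (rule card_mono) auto
  then show ?thesis by (simp add: line_start_def)
qed

lemma line_start_mono: "i < j \<Longrightarrow> line_start i < line_start j"
  unfolding line_start_def by (intro divide_strict_right_mono) (auto intro!: psubset_card_mono)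

text \<open>
  The line is \<open>z\<^sub>i = start i + t * slope i\<close>, with the constants \<open>z\<^sub>\<alpha> = 0\<close> and \<open>z\<^sub>\<beta> = 1\<close>; the values at
  \<open>\<omega>\<close> are never used. The form of \<open>X\<^sub>a\<^sub>b\<close> is the logarithmic derivative of \<open>z\<^sub>a - z\<^sub>b\<close>.
\<close>

primrec start_base :: "'n::{finite,linorder} base \<Rightarrow> complex" where
  "start_base Alpha = 0" | "start_base (Pt i) = of_real (line_start i)" | "start_base Omega = 0"

primrec start :: "'n::{finite,linorder} idx \<Rightarrow> complex" where
  "start Beta = 1" | "start (Nb v) = start_base v"

primrec slope_base :: "('n \<Rightarrow> complex) \<Rightarrow> 'n base \<Rightarrow> complex" where
  "slope_base d Alpha = 0" | "slope_base d (Pt i) = d i" | "slope_base d Omega = 0"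

primrec slope :: "('n \<Rightarrow> complex) \<Rightarrow> 'n idx \<Rightarrow> complex" where
  "slope d Beta = 0" | "slope d (Nb v) = slope_base d v"

text \<open>The parameter at which z_a - z_b vanishes on the line.\<close>

definition pole :: "('n::{finite,linorder} \<Rightarrow> complex) \<Rightarrow> 'n idx \<times> 'n idx \<Rightarrow> complex" where
  "pole d p = - (start (fst p) - start (snd p)) / (slope d (fst p) - slope d (snd p))"

lemma start_neq: "(a, b) \<in> gen_pairs \<Longrightarrow> start a \<noteq> start b"
proof -
  have "line_start i \<noteq> 0" "line_start i \<noteq> 1" for i :: 'a using line_start_pos[of i] line_start_less_1[of i] by auto
  moreover have "i < j \<Longrightarrow> line_start i \<noteq> line_start j" for i j :: 'a using line_start_mono[of i j] by auto
  ultimately show "(a, b) \<in> gen_pairs \<Longrightarrow> start a \<noteq> start b"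
    by (auto simp: gen_pairs_def of_real_eq_1_iff) 
qed

definition unit_slope :: "'n \<Rightarrow> 'n \<Rightarrow> complex" where
  "unit_slope k i = (if i = k then 1 else 0)"

lemma slope_unit: "slope (unit_slope k) v = (if v = i_pt k then 1 else 0)"
proof (cases v)
  case (Nb w) then show ?thesis by (cases w) (auto simp: unit_slope_def)
qed simp

lemma slope_linear: "slope (\<lambda>i. x i + t * y i) v = slope x v + t * slope y v"
proof (cases v)
  case (Nb w) then show ?thesis by (cases w) auto
qed simp

text \<open>\<open>A p\<close> nonzero means that the form of p has a pole on the line, and
  \<open>B p q\<close> nonzero is the condition that two poles differ, cleared of denominators. Both
  are linear in the slopes, so it suffices that none of them is identically zero.\<close>

lemma generic_slopes_exist:
  "\<exists>d :: 'n::{finite,linorder} \<Rightarrow> complex. (\<forall>p\<in>gen_pairs. slope d (fst p) \<noteq> slope d (snd p)) \<and> inj_on (pole d) gen_pairs"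
proof -
  define A where "A p d = slope d (fst p) - slope d (snd p)" for p :: "'n idx \<times> 'n idx" and d
  define c where "c p = start (fst p) - start (snd p)" for p :: "'n idx \<times> 'n idx"
  define B where "B p q d = c p * A q d - c q * A p d" for p q d
  have c0: "c p \<noteq> 0" if "p \<in> gen_pairs" for p
    using start_neq[of "fst p" "snd p"] that by (simp add: c_def)
  have neq: "fst p \<noteq> snd p" if "p \<in> gen_pairs" for p :: "'n idx \<times> 'n idx"
    using that by (auto simp: gen_pairs_def)
  have A1: "A p (unit_slope k) \<noteq> 0" if "p \<in> gen_pairs" "i_pt k = fst p \<or> i_pt k = snd p" for p k
  proof -
    have "(fst p = i_pt k) \<noteq> (snd p = i_pt k)" using neq[OF that(1)] that(2) by metis
    then show ?thesis by (cases "fst p = i_pt k") (simp_all add: A_def slope_unit unit_slope_def)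
  qed
  have A0: "A p (unit_slope k) = 0" if "i_pt k \<noteq> fst p" "i_pt k \<noteq> snd p" for p k
    using that[symmetric] by (simp add: A_def slope_unit)
  have A_ex: "\<exists>d. A p d \<noteq> 0" if "p \<in> gen_pairs" for p
  proof -
    have "\<exists>k. i_pt k = fst p \<or> i_pt k = snd p" using that unfolding gen_pairs_def by force
    then obtain k where "i_pt k = fst p \<or> i_pt k = snd p" by blast
    then show ?thesis using A1[OF that] by blast
  qed
  have B_diff: "B p q (unit_slope k) \<noteq> 0"
    if "p \<in> gen_pairs" "q \<in> gen_pairs" "i_pt k \<noteq> fst p" "i_pt k \<noteq> snd p" "i_pt k = fst q \<or> i_pt k = snd q" for p q k
    using A0[OF that(3,4)] A1[OF that(2,5)] c0[OF that(1)] by (simp add: B_def)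
  have B_swap: "B p q d = - B q p d" for p q d by (simp add: B_def)
  have B_ex: "\<exists>d. B p q d \<noteq> 0" if pq: "p \<in> gen_pairs" "q \<in> gen_pairs" "p \<noteq> q" for p q
  proof -
    \<comment> \<open>A point lying in only one of the pairs separates them by moving that point
      alone. Otherwise the pairs are (\<alpha>, k) and (k, \<beta>), and they are separated by the
      distinct constants 0 and 1.\<close>
    consider k where "i_pt k \<noteq> fst p" "i_pt k \<noteq> snd p" "i_pt k = fst q \<or> i_pt k = snd q"
      | k where "i_pt k \<noteq> fst q" "i_pt k \<noteq> snd q" "i_pt k = fst p \<or> i_pt k = snd p"
      | k where "p = (\<alpha>, i_pt k)" "q = (i_pt k, \<beta>)"
      | k where "q = (\<alpha>, i_pt k)" "p = (i_pt k, \<beta>)"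
    proof -
      have "(\<exists>k. i_pt k \<noteq> fst p \<and> i_pt k \<noteq> snd p \<and> (i_pt k = fst q \<or> i_pt k = snd q))
        \<or> (\<exists>k. i_pt k \<noteq> fst q \<and> i_pt k \<noteq> snd q \<and> (i_pt k = fst p \<or> i_pt k = snd p))
        \<or> (\<exists>k. p = (\<alpha>, i_pt k) \<and> q = (i_pt k, \<beta>)) \<or> (\<exists>k. q = (\<alpha>, i_pt k) \<and> p = (i_pt k, \<beta>))"
      proof -
        have form: "(\<exists>i. r = (\<alpha>, i_pt i)) \<or> (\<exists>i. r = (i_pt i, \<beta>)) \<or> (\<exists>i j. r = (i_pt i, i_pt j) \<and> i < j)"
          if "r \<in> gen_pairs" for r :: "'n idx \<times> 'n idx"
          using that unfolding gen_pairs_def by blast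
        show ?thesis
          using form[OF pq(1)] form[OF pq(2)] pq(3)
          by (elim disjE exE conjE; simp) (metis order.asym order.irrefl)+
      qed
      then show ?thesis using that by blast
    qed
    then show ?thesis
    proof cases
      case 1
      then show ?thesis using B_diff[OF pq(1,2)] by blast
    next
      case 2
      then show ?thesis using B_diff[OF pq(2,1)] B_swap[of p q] by (metis neg_equal_0_iff_equal)
    next
      case 3
      have "B p q (unit_slope k) = - 1" by (simp add: 3 B_def A_def c_def slope_unit unit_slope_def)
      then show ?thesis by (metis neg_equal_0_iff_equal zero_neq_one)
    next
      case 4
      have "B p q (unit_slope k) = 1" by (simp add: 4 B_def A_def c_def slope_unit unit_slope_def)
      then show ?thesis by (metis zero_neq_one)
    qed
  qed
  define L where "L = A ` gen_pairs \<union> (\<lambda>r. B (fst r) (snd r)) ` {r \<in> gen_pairs \<times> gen_pairs. fst r \<noteq> snd r}"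
  have "\<exists>d. \<forall>\<Psi>\<in>L. \<Psi> d \<noteq> 0"
  proof (rule avoid_finitely_many_hyperplanes)
    show "finite L"
      unfolding L_def by (intro finite_UnI finite_imageI finite_gen_pairs finite_Collect_conjI disjI1 finite_SigmaI) (simp add: finite_gen_pairs)
    show "\<Psi> (\<lambda>i. x i + t * y i) = \<Psi> x + t * \<Psi> y" if "\<Psi> \<in> L" for \<Psi> x y t
      using that by (auto simp: L_def A_def B_def slope_linear algebra_simps)
    show "\<exists>d. \<Psi> d \<noteq> 0" if "\<Psi> \<in> L" for \<Psi>
    proof -
      have "(\<exists>p\<in>gen_pairs. \<Psi> = A p) \<or> (\<exists>p\<in>gen_pairs. \<exists>q\<in>gen_pairs. p \<noteq> q \<and> \<Psi> = B p q)"
        using that unfolding L_def by (elim UnE imageE) force+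
      then show ?thesis
        by (elim disjE bexE conjE) (simp_all only: A_ex B_ex not_False_eq_True)
    qed
  qed
  then obtain d where d: "\<forall>\<Psi>\<in>L. \<Psi> d \<noteq> 0" by blast
  then have Ad: "A p d \<noteq> 0" if "p \<in> gen_pairs" for p using that by (auto simp: L_def)
  have "inj_on (pole d) gen_pairs"
  proof (rule inj_onI, rule ccontr)
    fix p q assume pq: "p \<in> gen_pairs" "q \<in> gen_pairs" "pole d p = pole d q" "p \<noteq> q"
    have "B p q \<in> L" unfolding L_def using pq by (intro UnI2 image_eqI[of _ _ "(p, q)"]) auto
    then have "B p q d \<noteq> 0" using d by blast
    moreover have "c p / A p d = c q / A q d" 
      using pq(3) by (simp only: pole_def flip: c_def A_def) simp
    ultimately show False using Ad[OF pq(1)] Ad[OF pq(2)] by (simp add: B_def field_simps)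
  qed
  then show ?thesis using Ad by (intro exI[of _ d]) (auto simp: A_def)
qed

definition nxt :: "'n::{finite,linorder} \<Rightarrow> 'n" where "nxt k = Min {k<..}"

lemma nxt:
  assumes "k \<noteq> Max UNIV"
  shows "k < nxt k" and "{k..} = insert k {nxt k..}"
proof -
  have "k < Max UNIV" using assms by (simp add: order.not_eq_order_implies_strict)
  then have ne: "{k<..} \<noteq> {}" by blast
  show 1: "k < nxt k" using Min_in[OF _ ne] by (simp add: nxt_def)
  have "nxt k \<le> j" if "k < j" for j using that by (simp add: nxt_def)
  then show "{k..} = insert k {nxt k..}" using 1 by (auto simp: le_less)
qed

definition line_z :: "('n::{finite,linorder} \<Rightarrow> complex) \<Rightarrow> 'n \<Rightarrow> complex \<Rightarrow> complex" where
  "line_z d i t = of_real (line_start i) + d i * t"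

text \<open>The inverse of the change of coordinates from x to z, applied to the line.\<close>

definition line_pt :: "('n::{finite,linorder} \<Rightarrow> complex) \<Rightarrow> complex \<Rightarrow> (complex, 'n) vec" where
  "line_pt d t = (\<chi> k. if k = Max UNIV then line_z d k t else line_z d k t / line_z d (nxt k) t)"

lemma zc_line_pt:
  assumes "\<And>i. line_z d i t \<noteq> 0"
  shows "zc i (line_pt d t) = line_z d i t"
proof (induction "card {i..}" arbitrary: i rule: less_induct)
  case less
  show ?case
  proof (cases "i = Max UNIV")
    case True
    have "{i..} = {i}" using True by (auto intro: antisym)
    then show ?thesis using True by (simp add: zc_def line_pt_def)
  next
    case False
    have "{nxt i..} \<subset> {i..}" using nxt[OF False] by auto
    then have IH: "zc (nxt i) (line_pt d t) = line_z d (nxt i) t"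
      by (intro less) (auto intro: psubset_card_mono)
    have "zc i (line_pt d t) = line_pt d t $ i * zc (nxt i) (line_pt d t)"
      unfolding zc_def nxt(2)[OF False] using nxt(1)[OF False] by simp
    moreover have "line_pt d t $ i = line_z d i t / line_z d (nxt i) t"
      using False by (simp add: line_pt_def)
    ultimately show ?thesis using assms by (simp add: IH)
  qed
qed

text \<open>At t = 0 all x_k are real numbers in (0, 1). Nearby they stay in the unit disc and in
  the right half-plane, where the principal logarithm is holomorphic.\<close>

lemma line_pt_nhd:
  "\<exists>r>0. \<forall>t\<in>ball 0 r. \<forall>k. norm (line_pt d t $ k) < 1 \<and> Re (line_pt d t $ k) > 0 \<and> line_z d k t \<noteq> 0"
proof -
  have cz: "isCont (line_z d k) 0" for k unfolding line_z_def by (intro continuous_intros)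
  have z0: "line_z d k 0 = of_real (line_start k)" for k by (simp add: line_z_def)
  have z0n: "line_z d k 0 \<noteq> 0" for k using line_start_pos[of k] by (simp add: z0)
  have c: "isCont (\<lambda>t. line_pt d t $ k) 0" for k
    by (cases "k = Max UNIV") (auto simp: line_pt_def z0n intro!: continuous_intros cz)
  have x0: "\<exists>u::real. line_pt d 0 $ k = of_real u \<and> 0 < u \<and> u < 1" for k
  proof (cases "k = Max UNIV")
    case True
    then show ?thesis using line_start_pos[of k] line_start_less_1[of k] by (auto simp: line_pt_def z0)
  next
    case False
    then have "line_pt d 0 $ k = of_real (line_start k / line_start (nxt k))" by (simp add: line_pt_def z0)
    moreover have "line_start k / line_start (nxt k) < 1" "0 < line_start k / line_start (nxt k)"
      using line_start_mono[OF nxt(1)[OF False]] line_start_pos[of k] by auto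
    ultimately show ?thesis by blast
  qed
  have "\<forall>\<^sub>F t in nhds 0. norm (line_pt d t $ k) < 1 \<and> Re (line_pt d t $ k) > 0 \<and> line_z d k t \<noteq> 0" for k
  proof -
    have o: "open {w. cmod w < 1 \<and> Re w > 0}"
      by (intro open_Collect_conj open_Collect_less continuous_intros)
    have m: "line_pt d 0 $ k \<in> {w. cmod w < 1 \<and> Re w > 0}" using x0[of k] by auto
    have "((\<lambda>t. line_pt d t $ k) \<longlongrightarrow> line_pt d 0 $ k) (nhds 0)"
      using c[of k] tendsto_at_iff_tendsto_nhds[of "\<lambda>t. line_pt d t $ k" 0] by (simp add: isCont_def)
    then have "\<forall>\<^sub>F t in nhds 0. line_pt d t $ k \<in> {w. cmod w < 1 \<and> Re w > 0}"
      by (rule topological_tendstoD[OF _ o m])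
    moreover have "(line_z d k \<longlongrightarrow> line_z d k 0) (nhds 0)"
      using cz[of k] by (simp add: isCont_def tendsto_at_iff_tendsto_nhds)
    then have "\<forall>\<^sub>F t in nhds 0. line_z d k t \<in> - {0}"
      by (rule topological_tendstoD) (use z0n[of k] in auto)
    ultimately show ?thesis by eventually_elim auto
  qed
  then have "\<forall>\<^sub>F t in nhds 0. \<forall>k. norm (line_pt d t $ k) < 1 \<and> Re (line_pt d t $ k) > 0 \<and> line_z d k t \<noteq> 0"
    by (rule eventually_all_finite)
  then show ?thesis by (auto simp: eventually_nhds_metric dist_commute)
qed

lemma zc_curve_derivative:
  fixes x :: "complex \<Rightarrow> complex ^ 'n::{finite,linorder}"
  assumes "\<And>j. ((\<lambda>t. x t $ j) has_field_derivative x' j) (at t)"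
  shows "((\<lambda>t. zc i (x t)) has_field_derivative (\<Sum>j\<in>UNIV. partial_deriv j (zc i) (x t) * x' j)) (at t)"
proof -
  have "((\<lambda>t. \<Prod>j\<in>{i..}. x t $ j) has_field_derivative (\<Sum>j\<in>{i..}. x' j * (\<Prod>l\<in>{i..} - {j}. x t $ l))) (at t)"
    by (rule has_field_derivative_prod) (rule assms)
  moreover have "(\<Sum>j\<in>{i..}. x' j * (\<Prod>l\<in>{i..} - {j}. x t $ l)) = (\<Sum>j\<in>UNIV. partial_deriv j (zc i) (x t) * x' j)"
    unfolding partial_deriv_zc by (rule sum.mono_neutral_cong_left) auto
  ultimately show ?thesis by (simp add: zc_def)
qed

text \<open>The supports of \<open>\<iota> \<phi>\<close> and of the functionals derived from it
  differ; a common finite box allows termwise comparison of their sums.\<close>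

definition expo_box :: "nat \<Rightarrow> ('n::finite \<Rightarrow> nat) set" where
  "expo_box M = {e. \<forall>k. e k < M}"

lemma finite_expo_box: "finite (expo_box M :: ('n::finite \<Rightarrow> nat) set)"
proof -
  have "(expo_box M :: ('n \<Rightarrow> nat) set) = (UNIV \<rightarrow>\<^sub>E {..<M})" by (auto simp: expo_box_def PiE_UNIV_domain)
  then show ?thesis by (simp add: finite_PiE)
qed

definition expo_mon :: "('n::finite \<Rightarrow> complex) \<Rightarrow> ('n \<Rightarrow> nat) \<Rightarrow> complex" where
  "expo_mon L e = (\<Prod>k\<in>UNIV. L k ^ e k)"

text \<open>Differentiating a power of the logarithm lowers its exponent; raising the summation
  index compensates this and produces the second term of \<open>logpoly_deriv\<close>. The vanishing
  of \<open>G\<close> beyond \<open>M\<close> takes care of the upper edge of the box.\<close>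

lemma sum_expo_shift:
  fixes G :: "('n::finite \<Rightarrow> nat) \<Rightarrow> complex"
  assumes G: "\<And>e. M \<le> e j \<Longrightarrow> G e = 0"
  shows "(\<Sum>e\<in>expo_box M. G e * (of_nat (e j) * L j ^ (e j - 1) * (\<Prod>k\<in>UNIV - {j}. L k ^ e k)))
    = (\<Sum>e\<in>expo_box M. of_nat (Suc (e j)) * G (e(j := Suc (e j))) * expo_mon L e)" (is "sum ?g _ = sum ?h _")
proof -
  have 1: "?h (e(j := e j - 1)) = ?g e" if "e j \<noteq> 0" for e
  proof -
    obtain m where m: "e j = Suc m" using \<open>e j \<noteq> 0\<close> by (cases "e j") auto
    have e_eqs: "(e(j := m)) j = m" "(e(j := m))(j := Suc m) = e"
      using m by auto
    have "expo_mon L (e(j := m)) = L j ^ m * (\<Prod>k\<in>UNIV - {j}. L k ^ (e(j := m)) k)"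
      unfolding expo_mon_def by (subst prod.remove[of UNIV j]) auto
    also have "(\<Prod>k\<in>UNIV - {j}. L k ^ (e(j := m)) k) = (\<Prod>k\<in>UNIV - {j}. L k ^ e k)"
      by (rule prod.cong) auto
    finally have ex: "expo_mon L (e(j := m)) = L j ^ m * (\<Prod>k\<in>UNIV - {j}. L k ^ e k)" .
    show ?thesis
      unfolding m diff_Suc_1 unfolding e_eqs ex by (simp only: mult_ac)
  qed
  have "sum ?g (expo_box M) = sum ?g {e \<in> expo_box M. e j \<noteq> 0}"
    by (rule sum.mono_neutral_right) (auto simp: finite_expo_box)
  also have "\<dots> = sum ?h {e \<in> expo_box M. Suc (e j) < M}"
  proof (rule sum.reindex_bij_witness[where i = "\<lambda>e. e(j := Suc (e j))" and j = "\<lambda>e. e(j := e j - 1)"])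
    show "?h (e(j := e j - 1)) = ?g e" if "e \<in> {e \<in> expo_box M. e j \<noteq> 0}" for e
      using that by (intro 1) auto
  qed (auto simp: expo_box_def fun_upd_idem le_less_trans[OF diff_le_self])
  also have "\<dots> = sum ?h (expo_box M)"
    by (rule sum.mono_neutral_left) (auto simp: finite_expo_box G not_less)
  finally show ?thesis .
qed

locale line_restriction =
  fixes \<iota> :: "('n::{finite,linorder} idx braid_lie uea \<Rightarrow> complex) \<Rightarrow> 'n logpoly"
    and d :: "'n \<Rightarrow> complex" and r :: real
  assumes \<iota>: "is_iterated_integral \<iota>"
    and slopes: "\<And>p. p \<in> gen_pairs \<Longrightarrow> slope d (fst p) \<noteq> slope d (snd p)" and poles: "inj_on (pole d) gen_pairs"
    and r: "r > 0" and line: "\<And>t k. t \<in> ball 0 r \<Longrightarrow> norm (line_pt d t $ k) < 1 \<and> Re (line_pt d t $ k) > 0 \<and> line_z d k t \<noteq> 0"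
begin

abbreviation X :: "complex \<Rightarrow> (complex, 'n) vec" where "X \<equiv> line_pt d"

lemma X_polydisc: "t \<in> ball 0 r \<Longrightarrow> X t \<in> polydisc"
  using line by (simp add: polydisc_def)

lemma X_nonzero: "t \<in> ball 0 r \<Longrightarrow> X t $ k \<noteq> 0"
  using line[of t k] by auto

lemma zc_X: "t \<in> ball 0 r \<Longrightarrow> zc i (X t) = line_z d i t"
  using line by (intro zc_line_pt) auto

definition X' :: "complex \<Rightarrow> 'n \<Rightarrow> complex" where "X' t k = deriv (\<lambda>t. X t $ k) t"

lemma X_deriv:
  assumes t: "t \<in> ball 0 r"
  shows "((\<lambda>t. X t $ k) has_field_derivative X' t k) (at t)"
proof -
  have z: "line_z d k field_differentiable at t" for k
    unfolding line_z_def by (intro derivative_intros)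
  have "(\<lambda>t. X t $ k) field_differentiable at t"
    using z line[OF t, THEN conjunct2, THEN conjunct2]
    by (cases "k = Max UNIV") (auto simp: line_pt_def intro!: field_differentiable_divide)
  then show ?thesis unfolding X'_def by (simp add: DERIV_deriv_iff_field_differentiable)
qed

text \<open>The derivatives of the x_k along the line are never computed: z_i is affine there, and
  uniqueness of the derivative identifies the chain-rule sum with its slope.\<close>

lemma sum_dlog_zc:
  assumes t: "t \<in> ball 0 r"
  shows "(\<Sum>j\<in>UNIV. partial_deriv j (zc i) (X t) * X' t j) = d i"
proof -
  have "((\<lambda>t. zc i (X t)) has_field_derivative d i) (at t)"
  proof (rule has_field_derivative_transform_within_open[OF _ open_ball t])
    show "(line_z d i has_field_derivative d i) (at t)"
      unfolding line_z_def by (auto intro!: derivative_eq_intros)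
  qed (simp add: zc_X)
  then show ?thesis using zc_curve_derivative[OF X_deriv[OF t]] DERIV_unique by blast
qed

lemma pole_form:
  assumes p: "p \<in> gen_pairs" and z: "z = (start (fst p) - start (snd p)) + (slope d (fst p) - slope d (snd p)) * t"
  shows "(slope d (fst p) - slope d (snd p)) / z = 1 / (t - pole d p)" and "z \<noteq> 0 \<longleftrightarrow> t \<noteq> pole d p"
proof -
  define s where "s = slope d (fst p) - slope d (snd p)"
  have s: "s \<noteq> 0" using slopes[OF p] by (simp add: s_def)
  have "z = s * (t - pole d p)" using s by (simp add: z pole_def flip: s_def) (simp add: field_simps)
  then show "(slope d (fst p) - slope d (snd p)) / z = 1 / (t - pole d p)" "z \<noteq> 0 \<longleftrightarrow> t \<noteq> pole d p"
    using s by (simp_all flip: s_def)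
qed

lemma sum_dlog:
  assumes t: "t \<in> ball 0 r"
  shows "(\<Sum>j\<in>UNIV. X' t j * dlog (zc i) j (X t)) = 1 / (t - pole d (\<alpha>, i_pt i))"
    and "(\<Sum>j\<in>UNIV. X' t j * dlog (\<lambda>y. zc i y - 1) j (X t)) = 1 / (t - pole d (i_pt i, \<beta>))"
    and "i < l \<Longrightarrow> (\<Sum>j\<in>UNIV. X' t j * dlog (\<lambda>y. zc i y - zc l y) j (X t)) = 1 / (t - pole d (i_pt i, i_pt l))"
proof -
  have lin: "(\<Sum>j\<in>UNIV. X' t j * (f j / z)) = (\<Sum>j\<in>UNIV. f j * X' t j) / z" for f z
    by (simp add: sum_divide_distrib mult.commute)
  have "(\<Sum>j\<in>UNIV. X' t j * dlog (zc i) j (X t)) = d i / line_z d i t"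
    unfolding dlog_def lin sum_dlog_zc[OF t] zc_X[OF t] ..
  \<comment> \<open>The pair is ordered as (\<alpha>, i), so the difference is -z_i; the logarithmic
    derivative ignores the sign.\<close>
  also have "\<dots> = (slope d \<alpha> - slope d (i_pt i)) / (- line_z d i t)" by simp
  also have "\<dots> = 1 / (t - pole d (\<alpha>, i_pt i))"
    using pole_form(1)[of "(\<alpha>, i_pt i)" "- line_z d i t" t] by (simp add: gen_pairs_def line_z_def)
  finally show "(\<Sum>j\<in>UNIV. X' t j * dlog (zc i) j (X t)) = 1 / (t - pole d (\<alpha>, i_pt i))" .
  have "(\<Sum>j\<in>UNIV. X' t j * dlog (\<lambda>y. zc i y - 1) j (X t)) = d i / (line_z d i t - 1)"
    unfolding dlog_def lin partial_deriv_zc(2) partial_deriv_zc(1)[symmetric] sum_dlog_zc[OF t] zc_X[OF t] ..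
  also have "\<dots> = 1 / (t - pole d (i_pt i, \<beta>))"
    using pole_form(1)[of "(i_pt i, \<beta>)" "line_z d i t - 1" t] by (simp add: gen_pairs_def line_z_def)
  finally show "(\<Sum>j\<in>UNIV. X' t j * dlog (\<lambda>y. zc i y - 1) j (X t)) = 1 / (t - pole d (i_pt i, \<beta>))" .
  assume il: "i < l"
  have "(\<Sum>j\<in>UNIV. X' t j * dlog (\<lambda>y. zc i y - zc l y) j (X t)) = (d i - d l) / (line_z d i t - line_z d l t)"
    unfolding dlog_def lin partial_deriv_zc(3) partial_deriv_zc(1)[symmetric] left_diff_distrib sum_subtractf
      sum_dlog_zc[OF t] zc_X[OF t] ..
  also have "\<dots> = 1 / (t - pole d (i_pt i, i_pt l))"
    using pole_form(1)[of "(i_pt i, i_pt l)" "line_z d i t - line_z d l t" t] il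
    by (simp add: gen_pairs_def line_z_def algebra_simps)
  finally show "(\<Sum>j\<in>UNIV. X' t j * dlog (\<lambda>y. zc i y - zc l y) j (X t)) = 1 / (t - pole d (i_pt i, i_pt l))" .
qed

text \<open>Over the ball the line stays in the polydisc with nonzero coordinates, where z_i, z_i -
  1 and z_i - z_l have no zeros.\<close>

lemma pole_outside: "p \<in> gen_pairs \<Longrightarrow> pole d p \<notin> ball 0 r"
proof
  assume p: "p \<in> gen_pairs" and t: "pole d p \<in> ball 0 r"
  define t where "t = pole d p"
  note tr = t[folded t_def]
  have z: "zc i (X t) \<noteq> 0" for i using line[OF tr] zc_X[OF tr] by simp
  have z1: "zc i (X t) \<noteq> 1" for i using norm_zc_less[OF X_polydisc[OF tr], of i] by auto
  have zz: "zc i (X t) \<noteq> zc l (X t)" if "i < l" for i l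
  proof -
    have "(\<Prod>j\<in>{i..<l}. X t $ j) \<noteq> 1"
      using norm_prod_less_1[OF X_polydisc[OF tr], of "{i..<l}"] that by auto
    then show ?thesis using zc_mult[OF less_imp_le[OF that], of "X t"] z[of l] by (metis mult_cancel_right1)
  qed
  have 0: "(start (fst p) - start (snd p)) + (slope d (fst p) - slope d (snd p)) * t = 0"
    using pole_form(2)[OF p refl, of t] by (simp add: t_def)
  show False
    using p 0 z z1 zz unfolding gen_pairs_def
    by (auto simp: zc_X[OF tr] line_z_def algebra_simps)
qed

text \<open>The principal branch of \<open>log x\<^sub>k\<close> is substituted for the formal symbol along the line.\<close>

definition F :: "('n idx braid_lie uea \<Rightarrow> complex) \<Rightarrow> complex \<Rightarrow> complex" where
  "F \<phi> t = (\<Sum>e\<in>{e. \<iota> \<phi> e \<noteq> (\<lambda>_. 0)}. \<iota> \<phi> e (X t) * expo_mon (\<lambda>k. Ln (X t $ k)) e)"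

lemma F_box:
  assumes "\<phi> \<in> graded_dual" "\<And>e k. M \<le> e k \<Longrightarrow> \<iota> \<phi> e = (\<lambda>_. 0)"
  shows "F \<phi> t = (\<Sum>e\<in>expo_box M. \<iota> \<phi> e (X t) * expo_mon (\<lambda>k. Ln (X t $ k)) e)"
  unfolding F_def
proof (rule sum.mono_neutral_left[OF finite_expo_box])
  show "{e. \<iota> \<phi> e \<noteq> (\<lambda>_. 0)} \<subseteq> expo_box M"
    using assms(2) by (force simp: expo_box_def not_less[symmetric])
qed auto

lemma expo_mon_deriv:
  assumes t: "t \<in> ball 0 r"
  shows "((\<lambda>t. expo_mon (\<lambda>k. Ln (X t $ k)) e) has_field_derivative
    (\<Sum>j\<in>UNIV. X' t j / X t $ j * (of_nat (e j) * Ln (X t $ j) ^ (e j - 1) * (\<Prod>k\<in>UNIV - {j}. Ln (X t $ k) ^ e k)))) (at t)"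
proof -
  have "((\<lambda>t. Ln (X t $ j) ^ e j) has_field_derivative X' t j / X t $ j * (of_nat (e j) * Ln (X t $ j) ^ (e j - 1))) (at t)" for j
  proof -
    have "X t $ j \<notin> \<real>\<^sub>\<le>\<^sub>0" using line[OF t, of j] by (auto simp: complex_nonpos_Reals_iff)
    then have "((\<lambda>t. Ln (X t $ j)) has_field_derivative X' t j / X t $ j) (at t)"
      using X_deriv[OF t, of j] by (auto intro!: derivative_eq_intros simp: field_simps)
    from DERIV_power[OF this, of "e j"] show ?thesis by (simp add: mult_ac)
  qed
  then have "((\<lambda>t. \<Prod>j\<in>UNIV. Ln (X t $ j) ^ e j) has_field_derivative
    (\<Sum>j\<in>UNIV. (X' t j / X t $ j * (of_nat (e j) * Ln (X t $ j) ^ (e j - 1))) * (\<Prod>k\<in>UNIV - {j}. Ln (X t $ k) ^ e k))) (at t)"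
    by (rule has_field_derivative_prod)
  then show ?thesis by (simp add: expo_mon_def mult.assoc)
qed

lemma F_deriv:
  assumes \<phi>: "\<phi> \<in> graded_dual" and t: "t \<in> ball 0 r"
  shows "(F \<phi> has_field_derivative (\<Sum>p\<in>gen_pairs. F (precomp \<phi> (gX (fst p) (snd p))) t / (t - pole d p))) (at t)"
proof -
  note pre = graded_dual_precomp[OF \<phi>]
  obtain m where m: "\<And>a b e k. m a b \<le> e k \<Longrightarrow> \<iota> (precomp \<phi> (gX a b)) e = (\<lambda>_. 0)"
    using iota_exponent_bound[OF \<iota> pre] by metis
  obtain m0 where m0: "\<And>e k. m0 \<le> e k \<Longrightarrow> \<iota> \<phi> e = (\<lambda>_. 0)"
    using iota_exponent_bound[OF \<iota> \<phi>] by metis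
  \<comment> \<open>One exponent bound for \<open>\<phi>\<close> and all its contractions with
    generators, so that every sum runs over the same box.\<close>
  define M where "M = m0 + (\<Sum>a\<in>UNIV. \<Sum>b\<in>UNIV. m a b)"
  have M0: "\<iota> \<phi> e = (\<lambda>_. 0)" if "M \<le> e k" for e k using m0[of e k] that by (simp add: M_def)
  have M1: "\<iota> (precomp \<phi> (gX a b)) e = (\<lambda>_. 0)" if "M \<le> e k" for a b e k
  proof -
    have "m a b \<le> (\<Sum>b\<in>UNIV. m a b)" by (rule member_le_sum) auto
    also have "\<dots> \<le> (\<Sum>a\<in>UNIV. \<Sum>b\<in>UNIV. m a b)" by (rule member_le_sum[of a UNIV "\<lambda>a. \<Sum>b\<in>UNIV. m a b"]) auto
    finally show ?thesis using m[of a b e k] that by (simp add: M_def)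
  qed
  define L where "L k = Ln (X t $ k)" for k
  define E where "E = expo_mon L"
  let ?B = "expo_box M :: ('n \<Rightarrow> nat) set"
  have eqF: "F \<phi> = (\<lambda>t. \<Sum>e\<in>?B. \<iota> \<phi> e (X t) * expo_mon (\<lambda>k. Ln (X t $ k)) e)"
    by (rule ext, rule F_box[OF \<phi>], rule M0)
  have "(F \<phi> has_field_derivative (\<Sum>e\<in>?B. (\<Sum>j\<in>UNIV. partial_deriv j (\<iota> \<phi> e) (X t) * X' t j) * E e
     + (\<Sum>j\<in>UNIV. X' t j / X t $ j * (of_nat (e j) * L j ^ (e j - 1) * (\<Prod>k\<in>UNIV - {j}. L k ^ e k))) * \<iota> \<phi> e (X t))) (at t)"
    unfolding eqF E_def L_def
    by (intro DERIV_sum DERIV_mult polydisc_curve_derivative iota_holo[OF \<iota> \<phi>] X_polydisc t X_deriv expo_mon_deriv)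
  moreover have "(\<Sum>e\<in>?B. (\<Sum>j\<in>UNIV. partial_deriv j (\<iota> \<phi> e) (X t) * X' t j) * E e
     + (\<Sum>j\<in>UNIV. X' t j / X t $ j * (of_nat (e j) * L j ^ (e j - 1) * (\<Prod>k\<in>UNIV - {j}. L k ^ e k))) * \<iota> \<phi> e (X t))
     = (\<Sum>p\<in>gen_pairs. F (precomp \<phi> (gX (fst p) (snd p))) t / (t - pole d p))" (is "?D = _")
  proof -
    have "?D = (\<Sum>j\<in>UNIV. \<Sum>e\<in>?B. partial_deriv j (\<iota> \<phi> e) (X t) * X' t j * E e)
      + (\<Sum>j\<in>UNIV. X' t j / X t $ j * (\<Sum>e\<in>?B. \<iota> \<phi> e (X t) * (of_nat (e j) * L j ^ (e j - 1) * (\<Prod>k\<in>UNIV - {j}. L k ^ e k))))"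
      unfolding sum.distrib sum_distrib_right sum_distrib_left
      by (subst (1 2) sum.swap) (simp add: mult_ac)
    \<comment> \<open>The derivatives of the logarithm powers, shifted in the exponent, complete the
      partial derivatives to the formal derivative, for which the equation of \<open>\<iota>\<close>
      is available.\<close>
    also have "\<dots> = (\<Sum>j\<in>UNIV. \<Sum>e\<in>?B. partial_deriv j (\<iota> \<phi> e) (X t) * X' t j * E e)
      + (\<Sum>j\<in>UNIV. X' t j / X t $ j * (\<Sum>e\<in>?B. of_nat (Suc (e j)) * \<iota> \<phi> (e(j := Suc (e j))) (X t) * E e))"
      unfolding E_def by (subst sum_expo_shift) (simp_all add: M0)
    also have "\<dots> = (\<Sum>j\<in>UNIV. \<Sum>e\<in>?B. X' t j * logpoly_deriv j (\<iota> \<phi>) e (X t) * E e)"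
      unfolding logpoly_deriv_def sum_distrib_left sum.distrib[symmetric]
      by (intro sum.cong refl) (simp add: algebra_simps add_divide_distrib fun_upd_def)
    also have "\<dots> = (\<Sum>e\<in>?B. (\<Sum>j\<in>UNIV. X' t j * logpoly_deriv j (\<iota> \<phi>) e (X t)) * E e)"
      by (subst sum.swap) (simp add: sum_distrib_right)
    also have "\<dots> = (\<Sum>e\<in>?B. (\<Sum>p\<in>gen_pairs. \<iota> (precomp \<phi> (gX (fst p) (snd p))) e (X t) / (t - pole d p)) * E e)"
    proof (intro sum.cong refl arg_cong2[of _ _ _ _ "(*)"])
      fix e
      have nz: "\<forall>i. X t $ i \<noteq> 0" using X_nonzero[OF t] by blast
      let ?a = "\<lambda>a b. \<iota> (precomp \<phi> (gX a b)) e (X t)"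
      have "(\<Sum>j\<in>UNIV. X' t j * logpoly_deriv j (\<iota> \<phi>) e (X t))
        = (\<Sum>i\<in>UNIV. ?a \<alpha> (i_pt i) * (\<Sum>j\<in>UNIV. X' t j * dlog (zc i) j (X t))
             + ?a (i_pt i) \<beta> * (\<Sum>j\<in>UNIV. X' t j * dlog (\<lambda>y. zc i y - 1) j (X t)))
          + (\<Sum>p\<in>{(i, j). i < j}. ?a (i_pt (fst p)) (i_pt (snd p)) *
              (\<Sum>j\<in>UNIV. X' t j * dlog (\<lambda>y. zc (fst p) y - zc (snd p) y) j (X t)))"
        unfolding iota_ode[OF \<iota> \<phi> X_polydisc[OF t] nz] distrib_left sum.distrib sum_distrib_left case_prod_unfold
        by (subst (1 2 3) sum.swap) (simp add: mult_ac)
      also have "\<dots> = (\<Sum>p\<in>gen_pairs. ?a (fst p) (snd p) / (t - pole d p))"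
        unfolding sum_gen_pairs case_prod_unfold
        by (intro arg_cong2[of _ _ _ _ "(+)"] sum.cong refl) (auto simp: sum_dlog[OF t])
      finally show "(\<Sum>j\<in>UNIV. X' t j * logpoly_deriv j (\<iota> \<phi>) e (X t)) = (\<Sum>p\<in>gen_pairs. ?a (fst p) (snd p) / (t - pole d p))" .
    qed
    also have "\<dots> = (\<Sum>p\<in>gen_pairs. (\<Sum>e\<in>?B. \<iota> (precomp \<phi> (gX (fst p) (snd p))) e (X t) * E e) / (t - pole d p))"
      unfolding sum_distrib_right sum_divide_distrib by (subst sum.swap) simp
    also have "\<dots> = (\<Sum>p\<in>gen_pairs. F (precomp \<phi> (gX (fst p) (snd p))) t / (t - pole d p))"
      unfolding E_def L_def by (intro sum.cong refl arg_cong2[of _ _ _ _ "(/)"] F_box[OF pre, symmetric] M1)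
    finally show ?thesis .
  qed
  ultimately show ?thesis by simp
qed

end

section \<open>Injectivity of the iterated integral map\<close>

definition convex_primitive :: "real \<Rightarrow> (complex \<Rightarrow> complex) \<Rightarrow> complex \<Rightarrow> complex" where
  "convex_primitive r f = (SOME g. g 0 = 0 \<and> (\<forall>t\<in>ball 0 r. (g has_field_derivative f t) (at t)))"

lemma convex_primitive:
  assumes f: "f holomorphic_on ball 0 r"
  shows "convex_primitive r f 0 = 0"
    and "t \<in> ball 0 r \<Longrightarrow> (convex_primitive r f has_field_derivative f t) (at t)"
proof -
  obtain g where g: "\<And>t. t \<in> ball 0 r \<Longrightarrow> (g has_field_derivative f t) (at t)"
    using holomorphic_convex_primitive'[OF convex_ball open_ball f] at_within_open[OF _ open_ball] by metis
  have "(\<lambda>t. g t - g 0) 0 = 0 \<and> (\<forall>t\<in>ball 0 r. ((\<lambda>t. g t - g 0) has_field_derivative f t) (at t))"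
    using g by (auto intro!: derivative_eq_intros)
  then have "\<exists>g. g 0 = 0 \<and> (\<forall>t\<in>ball 0 r. (g has_field_derivative f t) (at t))"
    by (intro exI[of _ "\<lambda>t. g t - g 0"]) simp
  then have "convex_primitive r f 0 = 0 \<and> (\<forall>t\<in>ball 0 r. (convex_primitive r f has_field_derivative f t) (at t))"
    unfolding convex_primitive_def by (rule someI_ex)
  then show "convex_primitive r f 0 = 0" "t \<in> ball 0 r \<Longrightarrow> (convex_primitive r f has_field_derivative f t) (at t)"
    by simp_all
qed

text \<open>Hyperlogarithms with base point 0, meaningful when the ball contains no letter of the
  word; the first letter belongs to the outermost integration.\<close>

primrec hyperlog :: "real \<Rightarrow> complex list \<Rightarrow> complex \<Rightarrow> complex" where
  "hyperlog r [] = (\<lambda>_. 1)"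
| "hyperlog r (a # w) = convex_primitive r (\<lambda>t. hyperlog r w t / (t - a))"

lemma hyperlog_deriv:
  assumes "a \<notin> ball 0 r" "set w \<inter> ball 0 r = {}" "t \<in> ball 0 r"
  shows "(hyperlog r (a # w) has_field_derivative hyperlog r w t / (t - a)) (at t)"
    and "hyperlog r (a # w) 0 = 0"
proof -
  have "hyperlog r w holomorphic_on ball 0 r" using assms(2)
  proof (induction w)
    case (Cons b w)
    then have "(\<lambda>t. hyperlog r w t / (t - b)) holomorphic_on ball 0 r" by (auto intro!: holomorphic_intros)
    from convex_primitive(2)[OF this] show ?case
      unfolding holomorphic_on_open[OF open_ball] hyperlog.simps by blast
  qed simp
  then have h: "(\<lambda>t. hyperlog r w t / (t - a)) holomorphic_on ball 0 r"
    using assms(1) by (auto intro!: holomorphic_intros)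
  show "(hyperlog r (a # w) has_field_derivative hyperlog r w t / (t - a)) (at t)"
    using convex_primitive(2)[OF h assms(3)] by simp
  show "hyperlog r (a # w) 0 = 0" using convex_primitive(1)[OF h] by simp
qed

section \<open>Expansion in hyperlogarithms along the line\<close>

context line_restriction
begin

definition S :: "complex set" where "S = pole d ` gen_pairs"

definition pole_pair :: "complex \<Rightarrow> 'n idx \<times> 'n idx" where "pole_pair = the_inv_into gen_pairs (pole d)"

lemma pole_pair: "p \<in> gen_pairs \<Longrightarrow> pole_pair (pole d p) = p"
  unfolding pole_pair_def by (rule the_inv_into_f_f[OF poles])

lemma finite_S: "finite S" by (simp add: S_def finite_gen_pairs)

lemma S_outside: "S \<inter> ball 0 r = {}" using pole_outside by (auto simp: S_def)

definition pre :: "('n idx braid_lie uea \<Rightarrow> complex) \<Rightarrow> complex \<Rightarrow> ('n idx braid_lie uea \<Rightarrow> complex)" where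
  "pre \<phi> a = precomp \<phi> (gX (fst (pole_pair a)) (snd (pole_pair a)))"

lemma F_deriv_S:
  assumes "\<phi> \<in> graded_dual" "t \<in> ball 0 r"
  shows "(F \<phi> has_field_derivative (\<Sum>a\<in>S. F (pre \<phi> a) t / (t - a))) (at t)"
proof -
  have "(\<Sum>a\<in>S. F (pre \<phi> a) t / (t - a)) = (\<Sum>p\<in>gen_pairs. F (precomp \<phi> (gX (fst p) (snd p))) t / (t - pole d p))"
    unfolding S_def by (subst sum.reindex[OF poles]) (auto simp: pre_def pole_pair)
  then show ?thesis using F_deriv[OF assms] by simp
qed

lemma pre_graded_dual: "\<phi> \<in> graded_dual \<Longrightarrow> pre \<phi> a \<in> graded_dual"
  unfolding pre_def by (rule graded_dual_precomp)

fun pre_word :: "('n idx braid_lie uea \<Rightarrow> complex) \<Rightarrow> complex list \<Rightarrow> ('n idx braid_lie uea \<Rightarrow> complex)" where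
  "pre_word \<phi> [] = \<phi>"
| "pre_word \<phi> (a # w) = pre_word (pre \<phi> a) w"

definition bounded_deg :: "nat \<Rightarrow> ('n idx braid_lie uea \<Rightarrow> complex) \<Rightarrow> bool" where
  "bounded_deg D \<phi> \<longleftrightarrow> \<phi> \<in> graded_dual \<and> (\<forall>e>D. \<forall>u\<in>uea_deg e. \<phi> u = 0)"

lemma bounded_deg_pre: "bounded_deg (Suc D) \<phi> \<Longrightarrow> bounded_deg D (pre \<phi> a)"
  unfolding bounded_deg_def
proof (elim conjE, intro conjI allI impI ballI)
  fix e and u :: "'n idx braid_lie uea"
  assume \<phi>: "\<forall>e>Suc D. \<forall>u\<in>uea_deg e. \<phi> u = 0" "D < e" "u \<in> uea_deg e"
  then have "Suc D < Suc e" by simp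
  with \<phi>(1) uea_deg_Suc[OF \<phi>(3)] show "pre \<phi> a u = 0" unfolding pre_def precomp_def by blast
qed (rule pre_graded_dual)

lemma F_counit: "t \<in> ball 0 r \<Longrightarrow> F (\<lambda>u. c * counit u) t = c"
proof -
  assume t: "t \<in> ball 0 r"
  have "(counit :: 'n idx braid_lie uea \<Rightarrow> complex) \<in> graded_dual"
    using homogeneous_graded_dual[OF homogeneous_word_fun[of "[]"]] by (simp add: word_fun_Nil)
  then have \<iota>c: "\<iota> (\<lambda>u. c * counit u) = (\<lambda>e x. c * logpoly_const (\<lambda>_. 1) e x)"
    by (simp add: iota_scale[OF \<iota>] iota_counit[OF \<iota>])
  have "F (\<lambda>u. c * counit u) t = (\<Sum>e\<in>{\<lambda>_. 0}. \<iota> (\<lambda>u. c * counit u) e (X t) * expo_mon (\<lambda>k. Ln (X t $ k)) e)"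
    unfolding F_def by (rule sum.mono_neutral_left) (auto simp: \<iota>c logpoly_const_def dest: fun_cong[of _ _ "X t"] split: if_splits)
  then show ?thesis using X_polydisc[OF t] by (simp add: \<iota>c logpoly_const_def expo_mon_def)
qed

lemma bounded_deg_0: "bounded_deg 0 \<phi> \<Longrightarrow> \<phi> = (\<lambda>u. \<phi> 1 * counit u)"
  by (rule homogeneous_0_eq) (auto simp: bounded_deg_def homogeneous_def)

lemma F_counit_multiple:
  assumes eq: "\<phi> = (\<lambda>u. \<phi> 1 * counit u)" and t: "t \<in> ball 0 r"
  shows "F \<phi> t = \<phi> 1"
  using arg_cong[OF eq, of "\<lambda>\<psi>. F \<psi> t"] F_counit[OF t, of "\<phi> 1"] by (rule trans)

lemma zero_of_counit_multiple:
  assumes eq: "\<phi> = (\<lambda>u. \<phi> 1 * counit u)" and F: "F \<phi> 0 = 0"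
  shows "\<phi> = (\<lambda>_. 0)"
proof
  fix u
  have "\<phi> 1 = 0" using F_counit_multiple[OF eq, of 0] F r by simp
  then show "\<phi> u = 0" using fun_cong[OF eq, of u] by simp
qed

text \<open>The iterated integral is transported to the base point 0 of the line. By induction both
  sides have the same derivative, and they agree at 0 because hyperlogarithms of nonempty words
  vanish there.\<close>

lemma F_expansion:
  assumes "bounded_deg D \<phi>" "t \<in> ball 0 r"
  shows "F \<phi> t = (\<Sum>w\<in>words_upto S D. hyperlog r w t * F (pre_word \<phi> w) 0)"
  using assms
proof (induction D arbitrary: \<phi> t)
  case 0
  have "words_upto S 0 = {[]}" by (auto simp: words_upto_def)
  moreover have "F \<phi> t = F \<phi> 0"
    using F_counit_multiple[OF bounded_deg_0[OF 0(1)]] 0(2) r by simp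
  ultimately show ?case by simp
next
  case (Suc D)
  have GD: "\<phi> \<in> graded_dual" using Suc.prems by (simp add: bounded_deg_def)
  let ?R = "\<lambda>t. F \<phi> 0 + (\<Sum>a\<in>S. \<Sum>w\<in>words_upto S D. hyperlog r (a # w) t * F (pre_word (pre \<phi> a) w) 0)"
  have out: "a \<notin> ball 0 r" "set w \<inter> ball 0 r = {}" if "a \<in> S" "w \<in> words_upto S D" for a w
    using that S_outside by (auto simp: words_upto_def)
  have R': "(?R has_field_derivative (\<Sum>a\<in>S. F (pre \<phi> a) t / (t - a))) (at t)" if t: "t \<in> ball 0 r" for t
  proof -
    have "(?R has_field_derivative 0 + (\<Sum>a\<in>S. \<Sum>w\<in>words_upto S D. hyperlog r w t / (t - a) * F (pre_word (pre \<phi> a) w) 0)) (at t)"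
      by (intro DERIV_add DERIV_const DERIV_sum DERIV_cmult_right hyperlog_deriv(1) out t)
    moreover have "(\<Sum>w\<in>words_upto S D. hyperlog r w t / (t - a) * F (pre_word (pre \<phi> a) w) 0) = F (pre \<phi> a) t / (t - a)" for a
      unfolding Suc.IH[OF bounded_deg_pre[OF Suc.prems(1)] t] by (simp add: sum_divide_distrib)
    ultimately show ?thesis by simp
  qed
  have d0: "((\<lambda>t. F \<phi> t - ?R t) has_field_derivative 0) (at t)" if "t \<in> ball 0 r" for t
    using DERIV_diff[OF F_deriv_S[OF GD that] R'[OF that]] by simp
  have "\<exists>c. \<forall>t\<in>ball 0 r. F \<phi> t - ?R t = c"
    by (rule has_field_derivative_zero_constant[OF convex_ball]) (rule has_field_derivative_at_within[OF d0])
  then obtain c where c: "\<And>t. t \<in> ball 0 r \<Longrightarrow> F \<phi> t - ?R t = c" by blast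
  have "hyperlog r (a # w) 0 = 0" if "a \<in> S" "w \<in> words_upto S D" for a w
    using hyperlog_deriv(2)[OF out[OF that], of 0] r by simp
  then have "?R 0 = F \<phi> 0"
    by (simp del: hyperlog.simps)
  then have "c = 0" using c[of 0] r by simp
  then have "F \<phi> t = ?R t" using c[OF Suc.prems(2)] by simp
  also have "\<dots> = (\<Sum>w\<in>words_upto S (Suc D). hyperlog r w t * F (pre_word \<phi> w) 0)"
    by (subst sum_words_upto_Suc[OF finite_S]) simp
  finally show ?case .
qed

lemma precomp_all_0:
  fixes a b :: "'n idx"
  assumes "clinear \<phi>" and "\<And>a. a \<in> S \<Longrightarrow> pre \<phi> a = (\<lambda>_. 0)"
  shows "\<phi> (uemb (gX a b) * u) = 0"
proof -
  have lin: "clinear (\<lambda>Y. precomp \<phi> Y u)"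
    unfolding precomp_def
    using assms(1) by (intro clinear_compose[OF assms(1)] clinear_compose[OF clinear_mult_right clinear_uemb])
  have "precomp \<phi> (gX a b) u = 0"
  proof (rule clinear_eq_on_span[OF lin _ _ gX_span])
    fix y :: "'n idx braid_lie" assume "y \<in> (\<lambda>(a, b). gX a b) ` gen_pairs"
    then obtain p where p: "p \<in> gen_pairs" "y = gX (fst p) (snd p)" by (auto simp: case_prod_unfold)
    then have "precomp \<phi> y = (\<lambda>_. 0)"
      using assms(2)[of "pole d p"] by (simp add: S_def pre_def pole_pair)
    then show "precomp \<phi> y u = 0" by simp
  qed (simp add: clinearI)
  then show ?thesis by (simp add: precomp_def)
qed

text \<open>Contracting with the generators that carry poles eventually reaches degree 0, where F
  reads off the value at 1. Since these generators span the others, the numbers F(...) at 0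
  determine the functional.\<close>

lemma functional_zero:
  assumes "bounded_deg D \<phi>" and "\<And>w. w \<in> words_upto S D \<Longrightarrow> F (pre_word \<phi> w) 0 = 0"
  shows "\<phi> = (\<lambda>_. 0)"
  using assms
proof (induction D arbitrary: \<phi>)
  case 0
  have "F \<phi> 0 = 0" using 0(2)[of "[]"] by (simp add: words_upto_def)
  then show ?case by (rule zero_of_counit_multiple[OF bounded_deg_0[OF 0(1)]])
next
  case (Suc D)
  have GD: "\<phi> \<in> graded_dual" using Suc.prems by (simp add: bounded_deg_def)
  have "pre \<phi> a = (\<lambda>_. 0)" if "a \<in> S" for a
  proof (rule Suc.IH[OF bounded_deg_pre[OF Suc.prems(1)]])
    show "F (pre_word (pre \<phi> a) w) 0 = 0" if "w \<in> words_upto S D" for w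
      using Suc.prems(2)[of "a # w"] that \<open>a \<in> S\<close> by (simp add: words_upto_def)
  qed
  then have z: "\<phi> (uemb (gX a b) * u) = 0" for a b u
    using precomp_all_0[OF graded_dualD[OF GD]] by blast
  have "\<phi> u = \<phi> 1 * counit u" for u
  proof (rule clinear_eq_on_gens[OF graded_dualD[OF GD]])
    show "clinear (\<lambda>u. \<phi> 1 * counit u)"
      by (rule clinearI) (simp_all add: clinear_add[OF clinear_counit] clinear_scaleC[OF clinear_counit] scaleC_complex_def algebra_simps)
    show "\<phi> (gens ps) = \<phi> 1 * counit (gens ps)" for ps
      by (cases ps) (auto simp: z counit_mult counit_uemb counit_one)
  qed
  then have eq: "\<phi> = (\<lambda>u. \<phi> 1 * counit u)" by blast
  have "F \<phi> 0 = 0" using Suc.prems(2)[of "[]"] by (simp add: words_upto_def)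
  then show ?case by (rule zero_of_counit_multiple[OF eq])
qed

lemma iota_eq_0:
  assumes GD: "\<phi> \<in> graded_dual" and 0: "\<iota> \<phi> = (\<lambda>e x. 0)"
  shows "\<phi> = (\<lambda>_. 0)"
proof -
  interpret hyperlogs S "ball 0 r" "hyperlog r"
  proof
    show "(hyperlog r (a # w) has_field_derivative hyperlog r w t / (t - a)) (at t)"
      if "a \<in> S" "set w \<subseteq> S" "t \<in> ball 0 r" for a w t
      using that S_outside by (intro hyperlog_deriv(1)) auto
  qed (use r finite_S S_outside in auto)
  obtain D where D: "bounded_deg D \<phi>"
    using GD by (auto simp: bounded_deg_def graded_dual_def)
  \<comment> \<open>The expansion with its constant coefficients is a relation between
    hyperlogarithms, so all these coefficients vanish.\<close>
  define P where "P w = (if w \<in> words_upto S D then [:F (pre_word \<phi> w) 0:] else 0)" for w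
  have "F \<phi> t = 0" for t by (simp add: F_def 0)
  then have "relation D P"
    using F_expansion[OF D] by (auto simp: relation_def P_def mult.commute)
  then have "P w = 0" for w by (rule hyperlogs_independent)
  then have "F (pre_word \<phi> w) 0 = 0" if "w \<in> words_upto S D" for w
    using that unfolding P_def by (metis pCons_eq_0_iff)
  then show ?thesis by (rule functional_zero[OF D])
qed

end

section \<open>Uniqueness and the formal polylogarithms\<close>

lemma iota_injective:
  fixes \<iota> :: "('n::{finite,linorder} idx braid_lie uea \<Rightarrow> complex) \<Rightarrow> 'n logpoly"
  assumes \<iota>: "is_iterated_integral \<iota>" and "\<phi> \<in> graded_dual" "\<psi> \<in> graded_dual" "\<iota> \<phi> = \<iota> \<psi>"
  shows "\<phi> = \<psi>"
proof -
  obtain d :: "'n \<Rightarrow> complex" where d: "\<forall>p\<in>gen_pairs. slope d (fst p) \<noteq> slope d (snd p)" "inj_on (pole d) gen_pairs"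
    using generic_slopes_exist by blast
  obtain r where r: "r > 0" "\<forall>t\<in>ball 0 r. \<forall>k. norm (line_pt d t $ k) < 1 \<and> Re (line_pt d t $ k) > 0 \<and> line_z d k t \<noteq> 0"
    using line_pt_nhd by blast
  interpret line_restriction \<iota> d r
    using \<iota> d r by unfold_locales auto
  define \<eta> where "\<eta> u = \<phi> u + (- 1) * \<psi> u" for u
  have m: "(\<lambda>u. (- 1) * \<psi> u) \<in> graded_dual" by (rule graded_dual_scale[OF assms(3)])
  have "\<eta> \<in> graded_dual" unfolding \<eta>_def by (rule graded_dual_add[OF assms(2) m])
  moreover have "\<iota> \<eta> = (\<lambda>e x. 0)"
    unfolding \<eta>_def iota_add[OF \<iota> assms(2) m] iota_scale[OF \<iota> assms(3)] by (simp add: assms(4))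
  ultimately have "\<eta> = (\<lambda>_. 0)" by (rule iota_eq_0)
  then show ?thesis by (simp add: \<eta>_def fun_eq_iff)
qed

text \<open>The definite description is resolved by \<open>iota_polylog\<close> for existence and
  \<open>iota_injective\<close> for uniqueness; the sign moves to the functional because its square
  is 1.\<close>

lemma formal_polylog_eq:
  fixes \<iota> :: "('n::{finite,linorder} idx braid_lie uea \<Rightarrow> complex) \<Rightarrow> 'n logpoly" and p :: "'n::{finite,linorder} idx braid_lie \<Rightarrow> 'n base braid_lie"
  assumes p: "is_pi_beta p" and s: "is_section p s" and \<iota>: "is_iterated_integral \<iota>"
    and a: "\<forall>i\<in>{1..N}. 1 \<le> a i" and \<kappa>: "mono_on {1..N} \<kappa>"
  shows "formal_polylog \<iota> N a \<kappa> = (\<lambda>u. (- 1) ^ N * word_fun (polylog_word N a \<kappa>) u)"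
  unfolding formal_polylog_def
proof (rule the_equality)
  let ?w = "word_fun (polylog_word N a \<kappa>)"
  have w: "?w \<in> graded_dual" by (rule homogeneous_graded_dual[OF homogeneous_word_fun])
  have l: "(\<lambda>u. (- 1) ^ N * ?w u) \<in> graded_dual" by (rule graded_dual_scale[OF w])
  have "\<iota> (\<lambda>u. (- 1) ^ N * ?w u) = (\<lambda>e x. (- 1) ^ N * \<iota> ?w e x)" by (rule iota_scale[OF \<iota> w])
  also have "\<dots> = logpoly_const (polylog N a \<kappa>)"
    unfolding iota_polylog[OF \<iota> p s a \<kappa>]
    by (auto simp: logpoly_const_def fun_eq_iff mult.assoc[symmetric] power_mult_distrib[symmetric])
  finally have v: "\<iota> (\<lambda>u. (- 1) ^ N * ?w u) = logpoly_const (polylog N a \<kappa>)" .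
  show "(\<lambda>u. (- 1) ^ N * ?w u) \<in> graded_dual \<and> \<iota> (\<lambda>u. (- 1) ^ N * ?w u) = logpoly_const (polylog N a \<kappa>)"
    using l v by simp
  show "l = (\<lambda>u. (- 1) ^ N * ?w u)" if "l \<in> graded_dual \<and> \<iota> l = logpoly_const (polylog N a \<kappa>)" for l
    using that l v iota_injective[OF \<iota>] by simp
qed

theorem theorem2p2:
  fixes \<pi>\<^sub>\<beta> :: "'n::{finite,linorder} idx braid_lie \<Rightarrow> 'n base braid_lie"
    and s :: "'n base braid_lie \<Rightarrow> 'n idx braid_lie"
  assumes "is_pi_beta \<pi>\<^sub>\<beta>" and "is_section \<pi>\<^sub>\<beta> s"
  defines "Uf \<equiv> uea_sub {x. \<pi>\<^sub>\<beta> x = 0}"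
    and "Us \<equiv> uea_left_ideal (range s)"
  shows "direct_sum Uf Us \<and>
    bij_betw word_eval UNIV Uf \<and>
    (\<forall>\<iota> N a \<kappa>. is_iterated_integral \<iota> \<longrightarrow> (\<forall>i\<in>{1..N}. 1 \<le> a i) \<longrightarrow> mono_on {1..N} \<kappa> \<longrightarrow>
       (\<forall>u\<in>Us. formal_polylog \<iota> N a \<kappa> u = 0) \<and>
       (\<forall>u\<in>Uf. formal_polylog \<iota> N a \<kappa> u = (- 1) ^ N * word_coeff (polylog_word N a \<kappa>) u))"
proof (intro conjI allI impI ballI)
  note ps = assms(1,2)
  have Uf: "Uf = range word_eval" unfolding Uf_def by (rule Uf_eq[OF ps])
  show "direct_sum Uf Us" unfolding Uf_def Us_def by (rule uea_direct_sum[OF ps])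
  show "bij_betw word_eval UNIV Uf" unfolding Uf by (rule inj_on_imp_bij_betw[OF inj_word_eval])
  fix \<iota> :: "('n idx braid_lie uea \<Rightarrow> complex) \<Rightarrow> 'n logpoly" and N :: nat and a :: "nat \<Rightarrow> nat" and \<kappa> :: "nat \<Rightarrow> 'n"
  assume h: "is_iterated_integral \<iota>" "\<forall>i\<in>{1..N}. 1 \<le> a i" "mono_on {1..N} \<kappa>"
  note eq = formal_polylog_eq[OF ps h]
  show "formal_polylog \<iota> N a \<kappa> u = 0" if "u \<in> Us" for u
    using fiber_proj_Us[OF ps] that by (simp add: eq word_fun_def Us_def)
  show "formal_polylog \<iota> N a \<kappa> u = (- 1) ^ N * word_coeff (polylog_word N a \<kappa>) u" if "u \<in> Uf" for u
    using word_coeff_eq[OF that[unfolded Uf]] by (simp add: eq word_fun_def)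
qed

end
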